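(* Consider the following four $\mathbb D^2$-contractive Hilbert modules over $\mathbb C[z_1,z_2]$ (with $T_p$, $Y$, $X$, $X_0$, $\mathcal E$ as defined in the context): $HM_1$: $H^2(\mathbb G)$ with the module action $\xi\cdot h=\xi(T_p,Y)h$; $HM_2$: $H^2_{\rm anti}(\mathbb D^2)$ with the module action $\xi\cdot h=\xi(M_{z_1z_2}|_{H^2_{\rm anti}(\mathbb D^2)},X)h$; $HM_3$: $H^2(\mathbb D)\otimes\mathcal E$ with the module action $\xi\cdot h=\xi(T_z\otimes I_{\mathcal E},\,I_{H^2(\mathbb D)}\otimes X_0)h$; $HM_4$: $H^2(\mathbb D^2)$ with the module action $\xi\cdot h=\xi(T_{z_1},T_{z_2})h$. Then these four Hilbert modules are isomorphic: $HM_1\cong HM_2\cong HM_3\cong HM_4$.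
   Context: A Hilbert module over $\mathbb C[z_1,z_2]$ is a Hilbert space $\mathcal H$ which is also a module over $\mathbb C[z_1,z_2]$; it is $\mathbb D^2$-contractive if $\|\xi\cdot h\|\le\|\xi\|_{\infty,\mathbb D^2}\|h\|$ for all polynomials $\xi$ and $h\in\mathcal H$, where $\|\xi\|_{\infty,\mathbb D^2}$ is the supremum of $|\xi|$ over $\mathbb D^2$. Two Hilbert modules $\mathcal H_1,\mathcal H_2$ are isomorphic if there is a unitary $F:\mathcal H_1\to\mathcal H_2$ with $F(\xi\cdot h)=\xi\cdot F(h)$ for all polynomials $\xi$ and all $h\in\mathcal H_1$. $\mathbb D$ is the open unit disc, $\mathbb T$ the unit circle, $m$ the product of normalized arc length measures on $\mathbb T\times\mathbb T$. Let $\pi(z_1,z_2)=(z_1+z_2,z_1z_2)$, $J(z_1,z_2)=z_1-z_2$, $\|J\|^2=\int_{\mathbb T\times\mathbb T}|J|^2dm=2$, and $\mathbb G=\pi(\mathbb D^2)$, with coordinates denoted $(s,p)$. $H^2(\mathbb G)$ is the Hilbert space of holomorphic functions $f$ on $\mathbb G$ with $$\|f\|=\|J\|^{-1}\Big\{\sup_{0<r<1}\int_{\mathbb T\times\mathbb T}|f\circ\pi(r\zeta_1,r\zeta_2)|^2|J(r\zeta_1,r\zeta_2)|^2dm(\zeta_1,\zeta_2)\Big\}^{1/2}<\infty.$$ $T_p$ is the operator of multiplication by the coordinate $p$ on $H^2(\mathbb G)$. $H^2(\mathbb D)$ and $H^2(\mathbb D^2)$ are the usual Hardy spaces of the disc and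 bidisc, $T_z$ is multiplication by $z$ on $H^2(\mathbb D)$, and $T_{z_1},T_{z_2}$ are multiplications by the coordinates on $H^2(\mathbb D^2)$. $H^2_{\rm anti}(\mathbb D^2)=\{f\in H^2(\mathbb D^2): f(z_1,z_2)=-f(z_2,z_1)\}$, and $M_{z_1z_2}|_{H^2_{\rm anti}(\mathbb D^2)}$ is multiplication by $z_1z_2$ on it. $U:H^2(\mathbb G)\to H^2_{\rm anti}(\mathbb D^2)$ is the unitary $Uf=\frac1{\|J\|}J\,(f\circ\pi)$. The functions $(z_1z_2)^i(z_1^j-z_2^j)$, $i\ge0$, $j\ge1$, form an orthogonal basis of $H^2_{\rm anti}(\mathbb D^2)$. $X$ is the bounded operator on $H^2_{\rm anti}(\mathbb D^2)$ determined by $X(z_1z_2)^i(z_1^j-z_2^j)=(z_1z_2)^i(z_1^{j+1}-z_2^{j+1})$ for $i\ge0$, $j\ge1$, and $Y=U^*XU$ on $H^2(\mathbb G)$. $\mathcal E=\overline{\operatorname{span}}\{z_1^j-z_2^j:1\le j<\infty\}\subset H^2_{\rm anti}(\mathbb D^2)$, which is a reducing subspace for $X$, and $X_0=X|_{\mathcal E}$. *)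

theory Defs
  imports
    "HOL-Complex_Analysis.Complex_Analysis"
    "HOL-Probability.Probability"
    "HOL-Library.Function_Algebras"
    "HOL-Computational_Algebra.Polynomial"
begin

text \<open>A complex Hilbert space is carried by a subspace of an ambient complex vector space, so
  that spaces of functions can be used directly. Addition is that of the ambient type.
  Inner products are linear in the first argument.\<close>

record 'a hspace =
  hcarrier :: "'a set"
  hscale :: "complex \<Rightarrow> 'a \<Rightarrow> 'a"
  hinner :: "'a \<Rightarrow> 'a \<Rightarrow> complex"

definition hnorm :: "('a, 'm) hspace_scheme \<Rightarrow> 'a \<Rightarrow> real" where
  "hnorm H x = sqrt (Re (hinner H x x))"

locale hilbert_space = vector_space "hscale H"
  for H :: "('a::ab_group_add, 'm) hspace_scheme" +
  assumes subspace_carrier: "subspace (hcarrier H)"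
    and inner_add_left: "\<lbrakk>x \<in> hcarrier H; y \<in> hcarrier H; z \<in> hcarrier H\<rbrakk>
      \<Longrightarrow> hinner H (x + y) z = hinner H x z + hinner H y z"
    and inner_scale_left: "\<lbrakk>x \<in> hcarrier H; y \<in> hcarrier H\<rbrakk>
      \<Longrightarrow> hinner H (hscale H c x) y = c * hinner H x y"
    and inner_commute: "\<lbrakk>x \<in> hcarrier H; y \<in> hcarrier H\<rbrakk>
      \<Longrightarrow> hinner H y x = cnj (hinner H x y)"
    and inner_nonneg: "x \<in> hcarrier H \<Longrightarrow> 0 \<le> Re (hinner H x x)"
    and inner_definite: "\<lbrakk>x \<in> hcarrier H; hinner H x x = 0\<rbrakk> \<Longrightarrow> x = 0"
    and complete: "\<lbrakk>\<And>n. u n \<in> hcarrier H;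
        \<And>e. e > 0 \<Longrightarrow> \<exists>N. \<forall>m\<ge>N. \<forall>n\<ge>N. hnorm H (u m - u n) < e\<rbrakk>
      \<Longrightarrow> \<exists>l\<in>hcarrier H. (\<lambda>n. hnorm H (u n - l)) \<longlonglongrightarrow> 0"

definition hlinear ::
    "('a::ab_group_add, 'm) hspace_scheme \<Rightarrow> ('b::ab_group_add, 'n) hspace_scheme \<Rightarrow> ('a \<Rightarrow> 'b) \<Rightarrow> bool" where
  "hlinear H K T \<longleftrightarrow>
     (\<forall>x\<in>hcarrier H. T x \<in> hcarrier K) \<and>
     (\<forall>x\<in>hcarrier H. \<forall>y\<in>hcarrier H. T (x + y) = T x + T y) \<and>
     (\<forall>c. \<forall>x\<in>hcarrier H. T (hscale H c x) = hscale K c (T x))"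

text \<open>Bounded operators are extensional, so that they are determined by their values on the
  carrier and can be introduced by definite description.\<close>

definition bounded_ops ::
    "('a::ab_group_add, 'm) hspace_scheme \<Rightarrow> ('b::ab_group_add, 'n) hspace_scheme \<Rightarrow> ('a \<Rightarrow> 'b) set" where
  "bounded_ops H K = {T \<in> extensional (hcarrier H).
     hlinear H K T \<and> (\<exists>C. \<forall>x\<in>hcarrier H. hnorm K (T x) \<le> C * hnorm H x)}"

definition adjoint_op ::
    "('a::ab_group_add, 'm) hspace_scheme \<Rightarrow> ('b::ab_group_add, 'n) hspace_scheme \<Rightarrow> ('a \<Rightarrow> 'b) \<Rightarrow> 'b \<Rightarrow> 'a" where
  "adjoint_op H K T = (THE S. S \<in> bounded_ops K H \<and>
     (\<forall>x\<in>hcarrier H. \<forall>y\<in>hcarrier K. hinner K (T x) y = hinner H x (S y)))"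

definition unitary_map ::
    "('a::ab_group_add, 'm) hspace_scheme \<Rightarrow> ('b::ab_group_add, 'n) hspace_scheme \<Rightarrow> ('a \<Rightarrow> 'b) \<Rightarrow> bool" where
  "unitary_map H K F \<longleftrightarrow> hlinear H K F \<and> bij_betw F (hcarrier H) (hcarrier K) \<and>
     (\<forall>x\<in>hcarrier H. \<forall>y\<in>hcarrier H. hinner K (F x) (F y) = hinner H x y)"

definition closed_span :: "('a::ab_group_add, 'm) hspace_scheme \<Rightarrow> 'a set \<Rightarrow> 'a set" where
  "closed_span H S =
     {x \<in> hcarrier H. \<forall>e>0. \<exists>y\<in>module.span (hscale H) S. hnorm H (x - y) < e}"

definition fun_scale :: "complex \<Rightarrow> ('x \<Rightarrow> complex) \<Rightarrow> 'x \<Rightarrow> complex" where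
  "fun_scale c f = (\<lambda>x. c * f x)"

text \<open>A Hilbert space of functions given by its norm \<open>N\<close>; the inner product is recovered from
  \<open>N\<close> by polarization.\<close>

definition hspace_of_norm :: "('x \<Rightarrow> complex) set \<Rightarrow> (('x \<Rightarrow> complex) \<Rightarrow> real) \<Rightarrow> ('x \<Rightarrow> complex) hspace" where
  "hspace_of_norm V N = \<lparr>hcarrier = V, hscale = fun_scale,
     hinner = (\<lambda>f g. (\<Sum>k<4. \<i> ^ k * complex_of_real ((N (f + fun_scale (\<i> ^ k) g))\<^sup>2)) / 4)\<rparr>"

text \<open>\<open>complex poly poly\<close> stands for \<open>\<complex>[z\<^sub>1, z\<^sub>2]\<close>: the outer variable is \<open>z\<^sub>1\<close>,
  the inner one \<open>z\<^sub>2\<close>, so that the coefficient of \<open>z\<^sub>1^i z\<^sub>2^j\<close> in \<open>\<xi>\<close> is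
  \<open>coeff (coeff \<xi> i) j\<close>.\<close>

type_synonym poly2 = "complex poly poly"

definition eval2 :: "poly2 \<Rightarrow> complex \<times> complex \<Rightarrow> complex" where
  "eval2 \<xi> z = poly (poly \<xi> [:fst z:]) (snd z)"

definition bidisc :: "(complex \<times> complex) set" where
  "bidisc = ball 0 1 \<times> ball 0 1"

definition supnorm_bidisc :: "poly2 \<Rightarrow> real" where
  "supnorm_bidisc \<xi> = (SUP z\<in>bidisc. cmod (eval2 \<xi> z))"

record 'a hmodule = "'a hspace" +
  act :: "poly2 \<Rightarrow> 'a \<Rightarrow> 'a"

locale hilbert_module = hilbert_space M
  for M :: "('a::ab_group_add, 'm) hmodule_scheme" +
  assumes act_closed: "h \<in> hcarrier M \<Longrightarrow> act M \<xi> h \<in> hcarrier M"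
    and act_add_right: "\<lbrakk>h \<in> hcarrier M; k \<in> hcarrier M\<rbrakk>
      \<Longrightarrow> act M \<xi> (h + k) = act M \<xi> h + act M \<xi> k"
    and act_add_left: "h \<in> hcarrier M \<Longrightarrow> act M (\<xi> + \<eta>) h = act M \<xi> h + act M \<eta> h"
    and act_mult: "h \<in> hcarrier M \<Longrightarrow> act M (\<xi> * \<eta>) h = act M \<xi> (act M \<eta> h)"
    and act_const: "h \<in> hcarrier M \<Longrightarrow> act M [:[:c:]:] h = hscale M c h"

definition bidisc_contractive :: "('a::ab_group_add, 'm) hmodule_scheme \<Rightarrow> bool" where
  "bidisc_contractive M \<longleftrightarrow>
     (\<forall>\<xi>. \<forall>h\<in>hcarrier M. hnorm M (act M \<xi> h) \<le> supnorm_bidisc \<xi> * hnorm M h)"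

definition hmodule_iso ::
    "('a::ab_group_add, 'm) hmodule_scheme \<Rightarrow> ('b::ab_group_add, 'n) hmodule_scheme \<Rightarrow> bool"
    (infix \<open>\<cong>\<^sub>H\<close> 50) where
  "M \<cong>\<^sub>H N \<longleftrightarrow> (\<exists>F. unitary_map M N F \<and>
     (\<forall>\<xi>. \<forall>h\<in>hcarrier M. F (act M \<xi> h) = act N \<xi> (F h)))"

definition op_poly2 :: "('a::ab_group_add) hspace \<Rightarrow> poly2 \<Rightarrow> ('a \<Rightarrow> 'a) \<Rightarrow> ('a \<Rightarrow> 'a) \<Rightarrow> 'a \<Rightarrow> 'a" where
  "op_poly2 H \<xi> A B h = (\<Sum>i\<le>degree \<xi>. \<Sum>j\<le>degree (coeff \<xi> i).
     hscale H (coeff (coeff \<xi> i) j) ((A ^^ i) ((B ^^ j) h)))"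

definition hmodule_of_ops :: "('a::ab_group_add) hspace \<Rightarrow> ('a \<Rightarrow> 'a) \<Rightarrow> ('a \<Rightarrow> 'a) \<Rightarrow> 'a hmodule" where
  "hmodule_of_ops H A B = hspace.extend H \<lparr>act = (\<lambda>\<xi>. op_poly2 H \<xi> A B)\<rparr>"

text \<open>Following Kadison and Ringrose, \<open>H \<otimes> K\<close> is realised as the space of Hilbert-Schmidt
  functionals on \<open>H \<times> K\<close>, conjugate-linear in each argument: a tensor \<open>u\<close> is identified with
  \<open>\<lambda>(x, y). \<langle>u, x \<otimes> y\<rangle>\<close>. The squared norm, that is the sum of \<open>\<bar>\<phi>(x, y)\<bar>\<^sup>2\<close> over orthonormal
  bases, is written as a supremum over finite orthonormal sets; finiteness of this supremum
  entails boundedness of the functional. Functionals vanish off \<open>H \<times> K\<close>.\<close>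

definition orthonormal :: "('a, 'm) hspace_scheme \<Rightarrow> 'a set \<Rightarrow> bool" where
  "orthonormal H A \<longleftrightarrow> A \<subseteq> hcarrier H \<and>
     (\<forall>x\<in>A. \<forall>y\<in>A. hinner H x y = (if x = y then 1 else 0))"

definition hs_norm_sq :: "'a hspace \<Rightarrow> 'b hspace \<Rightarrow> ('a \<times> 'b \<Rightarrow> complex) \<Rightarrow> ennreal" where
  "hs_norm_sq H K \<phi> =
     (SUP (A, B) \<in> {A. finite A \<and> orthonormal H A} \<times> {B. finite B \<and> orthonormal K B}.
        \<Sum>p\<in>A \<times> B. ennreal ((cmod (\<phi> p))\<^sup>2))"

definition hs_functionals ::
    "('a::ab_group_add) hspace \<Rightarrow> ('b::ab_group_add) hspace \<Rightarrow> ('a \<times> 'b \<Rightarrow> complex) set" where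
  "hs_functionals H K = {\<phi>.
     (\<forall>p. p \<notin> hcarrier H \<times> hcarrier K \<longrightarrow> \<phi> p = 0) \<and>
     (\<forall>x\<in>hcarrier H. \<forall>x'\<in>hcarrier H. \<forall>y\<in>hcarrier K. \<phi> (x + x', y) = \<phi> (x, y) + \<phi> (x', y)) \<and>
     (\<forall>x\<in>hcarrier H. \<forall>y\<in>hcarrier K. \<forall>y'\<in>hcarrier K. \<phi> (x, y + y') = \<phi> (x, y) + \<phi> (x, y')) \<and>
     (\<forall>c. \<forall>x\<in>hcarrier H. \<forall>y\<in>hcarrier K.
        \<phi> (hscale H c x, y) = cnj c * \<phi> (x, y) \<and> \<phi> (x, hscale K c y) = cnj c * \<phi> (x, y)) \<and>
     hs_norm_sq H K \<phi> < \<infinity>}"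

definition htensor ::
    "('a::ab_group_add) hspace \<Rightarrow> ('b::ab_group_add) hspace \<Rightarrow> ('a \<times> 'b \<Rightarrow> complex) hspace" where
  "htensor H K =
     hspace_of_norm (hs_functionals H K) (\<lambda>\<phi>. sqrt (enn2real (hs_norm_sq H K \<phi>)))"

definition elem_tensor :: "'a hspace \<Rightarrow> 'b hspace \<Rightarrow> 'a \<Rightarrow> 'b \<Rightarrow> 'a \<times> 'b \<Rightarrow> complex" where
  "elem_tensor H K a b = (\<lambda>(x, y).
     if x \<in> hcarrier H \<and> y \<in> hcarrier K then hinner H a x * hinner K b y else 0)"

definition tensor_op :: "('a::ab_group_add) hspace \<Rightarrow> ('b::ab_group_add) hspace \<Rightarrow>
    ('a \<Rightarrow> 'a) \<Rightarrow> ('b \<Rightarrow> 'b) \<Rightarrow> ('a \<times> 'b \<Rightarrow> complex) \<Rightarrow> 'a \<times> 'b \<Rightarrow> complex" where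
  "tensor_op H K A B = (THE T. T \<in> bounded_ops (htensor H K) (htensor H K) \<and>
     (\<forall>a\<in>hcarrier H. \<forall>b\<in>hcarrier K.
        T (elem_tensor H K a b) = elem_tensor H K (A a) (B b)))"

text \<open>A function on a domain is represented by its extension by zero.\<close>

definition zero_off :: "'x set \<Rightarrow> ('x \<Rightarrow> complex) \<Rightarrow> bool" where
  "zero_off S f \<longleftrightarrow> (\<forall>x. x \<notin> S \<longrightarrow> f x = 0)"

definition cut :: "'x set \<Rightarrow> ('x \<Rightarrow> complex) \<Rightarrow> 'x \<Rightarrow> complex" where
  "cut S f = (\<lambda>x. if x \<in> S then f x else 0)"

definition holomorphic2_on :: "(complex \<times> complex \<Rightarrow> complex) \<Rightarrow> (complex \<times> complex) set \<Rightarrow> bool"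
    (infixl \<open>holomorphic2'_on\<close> 50) where
  "f holomorphic2_on S \<longleftrightarrow>
     (\<forall>z\<in>S. \<exists>a b. (f has_derivative (\<lambda>(h, k). a * h + b * k)) (at z within S))"

definition circle_measure :: "complex measure" where
  "circle_measure = distr (uniform_measure lborel {0..2 * pi}) borel cis"

definition torus_measure :: "(complex \<times> complex) measure" where
  "torus_measure = circle_measure \<Otimes>\<^sub>M circle_measure"

definition mean_sq1 :: "(complex \<Rightarrow> complex) \<Rightarrow> ennreal" where
  "mean_sq1 f = (SUP r\<in>{0<..<1::real}.
     \<integral>\<^sup>+ \<zeta>. ennreal ((cmod (f (of_real r * \<zeta>)))\<^sup>2) \<partial>circle_measure)"

definition mean_sq2 :: "(complex \<times> complex \<Rightarrow> complex) \<Rightarrow> ennreal" where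
  "mean_sq2 f = (SUP r\<in>{0<..<1::real}.
     \<integral>\<^sup>+ \<zeta>. ennreal ((cmod (f (of_real r * fst \<zeta>, of_real r * snd \<zeta>)))\<^sup>2) \<partial>torus_measure)"

definition H2_disc :: "(complex \<Rightarrow> complex) hspace" where
  "H2_disc = hspace_of_norm
     {f. f holomorphic_on ball 0 1 \<and> zero_off (ball 0 1) f \<and> mean_sq1 f < \<infinity>}
     (\<lambda>f. sqrt (enn2real (mean_sq1 f)))"

definition H2_bidisc :: "(complex \<times> complex \<Rightarrow> complex) hspace" where
  "H2_bidisc = hspace_of_norm
     {f. f holomorphic2_on bidisc \<and> zero_off bidisc f \<and> mean_sq2 f < \<infinity>}
     (\<lambda>f. sqrt (enn2real (mean_sq2 f)))"

definition H2_anti :: "(complex \<times> complex \<Rightarrow> complex) hspace" where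
  "H2_anti = H2_bidisc
     \<lparr>hcarrier := {f \<in> hcarrier H2_bidisc. \<forall>z\<^sub>1 z\<^sub>2. f (z\<^sub>1, z\<^sub>2) = - f (z\<^sub>2, z\<^sub>1)}\<rparr>"

definition sym_map :: "complex \<times> complex \<Rightarrow> complex \<times> complex" where
  "sym_map = (\<lambda>(z\<^sub>1, z\<^sub>2). (z\<^sub>1 + z\<^sub>2, z\<^sub>1 * z\<^sub>2))"

definition J :: "complex \<times> complex \<Rightarrow> complex" where
  "J = (\<lambda>(z\<^sub>1, z\<^sub>2). z\<^sub>1 - z\<^sub>2)"

definition J_norm :: real where
  "J_norm = sqrt (\<integral>\<zeta>. (cmod (J \<zeta>))\<^sup>2 \<partial>torus_measure)"

definition symm_bidisc :: "(complex \<times> complex) set" where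
  "symm_bidisc = sym_map ` bidisc"

definition H2_sym :: "(complex \<times> complex \<Rightarrow> complex) hspace" where
  "H2_sym = hspace_of_norm
     {f. f holomorphic2_on symm_bidisc \<and> zero_off symm_bidisc f \<and>
         mean_sq2 (\<lambda>z. f (sym_map z) * J z) < \<infinity>}
     (\<lambda>f. inverse J_norm * sqrt (enn2real (mean_sq2 (\<lambda>z. f (sym_map z) * J z))))"

definition mult_op :: "('x \<Rightarrow> complex) hspace \<Rightarrow> ('x \<Rightarrow> complex) \<Rightarrow> ('x \<Rightarrow> complex) \<Rightarrow> 'x \<Rightarrow> complex" where
  "mult_op H \<phi> = restrict (\<lambda>f x. \<phi> x * f x) (hcarrier H)"

definition U_op :: "(complex \<times> complex \<Rightarrow> complex) \<Rightarrow> complex \<times> complex \<Rightarrow> complex" where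
  "U_op = restrict
     (\<lambda>f. cut bidisc (\<lambda>z. of_real (1 / J_norm) * J z * f (sym_map z))) (hcarrier H2_sym)"

definition anti_basis :: "nat \<Rightarrow> nat \<Rightarrow> complex \<times> complex \<Rightarrow> complex" where
  "anti_basis i j = cut bidisc (\<lambda>(z\<^sub>1, z\<^sub>2). (z\<^sub>1 * z\<^sub>2) ^ i * (z\<^sub>1 ^ j - z\<^sub>2 ^ j))"

definition X_op :: "(complex \<times> complex \<Rightarrow> complex) \<Rightarrow> complex \<times> complex \<Rightarrow> complex" where
  "X_op = (THE X. X \<in> bounded_ops H2_anti H2_anti \<and>
     (\<forall>i j. j \<ge> 1 \<longrightarrow> X (anti_basis i j) = anti_basis i (j + 1)))"

definition Y_op :: "(complex \<times> complex \<Rightarrow> complex) \<Rightarrow> complex \<times> complex \<Rightarrow> complex" where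
  "Y_op = restrict (\<lambda>f. adjoint_op H2_sym H2_anti U_op (X_op (U_op f))) (hcarrier H2_sym)"

definition E_space :: "(complex \<times> complex \<Rightarrow> complex) hspace" where
  "E_space = H2_anti \<lparr>hcarrier := closed_span H2_anti {anti_basis 0 j | j. j \<ge> 1}\<rparr>"

definition X0_op :: "(complex \<times> complex \<Rightarrow> complex) \<Rightarrow> complex \<times> complex \<Rightarrow> complex" where
  "X0_op = restrict X_op (hcarrier E_space)"

definition HM1 :: "(complex \<times> complex \<Rightarrow> complex) hmodule" where
  "HM1 = hmodule_of_ops H2_sym (mult_op H2_sym snd) Y_op"

definition HM2 :: "(complex \<times> complex \<Rightarrow> complex) hmodule" where
  "HM2 = hmodule_of_ops H2_anti (mult_op H2_anti (\<lambda>(z\<^sub>1, z\<^sub>2). z\<^sub>1 * z\<^sub>2)) X_op"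

definition HM3 :: "((complex \<Rightarrow> complex) \<times> (complex \<times> complex \<Rightarrow> complex) \<Rightarrow> complex) hmodule" where
  "HM3 = hmodule_of_ops (htensor H2_disc E_space)
     (tensor_op H2_disc E_space (mult_op H2_disc (\<lambda>z. z)) (\<lambda>h. h))
     (tensor_op H2_disc E_space (\<lambda>h. h) X0_op)"

definition HM4 :: "(complex \<times> complex \<Rightarrow> complex) hmodule" where
  "HM4 = hmodule_of_ops H2_bidisc (mult_op H2_bidisc fst) (mult_op H2_bidisc snd)"

end

theory Submission
  imports Defs
begin

text \<open>Each of the four modules is unitarily equivalent to square-summable families indexed by pairs
  \<open>(i, j)\<close>, with \<open>z\<^sub>1\<close> and \<open>z\<^sub>2\<close> acting as the shifts of \<open>i\<close> and \<open>j\<close>; the orthonormal bases are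
  \<open>p ^ i h\<^sub>j(s, p)\<close> in \<open>H\<^sup>2(G)\<close>, where \<open>h\<^sub>j\<close> is the complete homogeneous polynomial
  \<open>(z\<^sub>1 ^ (j + 1) - z\<^sub>2 ^ (j + 1)) / (z\<^sub>1 - z\<^sub>2)\<close> written in \<open>s\<close> and \<open>p\<close>,
  \<open>(z\<^sub>1 z\<^sub>2) ^ i (z\<^sub>1 ^ (j + 1) - z\<^sub>2 ^ (j + 1)) / \<surd>2\<close> in \<open>H\<^sup>2\<^sub>a\<^sub>n\<^sub>t\<^sub>i\<close>, elementary tensors of basis
  vectors in \<open>H\<^sup>2(D) \<otimes> E\<close>, and the monomials in \<open>H\<^sup>2(D\<^sup>2)\<close>. On \<open>H\<^sup>2(D\<^sup>2)\<close> a polynomial \<open>\<xi>\<close> acts by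
  pointwise multiplication, so there the module axioms and \<open>D\<^sup>2\<close>-contractivity are immediate; they
  carry over to the other three modules.\<close>

subsection \<open>Square-summable families\<close>

text \<open>Two obstacles shape the proof. \<open>X_op\<close>, \<open>tensor_op\<close> and
  \<open>adjoint_op\<close> are definite descriptions, so nothing can be computed with them before a
  bounded operator with the prescribed property is exhibited and shown to be unique. In coordinates,
  existence amounts to an explicit map between square-summable families, and for \<open>X_op\<close>
  and \<open>tensor_op\<close> uniqueness is a density argument. The other obstacle is that the
  orthonormal bases must be complete. On the bidisc, complex differentiability has to yield a double
  power series, and conversely such a series has to be differentiable in both variables jointly;
  both directions rest on Cauchy estimates. On \<open>symm_bidisc\<close>, an antisymmetric function
  has to be divided by \<open>J\<close>, which vanishes on the diagonal. The quotients h_j are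
  therefore given by a recursion in s and p, their series is summed on the whole open set
  \<open>symm_bidisc\<close>, and agreement with a given function on the diagonal comes from
  continuity. Taking \<open>l2\<close> as the model also makes its completeness the only one to be
  proved by hand.\<close>

definition l2 :: "('i \<Rightarrow> complex) hspace" where
  "l2 = \<lparr>hcarrier = {a. (\<lambda>i. (cmod (a i))\<^sup>2) summable_on UNIV}, hscale = fun_scale,
     hinner = (\<lambda>a b. \<Sum>\<^sub>\<infinity>i. a i * cnj (b i))\<rparr>"

definition unit_seq :: "'i \<Rightarrow> 'i \<Rightarrow> complex" where
  "unit_seq i = (\<lambda>k. if k = i then 1 else 0)"

lemma hscale_l2 [simp]: "hscale l2 = fun_scale"
  by (simp add: l2_def)

lemma l2_iff: "a \<in> hcarrier l2 \<longleftrightarrow> (\<lambda>i. (cmod (a i))\<^sup>2) summable_on UNIV"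
  by (simp add: l2_def)

lemma hinner_l2: "hinner l2 a b = (\<Sum>\<^sub>\<infinity>i. a i * cnj (b i))"
  by (simp add: l2_def)

lemma vector_space_fun_scale: "vector_space (fun_scale :: complex \<Rightarrow> ('x \<Rightarrow> complex) \<Rightarrow> _)"
  by unfold_locales (auto simp: fun_scale_def fun_eq_iff algebra_simps)

lemma fun_scale_simps [simp]:
  "fun_scale c f x = c * f x" "fun_scale 1 f = f" "fun_scale 0 f = 0" "fun_scale c 0 = 0"
  by (auto simp: fun_scale_def fun_eq_iff)

lemma l2_prod_abs:
  assumes "a \<in> hcarrier l2" "b \<in> hcarrier l2"
  shows "(\<lambda>i. cmod (a i * b i)) summable_on UNIV"
  by (rule abs_summable_product) (use assms in \<open>simp_all add: l2_iff norm_mult power2_eq_square\<close>)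

lemma l2_prod_summable:
  assumes "a \<in> hcarrier l2" "b \<in> hcarrier l2"
  shows "(\<lambda>i. a i * cnj (b i)) summable_on UNIV"
proof -
  have "(\<lambda>i. cnj (b i)) \<in> hcarrier l2" using assms by (simp add: l2_iff)
  from l2_prod_abs[OF assms(1) this] show ?thesis by (rule abs_summable_summable)
qed

lemma l2_add: "a \<in> hcarrier l2 \<Longrightarrow> b \<in> hcarrier l2 \<Longrightarrow> a + b \<in> hcarrier l2"
proof -
  assume ab: "a \<in> hcarrier l2" "b \<in> hcarrier l2"
  have "(\<lambda>i. 2 * (cmod (a i))\<^sup>2 + 2 * (cmod (b i))\<^sup>2) summable_on UNIV"
    using ab by (intro summable_on_add summable_on_cmult_right) (auto simp: l2_iff)
  moreover have "(cmod (a i + b i))\<^sup>2 \<le> 2 * (cmod (a i))\<^sup>2 + 2 * (cmod (b i))\<^sup>2" for i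
  proof -
    have "(cmod (a i + b i))\<^sup>2 \<le> (cmod (a i) + cmod (b i))\<^sup>2"
      by (intro power_mono norm_triangle_ineq) auto
    also have "\<dots> \<le> 2 * (cmod (a i))\<^sup>2 + 2 * (cmod (b i))\<^sup>2"
      using sum_squares_bound[of "cmod (a i)" "cmod (b i)"] by (simp add: power2_sum)
    finally show ?thesis .
  qed
  ultimately show ?thesis
    unfolding l2_iff by (elim summable_on_comparison_test) auto
qed

lemma l2_scale: "a \<in> hcarrier l2 \<Longrightarrow> fun_scale c a \<in> hcarrier l2"
  unfolding l2_iff by (simp add: norm_mult power_mult_distrib summable_on_cmult_right)

lemma l2_0: "0 \<in> hcarrier l2"
  by (simp add: l2_iff)

lemma l2_diff: "a \<in> hcarrier l2 \<Longrightarrow> b \<in> hcarrier l2 \<Longrightarrow> a - b \<in> hcarrier l2"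
  using l2_add[of a "fun_scale (-1) b"] l2_scale[of b "-1"]
  by (simp add: fun_scale_def fun_diff_def plus_fun_def)

lemma hinner_l2_self:
  assumes "a \<in> hcarrier l2"
  shows "hinner l2 a a = of_real (\<Sum>\<^sub>\<infinity>i. (cmod (a i))\<^sup>2)"
proof -
  have "((\<lambda>i. (cmod (a i))\<^sup>2) has_sum (\<Sum>\<^sub>\<infinity>i. (cmod (a i))\<^sup>2)) UNIV"
    using assms by (simp add: l2_iff)
  then have "((\<lambda>i. complex_of_real ((cmod (a i))\<^sup>2)) has_sum of_real (\<Sum>\<^sub>\<infinity>i. (cmod (a i))\<^sup>2)) UNIV"
    by (rule has_sum_of_real)
  moreover have "a i * cnj (a i) = complex_of_real ((cmod (a i))\<^sup>2)" for i
    by (rule complex_norm_square[symmetric])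
  ultimately show ?thesis by (simp only: hinner_l2 infsumI)
qed

lemma hnorm_l2: "a \<in> hcarrier l2 \<Longrightarrow> hnorm l2 a = sqrt (\<Sum>\<^sub>\<infinity>i. (cmod (a i))\<^sup>2)"
  by (simp add: hnorm_def hinner_l2_self)

lemma hnorm_l2_sq: "a \<in> hcarrier l2 \<Longrightarrow> (hnorm l2 a)\<^sup>2 = (\<Sum>\<^sub>\<infinity>i. (cmod (a i))\<^sup>2)"
  by (simp add: hnorm_l2 infsum_nonneg)

lemma hnorm_l2_nonneg: "a \<in> hcarrier l2 \<Longrightarrow> 0 \<le> hnorm l2 a"
  by (simp add: hnorm_l2 infsum_nonneg)

lemma l2_sum_le:
  assumes "a \<in> hcarrier l2" "finite F"
  shows "(\<Sum>i\<in>F. (cmod (a i))\<^sup>2) \<le> (hnorm l2 a)\<^sup>2"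
  using assms by (auto simp: hnorm_l2_sq l2_iff intro!: finite_sum_le_infsum)

lemma l2_coord_le: "a \<in> hcarrier l2 \<Longrightarrow> cmod (a i) \<le> hnorm l2 a"
  using l2_sum_le[of a "{i}"] by (auto intro: power2_le_imp_le hnorm_l2_nonneg)

text \<open>Only finite partial sums survive a pointwise limit, so membership and the norm bound are
  both extracted from a uniform bound on these.\<close>

lemma l2I:
  assumes "\<And>F. finite F \<Longrightarrow> (\<Sum>i\<in>F. (cmod (a i))\<^sup>2) \<le> C\<^sup>2" "0 \<le> C"
  shows "a \<in> hcarrier l2" "hnorm l2 a \<le> C"
proof -
  show *: "a \<in> hcarrier l2" unfolding l2_iff
    by (rule nonneg_bdd_above_summable_on) (use assms in \<open>auto intro!: bdd_aboveI2\<close>)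
  have "(hnorm l2 a)\<^sup>2 \<le> C\<^sup>2" unfolding hnorm_l2_sq[OF *]
    by (rule infsum_le_finite_sums) (use * in \<open>simp add: l2_iff\<close>, rule assms(1))
  then show "hnorm l2 a \<le> C" using assms(2) by (rule power2_le_imp_le)
qed

lemma hilbert_space_l2: "hilbert_space (l2 :: ('i \<Rightarrow> complex) hspace)"
proof -
  interpret V: vector_space "fun_scale :: complex \<Rightarrow> ('i \<Rightarrow> complex) \<Rightarrow> _"
    by (rule vector_space_fun_scale)
  have sub: "V.subspace (hcarrier l2)"
    by (auto simp: V.subspace_def intro: l2_add l2_scale l2_0)
  show ?thesis
  proof (unfold_locales, simp_all add: V.scale_right_distrib V.scale_left_distrib)
    show "module.subspace fun_scale (hcarrier l2 :: ('i \<Rightarrow> complex) set)"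
      by (rule sub)
  next
    fix x y z :: "'i \<Rightarrow> complex"
    assume "x \<in> hcarrier l2" "y \<in> hcarrier l2" "z \<in> hcarrier l2"
    then show "hinner l2 (x + y) z = hinner l2 x z + hinner l2 y z"
      by (simp add: hinner_l2 distrib_right infsum_add l2_prod_summable)
  next
    fix x y :: "'i \<Rightarrow> complex" and c
    show "hinner l2 (fun_scale c x) y = c * hinner l2 x y"
      by (simp add: hinner_l2 mult.assoc infsum_cmult_right')
  next
    fix x y :: "'i \<Rightarrow> complex"
    show "hinner l2 y x = cnj (hinner l2 x y)"
      by (simp add: hinner_l2 mult.commute flip: infsum_cnj)
  next
    fix x :: "'i \<Rightarrow> complex"
    assume x: "x \<in> hcarrier l2"
    show "0 \<le> Re (hinner l2 x x)" using x by (simp add: hinner_l2_self infsum_nonneg)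
    assume 0: "hinner l2 x x = 0"
    have "hnorm l2 x = 0" by (simp add: hnorm_def 0)
    then show "x = 0" using l2_coord_le[OF x] by (auto simp: fun_eq_iff)
  next
    fix u :: "nat \<Rightarrow> 'i \<Rightarrow> complex"
    assume u: "\<And>n. u n \<in> hcarrier l2"
      and C: "\<And>e. e > 0 \<Longrightarrow> \<exists>N. \<forall>m\<ge>N. \<forall>n\<ge>N. hnorm l2 (u m - u n) < e"
    have "\<exists>L. (\<lambda>n. u n i) \<longlonglongrightarrow> L" for i
    proof -
      have "Cauchy (\<lambda>n. u n i)"
      proof (rule CauchyI)
        fix e :: real assume "e > 0"
        then obtain N where N: "\<And>m n. m \<ge> N \<Longrightarrow> n \<ge> N \<Longrightarrow> hnorm l2 (u m - u n) < e"
          using C by blast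
        have "norm (u m i - u n i) < e" if "m \<ge> N" "n \<ge> N" for m n
          using l2_coord_le[OF l2_diff[OF u[of m] u[of n]], of i] N[OF that] by simp
        then show "\<exists>M. \<forall>m\<ge>M. \<forall>n\<ge>M. norm (u m i - u n i) < e" by blast
      qed
      then show ?thesis by (simp add: Cauchy_convergent_iff convergent_def)
    qed
    then obtain l where l: "\<And>i. (\<lambda>n. u n i) \<longlonglongrightarrow> l i" by metis
    \<comment> \<open>The bound passes to the limit m -> infinity inside a fixed finite sum. It
      yields membership of \<open>u n - l\<close> first; that of \<open>l\<close> follows by
      subtracting from \<open>u N\<close>.\<close>
    have *: "\<exists>N. \<forall>n\<ge>N. u n - l \<in> hcarrier l2 \<and> hnorm l2 (u n - l) \<le> e" if "e > 0" for e
    proof -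
      obtain N where N: "\<And>m n. m \<ge> N \<Longrightarrow> n \<ge> N \<Longrightarrow> hnorm l2 (u m - u n) < e"
        using C \<open>e > 0\<close> by blast
      have "(\<Sum>i\<in>F. (cmod ((u n - l) i))\<^sup>2) \<le> e\<^sup>2" if "n \<ge> N" "finite F" for n F
      proof (rule LIMSEQ_le_const2)
        show "(\<lambda>m. \<Sum>i\<in>F. (cmod ((u n - u m) i))\<^sup>2) \<longlonglongrightarrow> (\<Sum>i\<in>F. (cmod ((u n - l) i))\<^sup>2)"
          unfolding fun_diff_def by (intro tendsto_intros l)
        have "(\<Sum>i\<in>F. (cmod ((u n - u m) i))\<^sup>2) \<le> e\<^sup>2" if "m \<ge> N" for m
        proof -
          have "(hnorm l2 (u n - u m))\<^sup>2 \<le> e\<^sup>2"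
            using N[OF \<open>n \<ge> N\<close> that] by (intro power_mono hnorm_l2_nonneg l2_diff u) auto
          then show ?thesis using l2_sum_le[OF l2_diff[OF u u] \<open>finite F\<close>] by (rule order_trans[rotated])
        qed
        then show "\<exists>N. \<forall>m\<ge>N. (\<Sum>i\<in>F. (cmod ((u n - u m) i))\<^sup>2) \<le> e\<^sup>2" by blast
      qed
      from l2I[OF this less_imp_le[OF that]] show ?thesis by blast
    qed
    obtain N where "u N - l \<in> hcarrier l2" using *[of 1] by auto
    from l2_diff[OF u[of N] this] have "l \<in> hcarrier l2" by simp
    moreover have "(\<lambda>n. hnorm l2 (u n - l)) \<longlonglongrightarrow> 0"
    proof (rule LIMSEQ_I)
      fix r :: real assume "r > 0"
      then obtain N where N: "\<And>n. n \<ge> N \<Longrightarrow> u n - l \<in> hcarrier l2 \<and> hnorm l2 (u n - l) \<le> r / 2"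
        using *[of "r / 2"] by auto
      have "norm (hnorm l2 (u n - l) - 0) < r" if "n \<ge> N" for n
        using N[OF that] hnorm_l2_nonneg[of "u n - l"] \<open>r > 0\<close> by simp
      then show "\<exists>N. \<forall>n\<ge>N. norm (hnorm l2 (u n - l) - 0) < r" by blast
    qed
    ultimately show "\<exists>l\<in>hcarrier l2. (\<lambda>n. hnorm l2 (u n - l)) \<longlonglongrightarrow> 0" by blast
  qed
qed

interpretation l2: hilbert_space "l2 :: ('i \<Rightarrow> complex) hspace"
  by (rule hilbert_space_l2)

section \<open>Coordinate vectors and density of finitely supported families\<close>

lemma unit_seq_finite_sum: "(\<Sum>\<^sub>\<infinity>k. g k * unit_seq i k) = g i"
proof -
  have "(\<Sum>\<^sub>\<infinity>k. g k * unit_seq i k) = (\<Sum>\<^sub>\<infinity>k\<in>{i}. g k * unit_seq i k)"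
    by (rule infsum_cong_neutral) (auto simp: unit_seq_def)
  then show ?thesis by (simp add: unit_seq_def)
qed

lemma unit_seq_l2: "unit_seq i \<in> hcarrier l2"
proof -
  have "(\<lambda>k. (cmod (unit_seq i k))\<^sup>2) summable_on UNIV \<longleftrightarrow> (\<lambda>k. (cmod (unit_seq i k))\<^sup>2) summable_on {i}"
    by (rule summable_on_cong_neutral) (auto simp: unit_seq_def)
  then show ?thesis by (simp add: l2_iff)
qed

lemma hinner_unit_seq: "hinner l2 a (unit_seq i) = a i"
proof -
  have "cnj (unit_seq i k) = unit_seq i k" for k by (simp add: unit_seq_def)
  then show ?thesis by (simp add: hinner_l2 unit_seq_finite_sum)
qed

lemma l2_trunc:
  assumes "a \<in> hcarrier l2"
  shows "(\<lambda>i. if i \<in> F then a i else 0) \<in> hcarrier l2"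
  using assms unfolding l2_iff by (rule summable_on_comparison_test) auto

text \<open>A truncation and its remainder have disjoint supports, so Pythagoras turns convergence
  of the sum of squares into convergence in norm.\<close>

lemma l2_approx:
  assumes a: "a \<in> hcarrier l2" and "e > 0"
  obtains F where "finite F" "hnorm l2 (a - (\<lambda>i. if i \<in> F then a i else 0)) < e"
proof -
  have "(\<lambda>i. (cmod (a i))\<^sup>2) summable_on UNIV" using a by (simp add: l2_iff)
  \<comment> \<open>The finite approximation comes with a non-strict bound; halving \<open>e\<close>
    makes the final inequality strict.\<close>
  then obtain F where F: "finite F"
      "dist (\<Sum>i\<in>F. (cmod (a i))\<^sup>2) (\<Sum>\<^sub>\<infinity>i. (cmod (a i))\<^sup>2) \<le> (e / 2)\<^sup>2"
    using infsum_finite_approximation[of "\<lambda>i. (cmod (a i))\<^sup>2" UNIV "(e/2)\<^sup>2"] \<open>e > 0\<close> by auto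
  let ?t = "\<lambda>i. if i \<in> F then a i else 0"
  have t: "?t \<in> hcarrier l2" by (rule l2_trunc[OF a])
  have "(\<Sum>\<^sub>\<infinity>i. (cmod (?t i))\<^sup>2) = (\<Sum>\<^sub>\<infinity>i\<in>F. (cmod (a i))\<^sup>2)"
    by (rule infsum_cong_neutral) auto
  then have S: "(hnorm l2 ?t)\<^sup>2 = (\<Sum>i\<in>F. (cmod (a i))\<^sup>2)"
    using F(1) by (simp add: hnorm_l2_sq[OF t])
  have "(hnorm l2 a)\<^sup>2 = (\<Sum>\<^sub>\<infinity>i. (cmod ((a - ?t) i))\<^sup>2 + (cmod (?t i))\<^sup>2)"
    unfolding hnorm_l2_sq[OF a] by (rule infsum_cong) auto
  also have "\<dots> = (hnorm l2 (a - ?t))\<^sup>2 + (hnorm l2 ?t)\<^sup>2"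
    using l2_diff[OF a t] t by (simp add: hnorm_l2_sq infsum_add l2_iff)
  finally have "(hnorm l2 (a - ?t))\<^sup>2 \<le> (e / 2)\<^sup>2"
    using F(2) S by (simp add: hnorm_l2_sq[OF a] dist_real_def)
  then have "hnorm l2 (a - ?t) \<le> e / 2"
    by (rule power2_le_imp_le) (use \<open>e > 0\<close> in auto)
  with F(1) \<open>e > 0\<close> that show ?thesis by auto
qed

text \<open>The common source of the uniqueness statements. Scalars enter only through multiples of
  coordinate vectors, so that the lemma serves the linear coordinate functionals of
  \<open>bounded_ops_eqI\<close> as well as the conjugate-linear ones of
  \<open>tensor_synth_onto\<close>.\<close>

lemma l2_dense:
  fixes D :: "('i \<Rightarrow> complex) \<Rightarrow> complex"
  assumes add: "\<And>x y. x \<in> hcarrier l2 \<Longrightarrow> y \<in> hcarrier l2 \<Longrightarrow> D (x + y) = D x + D y"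
    and bound: "\<And>x. x \<in> hcarrier l2 \<Longrightarrow> cmod (D x) \<le> C * hnorm l2 x"
    and unit: "\<And>c i. D (fun_scale c (unit_seq i)) = 0"
    and a: "a \<in> hcarrier l2"
  shows "D a = 0"
proof -
  have trunc: "D (\<lambda>i. if i \<in> F then a i else 0) = 0" if "finite F" for F
    using that
  proof (induction F)
    case empty
    show ?case using unit[of 0 undefined] by (simp add: zero_fun_def)
  next
    case (insert j F)
    have "(\<lambda>i. if i \<in> insert j F then a i else 0) =
      (\<lambda>i. if i \<in> F then a i else 0) + fun_scale (a j) (unit_seq j)"
      using insert.hyps by (auto simp: fun_eq_iff unit_seq_def)
    then show ?case
      using add[OF l2_trunc[OF a] l2_scale[OF unit_seq_l2]] insert.IH unit by simp
  qed
  have "cmod (D a) \<le> \<bar>C\<bar> * e" if e: "e > 0" for e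
  proof -
    obtain F where F: "finite F" "hnorm l2 (a - (\<lambda>i. if i \<in> F then a i else 0)) < e"
      using l2_approx[OF a e] by blast
    let ?t = "\<lambda>i. if i \<in> F then a i else 0"
    have "D a = D ((a - ?t) + ?t)" by simp
    also have "\<dots> = D (a - ?t)"
      using add[OF l2_diff[OF a l2_trunc[OF a, of F]] l2_trunc[OF a, of F]] trunc[OF F(1)] by simp
    finally have "cmod (D a) \<le> C * hnorm l2 (a - ?t)"
      using bound[OF l2_diff[OF a l2_trunc[OF a, of F]]] by simp
    also have "\<dots> \<le> \<bar>C\<bar> * e"
      using F(2) hnorm_l2_nonneg[OF l2_diff[OF a l2_trunc[OF a, of F]]] by (intro mult_mono) auto
    finally show ?thesis .
  qed
  note le = this
  have "cmod (D a) \<le> 0"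
  proof (rule field_le_epsilon)
    fix e :: real assume "e > 0"
    \<comment> \<open>The summand 1 keeps the divisor positive when \<open>C\<close> is 0.\<close>
    have "cmod (D a) \<le> \<bar>C\<bar> * (e / (\<bar>C\<bar> + 1))"
      using \<open>e > 0\<close> by (intro le divide_pos_pos) auto
    also have "\<dots> \<le> e" using \<open>e > 0\<close> by (simp add: field_simps)
    finally show "cmod (D a) \<le> 0 + e" by simp
  qed
  then show ?thesis by simp
qed

section \<open>Reindexing along injections\<close>

text \<open>The isometry of \<open>l2\<close> that sends the coordinate vector at \<open>i\<close>
  to the one at \<open>\<sigma> i\<close>. The shifts of all four modules, the two triangles of
  antisymmetric coefficients, the embedding of E and the tensor operators are instances of
  it.\<close>

definition push :: "('i \<Rightarrow> 'k) \<Rightarrow> ('i \<Rightarrow> complex) \<Rightarrow> 'k \<Rightarrow> complex" where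
  "push \<sigma> a = (\<lambda>k. if k \<in> range \<sigma> then a (inv \<sigma> k) else 0)"

lemma push_apply [simp]: "inj \<sigma> \<Longrightarrow> push \<sigma> a (\<sigma> i) = a i"
  by (simp add: push_def)

lemma push_outside: "k \<notin> range \<sigma> \<Longrightarrow> push \<sigma> a k = 0"
  by (simp add: push_def)

lemma push_add: "push \<sigma> (a + b) = push \<sigma> a + push \<sigma> b"
  by (auto simp: push_def fun_eq_iff)

lemma push_scale: "push \<sigma> (fun_scale c a) = fun_scale c (push \<sigma> a)"
  by (auto simp: push_def fun_eq_iff)

lemma push_unit_seq: "inj \<sigma> \<Longrightarrow> push \<sigma> (unit_seq i) = unit_seq (\<sigma> i)"
  by (auto simp: push_def fun_eq_iff unit_seq_def inv_f_eq)

text \<open>Any \<open>g\<close> with \<open>g k 0 = 0\<close> sees only the range of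
  \<open>\<sigma>\<close>. In this generality the lemma and its companion for sums cover squared
  norms, inner products and series of monomials at once.\<close>

lemma push_summable:
  assumes "inj \<sigma>" "\<And>k. g k 0 = 0"
  shows "(\<lambda>k. g k (push \<sigma> a k)) summable_on UNIV \<longleftrightarrow> (\<lambda>i. g (\<sigma> i) (a i)) summable_on UNIV"
proof -
  have "(\<lambda>k. g k (push \<sigma> a k)) summable_on UNIV \<longleftrightarrow> (\<lambda>k. g k (push \<sigma> a k)) summable_on range \<sigma>"
    by (rule summable_on_cong_neutral) (auto simp: push_outside assms)
  also have "\<dots> \<longleftrightarrow> ((\<lambda>k. g k (push \<sigma> a k)) \<circ> \<sigma>) summable_on UNIV"
    by (rule summable_on_reindex[OF assms(1)])
  finally show ?thesis by (simp add: o_def assms)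
qed

lemma push_infsum:
  assumes "inj \<sigma>" "\<And>k. g k 0 = 0"
  shows "(\<Sum>\<^sub>\<infinity>k. g k (push \<sigma> a k)) = (\<Sum>\<^sub>\<infinity>i. g (\<sigma> i) (a i))"
proof -
  have "(\<Sum>\<^sub>\<infinity>k. g k (push \<sigma> a k)) = (\<Sum>\<^sub>\<infinity>k\<in>range \<sigma>. g k (push \<sigma> a k))"
    by (rule infsum_cong_neutral) (auto simp: push_outside assms)
  also have "\<dots> = infsum ((\<lambda>k. g k (push \<sigma> a k)) \<circ> \<sigma>) UNIV"
    by (rule infsum_reindex[OF assms(1)])
  finally show ?thesis by (simp add: o_def assms)
qed

lemma push_l2_iff: "inj \<sigma> \<Longrightarrow> push \<sigma> a \<in> hcarrier l2 \<longleftrightarrow> a \<in> hcarrier l2"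
  unfolding l2_iff by (rule push_summable[where g = "\<lambda>k x. (cmod x)\<^sup>2"]) auto

lemma hnorm_push:
  assumes "inj \<sigma>" "a \<in> hcarrier l2"
  shows "hnorm l2 (push \<sigma> a) = hnorm l2 a"
proof -
  have "push \<sigma> a \<in> hcarrier l2" using assms by (simp add: push_l2_iff)
  then show ?thesis
    using push_infsum[OF assms(1), of "\<lambda>k x. (cmod x)\<^sup>2" a] assms by (simp add: hnorm_l2)
qed

subsection \<open>Spaces modelled on square-summable families\<close>

text \<open>The target inner product is defined by polarization, so an isometry for the norm
  \<open>N\<close> preserves it automatically; injectivity also comes from the norm, as
  \<open>l2\<close> has a definite one.\<close>

lemma unitary_l2_hspace_of_norm:
  fixes V :: "('x \<Rightarrow> complex) set" and \<Psi> :: "('i \<Rightarrow> complex) \<Rightarrow> 'x \<Rightarrow> complex"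
  assumes lin: "\<And>a b. a \<in> hcarrier l2 \<Longrightarrow> b \<in> hcarrier l2 \<Longrightarrow> \<Psi> (a + b) = \<Psi> a + \<Psi> b"
      "\<And>c a. a \<in> hcarrier l2 \<Longrightarrow> \<Psi> (fun_scale c a) = fun_scale c (\<Psi> a)"
    and norm: "\<And>a. a \<in> hcarrier l2 \<Longrightarrow> N (\<Psi> a) = hnorm l2 a"
    and into: "\<And>a. a \<in> hcarrier l2 \<Longrightarrow> \<Psi> a \<in> V"
    and onto: "\<And>f. f \<in> V \<Longrightarrow> \<exists>a\<in>hcarrier l2. \<Psi> a = f"
  shows "unitary_map l2 (hspace_of_norm V N) \<Psi>"
proof -
  have inj: "inj_on \<Psi> (hcarrier l2)"
  proof (rule inj_onI)
    fix a b assume ab: "a \<in> hcarrier l2" "b \<in> hcarrier l2" "\<Psi> a = \<Psi> b"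
    have "a - b = a + fun_scale (-1) b" by (auto simp: fun_eq_iff)
    then have "\<Psi> (a - b) = \<Psi> a + fun_scale (-1) (\<Psi> b)"
      by (simp only: lin ab(1,2) l2_scale)
    also have "\<dots> = \<Psi> 0" using lin(2)[OF l2_0, of 0] ab(3) by (auto simp: fun_eq_iff)
    finally have "hnorm l2 (a - b) = hnorm l2 (0 :: 'i \<Rightarrow> complex)"
      using norm[OF l2_diff[OF ab(1,2)]] norm[OF l2_0] by simp
    then have "cmod ((a - b) i) \<le> 0" for i
      using l2_coord_le[OF l2_diff[OF ab(1,2)], of i] by (simp add: hnorm_l2[OF l2_0])
    then show "a = b" by (auto simp: fun_eq_iff)
  qed
  have bij: "bij_betw \<Psi> (hcarrier l2) V"
    unfolding bij_betw_def using inj into onto by blast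
  have inner: "hinner (hspace_of_norm V N) (\<Psi> a) (\<Psi> b) = hinner l2 a b"
    if ab: "a \<in> hcarrier l2" "b \<in> hcarrier l2" for a b
  proof -
    have *: "of_real ((N (\<Psi> a + fun_scale c (\<Psi> b)))\<^sup>2)
        = hinner l2 a a + c * hinner l2 b a + cnj c * hinner l2 a b + c * cnj c * hinner l2 b b" for c
    proof -
      have cb: "fun_scale c b \<in> hcarrier l2" and s: "a + fun_scale c b \<in> hcarrier l2"
        using ab by (auto intro: l2_add l2_scale)
      have right: "hinner l2 u (fun_scale c b) = cnj c * hinner l2 u b" if "u \<in> hcarrier l2" for u
        using l2.inner_commute[OF cb that] l2.inner_commute[OF ab(2) that]
          l2.inner_scale_left[OF ab(2) that] by simp
      have radd: "hinner l2 u (a + fun_scale c b) = hinner l2 u a + hinner l2 u (fun_scale c b)"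
        if "u \<in> hcarrier l2" for u
        using l2.inner_commute[OF s that] l2.inner_add_left[OF ab(1) cb that]
          l2.inner_commute[OF ab(1) that] l2.inner_commute[OF cb that] by simp
      have "complex_of_real ((N (\<Psi> a + fun_scale c (\<Psi> b)))\<^sup>2) = hinner l2 (a + fun_scale c b) (a + fun_scale c b)"
        using lin(1)[OF ab(1) cb] lin(2)[OF ab(2), of c] norm[OF s] hnorm_l2_sq[OF s] hinner_l2_self[OF s]
        by simp
      also have "\<dots> = hinner l2 a a + c * hinner l2 b a + cnj c * hinner l2 a b + c * cnj c * hinner l2 b b"
        using l2.inner_scale_left[OF ab(2) ab(1), of c] l2.inner_scale_left[OF ab(2) ab(2), of c]
        by (simp add: l2.inner_add_left[OF ab(1) cb s] radd[OF ab(1)] radd[OF cb] right[OF ab(1)] right[OF cb]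
            algebra_simps)
      finally show ?thesis .
    qed
    have "hinner (hspace_of_norm V N) (\<Psi> a) (\<Psi> b)
        = (\<Sum>k<4. \<i> ^ k * of_real ((N (\<Psi> a + fun_scale (\<i> ^ k) (\<Psi> b)))\<^sup>2)) / 4"
      by (simp add: hspace_of_norm_def)
    \<comment> \<open>Among the four terms of the expansion only the one with \<open>cnj c\<close>
      survives the weights \<open>\<i> ^ k\<close>: the sums of \<open>\<i> ^ k\<close> and of
      \<open>\<i> ^ (2 * k)\<close> over k < 4 vanish, and each product of \<open>\<i> ^ k\<close>
      with its conjugate is 1.\<close>
    also have "\<dots> = hinner l2 a b"
      unfolding * by (simp add: numeral_eq_Suc algebra_simps)
    finally show ?thesis .
  qed
  show ?thesis
    using lin bij inner into
    by (auto simp: unitary_map_def hlinear_def) (simp_all add: hspace_of_norm_def)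
qed

section \<open>Transport along unitary maps\<close>

lemma unitary_hnorm:
  "unitary_map H K F \<Longrightarrow> x \<in> hcarrier H \<Longrightarrow> hnorm K (F x) = hnorm H x"
  by (simp add: unitary_map_def hnorm_def)

lemma unitary_map_comp:
  assumes "unitary_map H K F" "unitary_map K L G"
  shows "unitary_map H L (G \<circ> F)"
  using assms unfolding unitary_map_def hlinear_def
  by (auto intro: bij_betw_trans)

lemma unitary_map_inv:
  assumes F: "unitary_map H K F" and H: "module.subspace (hscale H) (hcarrier H)"
    "vector_space (hscale H)"
  shows "unitary_map K H (inv_into (hcarrier H) F)" (is "unitary_map K H ?G")
proof -
  interpret vector_space "hscale H" by (rule H)
  have bij: "bij_betw F (hcarrier H) (hcarrier K)" using F by (simp add: unitary_map_def)
  have G: "?G y \<in> hcarrier H" "F (?G y) = y" if "y \<in> hcarrier K" for y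
    using bij that by (auto simp: bij_betw_def inv_into_into f_inv_into_f)
  have GF: "?G (F x) = x" if "x \<in> hcarrier H" for x
    using bij that by (simp add: bij_betw_inv_into_left)
  show ?thesis
    unfolding unitary_map_def hlinear_def
  proof (intro conjI ballI allI)
    show "bij_betw ?G (hcarrier K) (hcarrier H)" by (rule bij_betw_inv_into[OF bij])
    fix x assume x: "x \<in> hcarrier K"
    show "?G x \<in> hcarrier H" by (rule G[OF x])
    show "?G (hscale K c x) = hscale H c (?G x)" for c
      using GF[of "hscale H c (?G x)"] subspace_scale[OF H(1)] G[OF x] F
      by (simp add: unitary_map_def hlinear_def)
    fix y assume y: "y \<in> hcarrier K"
    show "?G (x + y) = ?G x + ?G y"
      using GF[of "?G x + ?G y"] subspace_add[OF H(1)] G[OF x] G[OF y] F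
      by (simp add: unitary_map_def hlinear_def)
    show "hinner H (?G x) (?G y) = hinner K x y"
      using F G[OF x] G[OF y] unfolding unitary_map_def by metis
  qed
qed

text \<open>Carries all axioms, completeness included, over from \<open>l2\<close>; no Cauchy
  sequence of holomorphic functions or of functionals is ever considered.\<close>

lemma hilbert_space_unitary:
  assumes F: "unitary_map H K F" and H: "hilbert_space H" and K: "vector_space (hscale K)"
  shows "hilbert_space K"
proof -
  interpret H: hilbert_space H by (rule H)
  interpret K: vector_space "hscale K" by (rule K)
  define G where "G = inv_into (hcarrier H) F"
  have car: "hcarrier K = F ` hcarrier H" using F by (auto simp: unitary_map_def bij_betw_def)
  have lin: "F (x + y) = F x + F y" "F (hscale H c x) = hscale K c (F x)"
    if "x \<in> hcarrier H" "y \<in> hcarrier H" for x y c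
    using F that by (auto simp: unitary_map_def hlinear_def)
  have inn: "hinner K (F x) (F y) = hinner H x y" if "x \<in> hcarrier H" "y \<in> hcarrier H" for x y
    using F that by (auto simp: unitary_map_def)
  have cl: "x + y \<in> hcarrier H" "hscale H c x \<in> hcarrier H" "0 \<in> hcarrier H" "x - y \<in> hcarrier H"
    if "x \<in> hcarrier H" "y \<in> hcarrier H" for x y c
    using that H.subspace_carrier
    by (auto intro: H.subspace_add H.subspace_scale H.subspace_0 H.subspace_diff)
  have H0: "0 \<in> hcarrier H" using H.subspace_carrier by (rule H.subspace_0)
  have F0: "F 0 = 0" using lin(1)[OF H0 H0] by simp
  have dif: "F (x - y) = F x - F y" if "x \<in> hcarrier H" "y \<in> hcarrier H" for x y
    using lin(1)[OF cl(4)[OF that] that(2)] by simp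
  show ?thesis
  proof (unfold_locales)
    show "K.subspace (hcarrier K)" unfolding K.subspace_def
    proof (intro conjI ballI allI)
      show "0 \<in> hcarrier K" using F0 H0 unfolding car by force
      fix x assume "x \<in> hcarrier K"
      then obtain x' where x': "x = F x'" "x' \<in> hcarrier H" unfolding car by auto
      show "hscale K c x \<in> hcarrier K" for c
        using lin(2)[OF x'(2) x'(2), of c, symmetric] cl(2)[OF x'(2) x'(2)] x' unfolding car by auto
      fix y assume "y \<in> hcarrier K"
      then obtain y' where y': "y = F y'" "y' \<in> hcarrier H" unfolding car by auto
      show "x + y \<in> hcarrier K"
        using lin(1)[OF x'(2) y'(2), symmetric] cl(1)[OF x'(2) y'(2)] x' y' unfolding car by auto
    qed
  next
    fix x y z assume "x \<in> hcarrier K" "y \<in> hcarrier K" "z \<in> hcarrier K"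
    then show "hinner K (x + y) z = hinner K x z + hinner K y z"
      by (auto simp: car inn cl H.inner_add_left simp flip: lin)
  next
    fix x y c assume "x \<in> hcarrier K" "y \<in> hcarrier K"
    then show "hinner K (hscale K c x) y = c * hinner K x y"
      by (auto simp: car inn cl H.inner_scale_left simp flip: lin(2))
  next
    fix x y assume "x \<in> hcarrier K" "y \<in> hcarrier K"
    then show "hinner K y x = cnj (hinner K x y)"
      by (auto simp: car inn intro: H.inner_commute)
  next
    fix x assume "x \<in> hcarrier K"
    then show "0 \<le> Re (hinner K x x)" by (auto simp: car inn H.inner_nonneg)
  next
    fix x assume "x \<in> hcarrier K" and 0: "hinner K x x = 0"
    then obtain y where y: "x = F y" "y \<in> hcarrier H" unfolding car by auto
    then have "y = 0" using 0 inn by (intro H.inner_definite) auto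
    then show "x = 0" using F0 y by simp
  next
    fix u :: "nat \<Rightarrow> 'c"
    assume u: "\<And>n. u n \<in> hcarrier K"
      and C: "\<And>e. e > 0 \<Longrightarrow> \<exists>N. \<forall>m\<ge>N. \<forall>n\<ge>N. hnorm K (u m - u n) < e"
    obtain v where v: "\<And>n. u n = F (v n)" "\<And>n. v n \<in> hcarrier H"
      using u unfolding car image_iff by metis
    have nrm: "hnorm K (F x - F y) = hnorm H (x - y)" if "x \<in> hcarrier H" "y \<in> hcarrier H" for x y
      using unitary_hnorm[OF F cl(4)[OF that]] dif[OF that] by simp
    have "\<exists>l\<in>hcarrier H. (\<lambda>n. hnorm H (v n - l)) \<longlonglongrightarrow> 0"
      by (rule H.complete) (use C v in \<open>simp_all add: nrm\<close>)
    then obtain l where "l \<in> hcarrier H" "(\<lambda>n. hnorm H (v n - l)) \<longlonglongrightarrow> 0" by blast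
    then show "\<exists>l\<in>hcarrier K. (\<lambda>n. hnorm K (u n - l)) \<longlonglongrightarrow> 0"
      by (intro bexI[of _ "F l"]) (use v nrm in \<open>auto simp: car\<close>)
  qed
qed

text \<open>The uniqueness half for operators introduced by \<open>THE\<close>. Each coordinate of
  the difference, read off through \<open>\<Phi>\<close>, is a bounded additive functional of the
  \<open>\<Psi>\<close>-coordinates that vanishes on multiples of coordinate vectors; extensionality
  settles the rest of the type.\<close>

lemma bounded_ops_eqI:
  fixes \<Psi> :: "('i \<Rightarrow> complex) \<Rightarrow> 'a::ab_group_add" and \<Phi> :: "('k \<Rightarrow> complex) \<Rightarrow> 'b::ab_group_add"
  assumes \<Psi>: "unitary_map l2 H \<Psi>" and \<Phi>: "unitary_map l2 K \<Phi>"
    and S: "S \<in> bounded_ops H K" and T: "T \<in> bounded_ops H K"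
    and eq: "\<And>i. S (\<Psi> (unit_seq i)) = T (\<Psi> (unit_seq i))"
  shows "S = T"
proof (rule extensionalityI)
  show "S \<in> extensional (hcarrier H)" "T \<in> extensional (hcarrier H)"
    using S T by (auto simp: bounded_ops_def)
  have car: "hcarrier H = \<Psi> ` hcarrier l2" using \<Psi> by (auto simp: unitary_map_def bij_betw_def)
  define G where "G = inv_into (hcarrier l2) \<Phi>"
  have G: "unitary_map K l2 G" unfolding G_def
    by (rule unitary_map_inv[OF \<Phi>]) (use l2.subspace_carrier vector_space_fun_scale in auto)
  have Ginj: "inj_on G (hcarrier K)" using G by (auto simp: unitary_map_def bij_betw_def)
  obtain C where C: "\<And>x. x \<in> hcarrier H \<Longrightarrow> hnorm K (S x) \<le> C * hnorm H x"
    using S by (auto simp: bounded_ops_def)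
  obtain C' where C': "\<And>x. x \<in> hcarrier H \<Longrightarrow> hnorm K (T x) \<le> C' * hnorm H x"
    using T by (auto simp: bounded_ops_def)
  have S_lin: "hlinear H K S" and T_lin: "hlinear H K T" using S T by (auto simp: bounded_ops_def)
  have \<Psi>in: "\<Psi> a \<in> hcarrier H" if "a \<in> hcarrier l2" for a using that car by auto
  have zero: "G (S (\<Psi> a)) i - G (T (\<Psi> a)) i = 0" if a: "a \<in> hcarrier l2" for a i
  proof (rule l2_dense[OF _ _ _ a])
    fix x y :: "'i \<Rightarrow> complex" assume "x \<in> hcarrier l2" "y \<in> hcarrier l2"
    then show "G (S (\<Psi> (x + y))) i - G (T (\<Psi> (x + y))) i =
        G (S (\<Psi> x)) i - G (T (\<Psi> x)) i + (G (S (\<Psi> y)) i - G (T (\<Psi> y)) i)"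
      using \<Psi> G S_lin T_lin by (simp add: unitary_map_def hlinear_def)
  next
    fix x :: "'i \<Rightarrow> complex" assume x: "x \<in> hcarrier l2"
    have bd: "cmod (G (R (\<Psi> x)) i) \<le> c * hnorm l2 x"
      if "hlinear H K R" "\<And>x. x \<in> hcarrier H \<Longrightarrow> hnorm K (R x) \<le> c * hnorm H x" for R c
    proof -
      have R: "R (\<Psi> x) \<in> hcarrier K" using that \<Psi>in[OF x] by (simp add: hlinear_def)
      have "cmod (G (R (\<Psi> x)) i) \<le> hnorm l2 (G (R (\<Psi> x)))"
        using G R by (intro l2_coord_le) (simp add: unitary_map_def hlinear_def)
      also have "\<dots> = hnorm K (R (\<Psi> x))" by (rule unitary_hnorm[OF G R])
      also have "\<dots> \<le> c * hnorm H (\<Psi> x)" by (rule that(2)[OF \<Psi>in[OF x]])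
      finally show ?thesis by (simp add: unitary_hnorm[OF \<Psi> x])
    qed
    show "cmod (G (S (\<Psi> x)) i - G (T (\<Psi> x)) i) \<le> (C + C') * hnorm l2 x"
      using bd[OF S_lin C] bd[OF T_lin C'] norm_triangle_ineq4[of "G (S (\<Psi> x)) i" "G (T (\<Psi> x)) i"]
      by (simp add: distrib_right)
  next
    fix c and j :: 'i
    show "G (S (\<Psi> (fun_scale c (unit_seq j)))) i - G (T (\<Psi> (fun_scale c (unit_seq j)))) i = 0"
      using \<Psi> S_lin T_lin eq[of j] unit_seq_l2[of j] \<Psi>in[OF unit_seq_l2[of j]]
      by (simp add: unitary_map_def hlinear_def)
  qed
  fix x assume "x \<in> hcarrier H"
  then obtain a where a: "x = \<Psi> a" "a \<in> hcarrier l2" unfolding car by auto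
  have "G (S x) = G (T x)" using zero[OF a(2)] a by (auto simp: fun_eq_iff)
  then show "S x = T x"
    using Ginj S_lin T_lin \<open>x \<in> hcarrier H\<close> by (auto simp: inj_on_def hlinear_def)
qed

subsection \<open>Holomorphic functions of two variables\<close>

text \<open>Cauchy's inequality on the circle of radius d/4 about \<open>x\<close>, which stays
  inside since d/2 + d/4 < d.\<close>

lemma deriv_bound_half_ball:
  assumes g: "g holomorphic_on ball c d" and B: "\<And>x. x \<in> ball c d \<Longrightarrow> cmod (g x) \<le> B"
    and x: "x \<in> ball c (d / 2)"
  shows "cmod (deriv g x) \<le> 4 * B / d"
proof -
  have d: "d > 0" using x by (metis ball_eq_empty empty_iff half_gt_zero_iff not_le)
  have sub: "cball x (d / 4) \<subseteq> ball c d"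
  proof
    fix y assume "y \<in> cball x (d / 4)"
    then show "y \<in> ball c d" using x dist_triangle[of c y x] d by simp
  qed
  then have "ball x (d / 4) \<subseteq> ball c d" using ball_subset_cball by blast
  then have "cmod ((deriv ^^ 1) g x) \<le> fact 1 * B / (d / 4) ^ 1"
    using sub d g
    by (intro Cauchy_inequality B) (auto intro!:
        continuous_on_subset[OF holomorphic_on_imp_continuous_on] simp: dist_norm subset_iff)
  then show ?thesis by (simp add: field_simps)
qed

lemma Lipschitz_half_ball:
  assumes g: "g holomorphic_on ball c d" and B: "\<And>x. x \<in> ball c d \<Longrightarrow> cmod (g x) \<le> B"
    and xy: "x \<in> ball c (d / 2)" "y \<in> ball c (d / 2)"
  shows "cmod (g x - g y) \<le> 4 * B / d * cmod (x - y)"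
proof (rule field_differentiable_bound[OF convex_ball])
  have d: "d > 0" using xy by (metis ball_eq_empty empty_iff half_gt_zero_iff not_le)
  fix z assume z: "z \<in> ball c (d / 2)"
  then have "z \<in> ball c d" using d by auto
  then show "(g has_field_derivative deriv g z) (at z within ball c (d / 2))"
    using g by (auto intro: holomorphic_derivI has_field_derivative_at_within)
  show "cmod (deriv g z) \<le> 4 * B / d"
    using g B z by (rule deriv_bound_half_ball)
qed (use xy in auto)

text \<open>Osgood's lemma with local boundedness. A total derivative exists at a point once one
  partial derivative exists there and the other exists nearby and is jointly continuous at the
  point; Cauchy estimates make the partial derivative in the second variable Lipschitz in each
  variable.\<close>

lemma holomorphic2_on_separately:
  assumes sep: "\<And>a b. (a, b) \<in> S \<Longrightarrow> \<exists>d>0. \<exists>B. ball a d \<times> ball b d \<subseteq> S \<and>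
      (\<forall>y\<in>ball b d. (\<lambda>x. f (x, y)) holomorphic_on ball a d) \<and>
      (\<forall>x\<in>ball a d. (\<lambda>y. f (x, y)) holomorphic_on ball b d) \<and>
      (\<forall>x\<in>ball a d. \<forall>y\<in>ball b d. cmod (f (x, y)) \<le> B)"
  shows "f holomorphic2_on S"
  unfolding holomorphic2_on_def
proof
  fix z assume "z \<in> S"
  then obtain a b where z: "z = (a, b)" "(a, b) \<in> S" by (cases z) auto
  from sep[OF z(2)] obtain d B where d: "d > 0"
    and h1: "\<And>y. y \<in> ball b d \<Longrightarrow> (\<lambda>x. f (x, y)) holomorphic_on ball a d"
    and h2: "\<And>x. x \<in> ball a d \<Longrightarrow> (\<lambda>y. f (x, y)) holomorphic_on ball b d"
    and B: "\<And>x y. x \<in> ball a d \<Longrightarrow> y \<in> ball b d \<Longrightarrow> cmod (f (x, y)) \<le> B" by blast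
  define fy where "fy = (\<lambda>x y. deriv (\<lambda>y. f (x, y)) y)"
  \<comment> \<open>Two successive Cauchy estimates: 4B/d on the balls of radius d, then a factor
    8/d on a ball of radius d/2.\<close>
  define L where "L = 32 * B / d\<^sup>2"
  \<comment> \<open>The second variable is halved twice because the second estimate starts from
    bounds that hold only on radius d/2.\<close>
  let ?X = "ball a (d / 2)" and ?Y = "ball b (d / 4)"
  have Y: "y \<in> ball b (d / 2)" "y \<in> ball b d" if "y \<in> ?Y" for y using that d by auto
  have X: "x \<in> ball a d" if "x \<in> ?X" for x using that d by auto
  have ab: "a \<in> ?X" "b \<in> ?Y" using d by auto
  have lip_x: "cmod (fy x y - fy x' y) \<le> L * cmod (x - x')"
    if x: "x \<in> ?X" "x' \<in> ?X" and y: "y \<in> ?Y" for x x' y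
  proof -
    \<comment> \<open>The difference of two slices is small uniformly in the second variable, by the
      Lipschitz bound in the first; differentiating it costs one more Cauchy estimate.\<close>
    have "cmod (deriv (\<lambda>y. f (x, y) - f (x', y)) y) \<le> 4 * (4 * B / d * cmod (x - x')) / (d / 2)"
    proof (rule deriv_bound_half_ball)
      show "(\<lambda>y. f (x, y) - f (x', y)) holomorphic_on ball b (d / 2)"
        using d by (intro holomorphic_on_diff h2[THEN holomorphic_on_subset] X x) auto
      show "cmod (f (x, w) - f (x', w)) \<le> 4 * B / d * cmod (x - x')" if "w \<in> ball b (d / 2)" for w
        using that d by (intro Lipschitz_half_ball[OF h1] x B) auto
      show "y \<in> ball b (d / 2 / 2)" using y by simp
    qed
    moreover have "deriv (\<lambda>y. f (x, y) - f (x', y)) y = fy x y - fy x' y"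
      unfolding fy_def
      by (intro deriv_diff holomorphic_on_imp_differentiable_at[OF h2[OF X[OF x(1)]] _ Y(2)[OF y]]
          holomorphic_on_imp_differentiable_at[OF h2[OF X[OF x(2)]] _ Y(2)[OF y]]) auto
    ultimately show ?thesis by (simp add: L_def power2_eq_square field_simps)
  qed
  have lip_y: "cmod (fy x y - fy x y') \<le> L * cmod (y - y')"
    if x: "x \<in> ?X" and y: "y \<in> ?Y" "y' \<in> ?Y" for x y y'
  proof -
    have "cmod (fy x y - fy x y') \<le> 4 * (4 * B / d) / (d / 2) * cmod (y - y')"
    proof (rule Lipschitz_half_ball)
      show "fy x holomorphic_on ball b (d / 2)" unfolding fy_def
        using h2[OF X[OF x]] d
        by (intro holomorphic_on_subset[OF holomorphic_deriv[of _ "ball b d"]]) auto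
      show "cmod (fy x w) \<le> 4 * B / d" if "w \<in> ball b (d / 2)" for w
        unfolding fy_def by (rule deriv_bound_half_ball[OF h2[OF X[OF x]] B[OF X[OF x]] that])
    qed (use y in auto)
    then show ?thesis by (simp add: L_def power2_eq_square field_simps)
  qed
  have cont: "continuous (at (a, b) within ?X \<times> ?Y) (\<lambda>(x, y). blinfun_mult_right (fy x y))"
  proof -
    have "((\<lambda>w. fy (fst w) (snd w) - fy a b) \<longlongrightarrow> 0) (at (a, b) within ?X \<times> ?Y)"
    proof (rule Lim_null_comparison)
      show "eventually (\<lambda>w. cmod (fy (fst w) (snd w) - fy a b)
          \<le> L * cmod (fst w - a) + L * cmod (snd w - b)) (at (a, b) within ?X \<times> ?Y)"
        unfolding eventually_at_topological
      proof (intro exI[of _ UNIV] conjI ballI impI)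
        fix w assume "w \<in> ?X \<times> ?Y"
        then have w: "fst w \<in> ?X" "snd w \<in> ?Y" by auto
        show "cmod (fy (fst w) (snd w) - fy a b) \<le> L * cmod (fst w - a) + L * cmod (snd w - b)"
          using lip_x[OF w(1) ab(1) w(2)] lip_y[OF ab(1) w(2) ab(2)]
            norm_triangle_ineq[of "fy (fst w) (snd w) - fy a (snd w)" "fy a (snd w) - fy a b"] by simp
      qed auto
      have "((\<lambda>w. L * cmod (fst w - a) + L * cmod (snd w - b)) \<longlongrightarrow>
          L * cmod (fst (a, b) - a) + L * cmod (snd (a, b) - b)) (at (a, b) within ?X \<times> ?Y)"
        by (intro tendsto_intros)
      then show "((\<lambda>w. L * cmod (fst w - a) + L * cmod (snd w - b)) \<longlongrightarrow> 0) (at (a, b) within ?X \<times> ?Y)"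
        by simp
    qed
    then have "((\<lambda>w. fy (fst w) (snd w)) \<longlongrightarrow> fy a b) (at (a, b) within ?X \<times> ?Y)"
      by (simp add: LIM_zero_iff)
    then have "continuous (at (a, b) within ?X \<times> ?Y) (\<lambda>w. fy (fst w) (snd w))"
      by (simp add: continuous_within)
    then have "continuous (at (a, b) within ?X \<times> ?Y) (\<lambda>w. blinfun_mult_right (fy (fst w) (snd w)))"
      by (rule bounded_linear.continuous[OF bounded_linear_blinfun_mult_right])
    then show ?thesis by (simp add: case_prod_unfold)
  qed
  have "((\<lambda>(x, y). f (x, y)) has_derivative
      (\<lambda>(h, k). deriv (\<lambda>x. f (x, b)) a * h + blinfun_apply (blinfun_mult_right (fy a b)) k)) (at (a, b) within ?X \<times> ?Y)"
  proof (rule has_derivative_partialsI[OF _ _ cont ab(2) convex_ball])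
    have "((\<lambda>x. f (x, b)) has_field_derivative deriv (\<lambda>x. f (x, b)) a) (at a)"
      using h1[of b] d by (intro holomorphic_derivI[of _ "ball a d"]) auto
    then show "((\<lambda>x. f (x, b)) has_derivative (\<lambda>h. deriv (\<lambda>x. f (x, b)) a * h)) (at a within ?X)"
      by (simp add: has_field_derivative_def has_derivative_at_withinI)
    fix x y assume xy: "x \<in> ?X" "y \<in> ?Y"
    then have "((\<lambda>y. f (x, y)) has_field_derivative fy x y) (at y)"
      unfolding fy_def using h2[OF X] Y by (intro holomorphic_derivI[of _ "ball b d"]) auto
    then show "((\<lambda>y. f (x, y)) has_derivative blinfun_apply (blinfun_mult_right (fy x y))) (at y within ?Y)"
      by (simp add: has_field_derivative_def has_derivative_at_withinI)
  qed
  moreover have "at (a, b) within ?X \<times> ?Y = at (a, b)"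
    using ab by (intro at_within_open open_Times) auto
  ultimately have "(f has_derivative (\<lambda>(h, k). deriv (\<lambda>x. f (x, b)) a * h + fy a b * k)) (at z)"
    using z by simp
  then show "\<exists>\<alpha> \<beta>. (f has_derivative (\<lambda>(h, k). \<alpha> * h + \<beta> * k)) (at z within S)"
    using has_derivative_at_withinI by blast
qed

text \<open>A locally uniform majorant gives holomorphy in each variable by the Weierstrass test,
  and the same majorant supplies the local bound that joint differentiability requires.\<close>

lemma holomorphic2_on_infsum:
  fixes t :: "'i \<Rightarrow> complex \<times> complex \<Rightarrow> complex"
  assumes "open S"
    and h1: "\<And>i y. (\<lambda>x. t i (x, y)) holomorphic_on UNIV"
    and h2: "\<And>i x. (\<lambda>y. t i (x, y)) holomorphic_on UNIV"
    and M: "\<And>z. z \<in> S \<Longrightarrow> \<exists>d>0. \<exists>M. M summable_on UNIV \<and> (\<forall>w\<in>S. dist z w < d \<longrightarrow> (\<forall>i. cmod (t i w) \<le> M i))"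
  shows "(\<lambda>z. \<Sum>\<^sub>\<infinity>i. t i z) holomorphic2_on S"
proof (rule holomorphic2_on_separately)
  fix a b assume ab: "(a, b) \<in> S"
  obtain e where e: "e > 0" "ball (a, b) e \<subseteq> S" using \<open>open S\<close> ab open_contains_ball by blast
  obtain d' M where d': "d' > 0" and M: "M summable_on UNIV"
    and le: "\<And>w i. w \<in> S \<Longrightarrow> dist (a, b) w < d' \<Longrightarrow> cmod (t i w) \<le> M i" using M[OF ab] by blast
  \<comment> \<open>A distance in the product is at most the sum of the two coordinate distances,
    hence the half. The uniform limit is taken on a closed disc in one variable while the other
    stays in the open disc, so one strict inequality is enough.\<close>
  define d where "d = min d' e / 2"
  have d: "d > 0" using e d' by (simp add: d_def)
  have near: "(x, y) \<in> S \<and> dist (a, b) (x, y) < d'" if "dist a x \<le> d" "dist b y \<le> d" "dist a x < d \<or> dist b y < d" for x y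
  proof -
    have "dist (a, b) (x, y) \<le> dist a x + dist b y"
      using sqrt_sum_squares_le_sum_abs[of "dist a x" "dist b y"] by (simp add: dist_Pair_Pair)
    then have "dist (a, b) (x, y) < min d' e" using that by (auto simp: d_def)
    then show ?thesis using e by auto
  qed
  have lim: "g holomorphic_on ball c d"
    if h: "\<And>i. g' i holomorphic_on UNIV" and le: "\<And>i x. x \<in> cball c d \<Longrightarrow> cmod (g' i x) \<le> M i"
      and g: "g = (\<lambda>x. \<Sum>\<^sub>\<infinity>i. g' i x)" for g g' c
  proof (rule holomorphic_uniform_limit)
    show "uniform_limit (cball c d) (\<lambda>X x. \<Sum>i\<in>X. g' i x) g (finite_subsets_at_top UNIV)"
      unfolding g by (rule Weierstrass_m_test_general[OF _ M]) (use le in auto)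
    show "\<forall>\<^sub>F X in finite_subsets_at_top UNIV. continuous_on (cball c d) (\<lambda>x. \<Sum>i\<in>X. g' i x) \<and>
         (\<lambda>x. \<Sum>i\<in>X. g' i x) holomorphic_on ball c d"
      by (intro always_eventually allI conjI holomorphic_on_sum continuous_on_sum
          holomorphic_on_imp_continuous_on holomorphic_on_subset[OF h]) auto
  qed auto
  show "\<exists>d>0. \<exists>B. ball a d \<times> ball b d \<subseteq> S \<and>
      (\<forall>y\<in>ball b d. (\<lambda>x. \<Sum>\<^sub>\<infinity>i. t i (x, y)) holomorphic_on ball a d) \<and>
      (\<forall>x\<in>ball a d. (\<lambda>y. \<Sum>\<^sub>\<infinity>i. t i (x, y)) holomorphic_on ball b d) \<and>
      (\<forall>x\<in>ball a d. \<forall>y\<in>ball b d. cmod (\<Sum>\<^sub>\<infinity>i. t i (x, y)) \<le> B)"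
  proof (rule exI[of _ d], intro conjI d, rule exI[of _ "infsum M UNIV"], intro conjI ballI)
    show "ball a d \<times> ball b d \<subseteq> S" using near by auto
    show "(\<lambda>x. \<Sum>\<^sub>\<infinity>i. t i (x, y)) holomorphic_on ball a d" if "y \<in> ball b d" for y
      using that near by (intro lim[OF h1 le refl]) auto
    show "(\<lambda>y. \<Sum>\<^sub>\<infinity>i. t i (x, y)) holomorphic_on ball b d" if "x \<in> ball a d" for x
      using that near by (intro lim[OF h2 le refl]) auto
    show "cmod (\<Sum>\<^sub>\<infinity>i. t i (x, y)) \<le> infsum M UNIV" if "x \<in> ball a d" "y \<in> ball b d" for x y
    proof -
      have *: "cmod (t i (x, y)) \<le> M i" for i using that near[of x y] by (intro le) auto
      then have "(\<lambda>i. cmod (t i (x, y))) summable_on UNIV"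
        by (intro summable_on_comparison_test[OF M]) auto
      then show ?thesis using * by (intro norm_infsum_le[OF has_sum_infsum has_sum_infsum] M)
          (auto intro: abs_summable_summable)
    qed
  qed
qed

section \<open>Double power series on the bidisc\<close>

lemma summable_on_times:
  fixes f :: "'i \<Rightarrow> real" and g :: "'k \<Rightarrow> real"
  assumes "f summable_on UNIV" "g summable_on UNIV" "\<And>i. 0 \<le> f i" "\<And>k. 0 \<le> g k"
  shows "(\<lambda>(i, k). f i * g k) summable_on UNIV"
proof -
  have "(\<lambda>(i, k). f i * g k) summable_on UNIV \<times> UNIV"
  proof (rule summable_on_SigmaI)
    show "((\<lambda>k. case (i, k) of (i, k) \<Rightarrow> f i * g k) has_sum f i * infsum g UNIV) UNIV" for i
      using assms(2) by (simp add: has_sum_cmult_right)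
    show "(\<lambda>i. f i * infsum g UNIV) summable_on UNIV"
      using assms(1) by (rule summable_on_cmult_left)
  qed (use assms in auto)
  then show ?thesis by simp
qed

lemma summable_on_geometric:
  fixes p :: real
  assumes "0 \<le> p" "p < 1"
  shows "(\<lambda>n. p ^ n) summable_on UNIV"
  using assms by (intro summable_nonneg_imp_summable_on summable_geometric) auto

lemma power_lt_1_between:
  fixes x :: real
  assumes "x < 1"
  obtains r where "0 < r" "r < 1" "x < r"
  using dense[of "max x 0" 1] assms by auto

lemma open_bidisc: "open bidisc"
  by (simp add: bidisc_def open_Times)

lemma holomorphic2_on_imp_continuous_on: "f holomorphic2_on S \<Longrightarrow> continuous_on S f"
  unfolding holomorphic2_on_def continuous_on_eq_continuous_within
  using has_derivative_continuous by blast

lemma holomorphic2_on_slices: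
  assumes f: "f holomorphic2_on bidisc"
  shows "cmod y < 1 \<Longrightarrow> (\<lambda>x. f (x, y)) holomorphic_on ball 0 1"
    and "cmod x < 1 \<Longrightarrow> (\<lambda>y. f (x, y)) holomorphic_on ball 0 1"
proof -
  have D: "\<exists>a b. (f has_derivative (\<lambda>(h, k). a * h + b * k)) (at (x, y))"
    if "cmod x < 1" "cmod y < 1" for x y
  proof -
    have "(x, y) \<in> bidisc" using that by (simp add: bidisc_def)
    then show ?thesis using f open_bidisc unfolding holomorphic2_on_def
      by (metis at_within_open)
  qed
  show "(\<lambda>x. f (x, y)) holomorphic_on ball 0 1" if "cmod y < 1"
    unfolding holomorphic_on_open[OF open_ball]
  proof
    fix x :: complex assume "x \<in> ball 0 1"
    then obtain a b where d: "(f has_derivative (\<lambda>(h, k). a * h + b * k)) (at (x, y))"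
      using D[of x y] \<open>cmod y < 1\<close> by auto
    have p: "((\<lambda>x. (x, y)) has_derivative (\<lambda>h. (h, 0))) (at x)"
      by (auto intro!: derivative_eq_intros)
    show "\<exists>f'. ((\<lambda>x. f (x, y)) has_field_derivative f') (at x)"
      using has_derivative_compose[OF p d] by (auto simp: has_field_derivative_def)
  qed
  show "(\<lambda>y. f (x, y)) holomorphic_on ball 0 1" if "cmod x < 1"
    unfolding holomorphic_on_open[OF open_ball]
  proof
    fix y :: complex assume "y \<in> ball 0 1"
    then obtain a b where d: "(f has_derivative (\<lambda>(h, k). a * h + b * k)) (at (x, y))"
      using D[of x y] \<open>cmod x < 1\<close> by auto
    have p: "((\<lambda>y. (x, y)) has_derivative (\<lambda>k. (0, k))) (at y)"
      by (auto intro!: derivative_eq_intros)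
    show "\<exists>f'. ((\<lambda>y. f (x, y)) has_field_derivative f') (at y)"
      using has_derivative_compose[OF p d] by (auto simp: has_field_derivative_def)
  qed
qed

text \<open>The coefficient of \<open>x ^ i\<close> in \<open>f (x, y)\<close> depends holomorphically on \<open>y\<close>: it is the locally
  uniform limit of \<open>(f (t, y) - \<Sum>k<i. c\<^sub>k y t ^ k) / t ^ i\<close> as \<open>t\<close> tends to \<open>0\<close>.\<close>

lemma power_series_coefficient_holomorphic:
  fixes c :: "nat \<Rightarrow> complex \<Rightarrow> complex"
  assumes hol: "\<And>t. cmod t < 1 \<Longrightarrow> (\<lambda>y. f (t, y)) holomorphic_on ball 0 1"
    and sums: "\<And>t y. cmod t < 1 \<Longrightarrow> cmod y < 1 \<Longrightarrow> (\<lambda>i. c i y * t ^ i) sums f (t, y)"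
    and bound: "\<And>r. 0 < r \<Longrightarrow> r < 1 \<Longrightarrow> \<exists>M. \<forall>i y. cmod y \<le> r \<longrightarrow> cmod (c i y) \<le> M / r ^ i"
  shows "c i holomorphic_on ball 0 1"
proof (induction i rule: less_induct)
  case (less i)
  have "c i holomorphic_on ball 0 r" if r: "0 < r" "r < 1" for r
  proof (rule holomorphic_uniform_limit[of 0 r])
    obtain M where M: "\<And>i y. cmod y \<le> r \<Longrightarrow> cmod (c i y) \<le> M / r ^ i" using bound[OF r] by blast
    have "0 \<le> M" using M[of 0 0] r by (simp add: order_trans[OF norm_ge_zero])
    \<comment> \<open>With this choice \<open>t n / r\<close> is 1 / (n + 2), so the tail of the
      series is geometric with that ratio q, and q / (1 - q) = 1 / (n + 1) is the rate of uniform
      convergence.\<close>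
    define t where "t = (\<lambda>n. r / (real n + 2))"
    define g where "g = (\<lambda>n y. (f (of_real (t n), y) - (\<Sum>k<i. c k y * of_real (t n) ^ k)) / of_real (t n) ^ i)"
    have t: "0 < t n" "t n < 1" "t n / r = 1 / (real n + 2)" for n
      using r by (auto simp: t_def field_simps) (smt (verit) of_nat_0_le_iff mult_nonneg_nonneg)
    have g_hol: "g n holomorphic_on ball 0 1" for n
      unfolding g_def using t[of n] by (intro holomorphic_intros hol less) auto
    show "\<forall>\<^sub>F n in sequentially. continuous_on (cball 0 r) (g n) \<and> g n holomorphic_on ball 0 r"
    proof (intro always_eventually allI conjI)
      fix n
      show "g n holomorphic_on ball 0 r" using r by (intro holomorphic_on_subset[OF g_hol]) auto
      show "continuous_on (cball 0 r) (g n)"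
        using r by (intro holomorphic_on_imp_continuous_on holomorphic_on_subset[OF g_hol]) auto
    qed
    have est: "cmod (g n y - c i y) \<le> M / r ^ i * (1 / (real n + 1))" if y: "cmod y \<le> r" for n y
    proof -
      let ?t = "complex_of_real (t n)"
      have "(\<lambda>k. c k y * ?t ^ k) sums f (?t, y)" using t[of n] y r by (intro sums) auto
      then have s: "(\<lambda>k. c (k + Suc i) y * ?t ^ (k + Suc i)) sums (f (?t, y) - (\<Sum>k<Suc i. c k y * ?t ^ k))"
        by (rule sums_split_initial_segment)
      let ?q = "1 / (real n + 2)"
      have q: "norm ?q < 1" "0 < ?q" by auto
      have "(\<lambda>k. M * ?q ^ Suc i * ?q ^ k) sums (M * ?q ^ Suc i * (1 / (1 - ?q)))"
        by (intro sums_mult geometric_sums q)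
      moreover have "cmod (c (k + Suc i) y * ?t ^ (k + Suc i)) \<le> M * ?q ^ Suc i * ?q ^ k" for k
      proof -
        have "cmod (c (k + Suc i) y * ?t ^ (k + Suc i)) = cmod (c (k + Suc i) y) * t n ^ (k + Suc i)"
          using t[of n] by (simp add: norm_mult norm_power)
        also have "\<dots> \<le> M / r ^ (k + Suc i) * t n ^ (k + Suc i)"
          using t[of n] by (intro mult_right_mono M y) auto
        also have "\<dots> = M * (t n / r) ^ (k + Suc i)" by (simp add: power_divide)
        finally show ?thesis by (simp add: t(3) power_add mult_ac)
      qed
      ultimately have "cmod (f (?t, y) - (\<Sum>k<Suc i. c k y * ?t ^ k)) \<le> M * ?q ^ Suc i * (1 / (1 - ?q))"
        by (rule norm_sums_le[OF s])
      also have "\<dots> = M * ?q ^ i * (?q * (1 / (1 - ?q)))" by simp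
      also have "?q * (1 / (1 - ?q)) = 1 / (real n + 1)" by (simp add: divide_simps)
      also have "M * ?q ^ i * (1 / (real n + 1)) = M / r ^ i * (1 / (real n + 1)) * t n ^ i"
        using r by (simp add: power_divide flip: t(3))
      finally have "cmod (f (?t, y) - (\<Sum>k<Suc i. c k y * ?t ^ k)) / t n ^ i \<le> M / r ^ i * (1 / (real n + 1))"
        using t[of n] by (simp add: divide_le_eq)
      moreover have "g n y - c i y = (f (?t, y) - (\<Sum>k<Suc i. c k y * ?t ^ k)) / ?t ^ i"
        using t(1)[of n] by (simp add: g_def field_simps)
      ultimately show ?thesis using t(1)[of n] by (simp add: norm_divide norm_power)
    qed
    show "uniform_limit (cball 0 r) g (c i) sequentially"
    proof (rule uniform_limitI)
      fix e :: real assume "e > 0"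
      have "(\<lambda>n. M / r ^ i * (1 / (real n + 1))) \<longlonglongrightarrow> M / r ^ i * 0"
        by (intro tendsto_mult tendsto_const) (use LIMSEQ_inverse_real_of_nat in \<open>simp add: inverse_eq_divide add.commute\<close>)
      then have "\<forall>\<^sub>F n in sequentially. M / r ^ i * (1 / (real n + 1)) < e"
        using \<open>e > 0\<close> by (intro order_tendstoD(2)) auto
      then show "\<forall>\<^sub>F n in sequentially. \<forall>y\<in>cball 0 r. dist (g n y) (c i y) < e"
        by eventually_elim (auto simp: dist_norm intro: le_less_trans[OF est])
    qed
  qed auto
  then have "\<And>x. x \<in> ball 0 1 \<Longrightarrow> c i field_differentiable (at x)"
  proof -
    fix x :: complex assume "x \<in> ball 0 1"
    then obtain r where "0 < r" "r < 1" "cmod x < r" using power_lt_1_between[of "cmod x"] by auto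
    then show "c i field_differentiable (at x)"
      using \<open>\<And>r. _ \<Longrightarrow> _ \<Longrightarrow> c i holomorphic_on ball 0 r\<close>[of r]
      by (intro holomorphic_on_imp_differentiable_at[of _ "ball 0 r"]) auto
  qed
  then show ?case
    by (auto simp: holomorphic_on_def intro: field_differentiable_at_within)
qed

text \<open>One-variable Taylor expansion is applied twice: in \<open>x\<close>, and then in
  \<open>y\<close> to the coefficients, which are holomorphic by the preceding lemma. Two Cauchy
  estimates at the same radius give the bound on \<open>a\<close>; that bound makes the double
  family absolutely summable, so that the iterated sum is the unordered one.\<close>

lemma holomorphic2_on_bidisc_power_series:
  assumes f: "f holomorphic2_on bidisc"
  obtains a :: "nat \<times> nat \<Rightarrow> complex" where
    "\<And>r. 0 < r \<Longrightarrow> r < 1 \<Longrightarrow> \<exists>M. \<forall>i j. cmod (a (i, j)) \<le> M / r ^ (i + j)"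
    "\<And>x y. cmod x < 1 \<Longrightarrow> cmod y < 1 \<Longrightarrow> ((\<lambda>(i, j). a (i, j) * (x ^ i * y ^ j)) has_sum f (x, y)) UNIV"
proof -
  define c where "c = (\<lambda>i y. (deriv ^^ i) (\<lambda>x. f (x, y)) 0 / fact i)"
  define a where "a = (\<lambda>(i, j). (deriv ^^ j) (c i) 0 / fact j)"
  note h = holomorphic2_on_slices[OF f]
  have c_bound: "\<exists>M. \<forall>i y. cmod y \<le> r \<longrightarrow> cmod (c i y) \<le> M / r ^ i" if r: "0 < r" "r < 1" for r
  proof -
    have "compact (f ` (cball 0 r \<times> cball 0 r))"
      by (intro compact_continuous_image compact_Times continuous_on_subset[OF holomorphic2_on_imp_continuous_on[OF f]])
        (use r in \<open>auto simp: bidisc_def\<close>)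
    from compact_imp_bounded[OF this] obtain M where "\<forall>w\<in>f ` (cball 0 r \<times> cball 0 r). cmod w \<le> M"
      unfolding bounded_iff by blast
    then have M: "\<And>x y. cmod x \<le> r \<Longrightarrow> cmod y \<le> r \<Longrightarrow> cmod (f (x, y)) \<le> M" by auto
    have "cmod (c i y) \<le> M / r ^ i" if "cmod y \<le> r" for i y
    proof -
      have "cmod ((deriv ^^ i) (\<lambda>x. f (x, y)) 0) \<le> fact i * M / r ^ i"
        using r that
        by (intro Cauchy_inequality M holomorphic_on_subset[OF h(1)]
            continuous_on_subset[OF holomorphic_on_imp_continuous_on[OF h(1)]]) auto
      then show ?thesis by (simp add: c_def norm_divide field_simps)
    qed
    then show ?thesis by blast
  qed
  have c_sums: "(\<lambda>i. c i y * x ^ i) sums f (x, y)" if "cmod x < 1" "cmod y < 1" for x y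
    using holomorphic_power_series[OF h(1)[OF that(2)], of x] that by (simp add: c_def)
  have c_hol: "c i holomorphic_on ball 0 1" for i
    by (rule power_series_coefficient_holomorphic[OF h(2) c_sums c_bound])
  have a_sums: "(\<lambda>j. a (i, j) * y ^ j) sums c i y" if "cmod y < 1" for i y
    using holomorphic_power_series[OF c_hol, of y i] that by (simp add: a_def)
  have a_bound: "\<exists>M. \<forall>i j. cmod (a (i, j)) \<le> M / r ^ (i + j)" if r: "0 < r" "r < 1" for r
  proof -
    obtain M where M: "\<And>i y. cmod y \<le> r \<Longrightarrow> cmod (c i y) \<le> M / r ^ i" using c_bound[OF r] by blast
    have "cmod (a (i, j)) \<le> M / r ^ (i + j)" for i j
    proof -
      have "cmod ((deriv ^^ j) (c i) 0) \<le> fact j * (M / r ^ i) / r ^ j"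
        using r
        by (intro Cauchy_inequality M holomorphic_on_subset[OF c_hol]
            continuous_on_subset[OF holomorphic_on_imp_continuous_on[OF c_hol]]) auto
      then show ?thesis by (simp add: a_def norm_divide field_simps power_add)
    qed
    then show ?thesis by blast
  qed
  show thesis
  proof (rule that[OF a_bound])
    fix x y :: complex assume xy: "cmod x < 1" "cmod y < 1"
    \<comment> \<open>The coefficient bound is used at a radius strictly beyond both moduli, which
      leaves geometric ratios below 1.\<close>
    then obtain r where r: "0 < r" "r < 1" "max (cmod x) (cmod y) < r"
      using power_lt_1_between[of "max (cmod x) (cmod y)"] by auto
    obtain M where M: "\<And>i j. cmod (a (i, j)) \<le> M / r ^ (i + j)" using a_bound[OF r(1,2)] by blast
    let ?g = "\<lambda>(i, j). a (i, j) * (x ^ i * y ^ j)"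
    have "(\<lambda>(i, j). (cmod x / r) ^ i * (cmod y / r) ^ j) summable_on UNIV"
      by (intro summable_on_times summable_on_geometric) (use r in auto)
    then have "(\<lambda>p. M * (case p of (i, j) \<Rightarrow> (cmod x / r) ^ i * (cmod y / r) ^ j)) summable_on UNIV"
      by (rule summable_on_cmult_right)
    then have "(\<lambda>p. cmod (?g p)) summable_on UNIV"
    proof (rule summable_on_comparison_test)
      show "cmod (?g p) \<le> M * (case p of (i, j) \<Rightarrow> (cmod x / r) ^ i * (cmod y / r) ^ j)" for p
      proof (cases p)
        case (Pair i j)
        have "cmod (?g p) \<le> M / r ^ (i + j) * (cmod x ^ i * cmod y ^ j)"
          using mult_right_mono[OF M[of i j], of "cmod x ^ i * cmod y ^ j"]
          by (simp add: Pair norm_mult norm_power)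
        then show ?thesis by (simp add: Pair power_divide power_add)
      qed
    qed auto
    then have S: "?g summable_on UNIV" by (rule abs_summable_summable)
    then have S': "(\<lambda>(i, j). a (i, j) * (x ^ i * y ^ j)) summable_on (UNIV \<times> UNIV)" by simp
    have "((\<lambda>i. \<Sum>\<^sub>\<infinity>j. a (i, j) * (x ^ i * y ^ j)) has_sum infsum ?g UNIV) UNIV"
      using has_sum_infsum[OF summable_on_Sigma_banach[OF S']] infsum_Sigma'_banach[OF S'] by simp
    moreover have "(\<Sum>\<^sub>\<infinity>j. a (i, j) * (x ^ i * y ^ j)) = c i y * x ^ i" for i
    proof -
      have "(\<lambda>j. a (i, j) * (x ^ i * y ^ j)) summable_on UNIV"
        using summable_on_SigmaD1[of "\<lambda>i j. a (i, j) * (x ^ i * y ^ j)" UNIV "\<lambda>_. UNIV" i] S' by simp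
      then have "(\<lambda>j. a (i, j) * (x ^ i * y ^ j)) sums (\<Sum>\<^sub>\<infinity>j. a (i, j) * (x ^ i * y ^ j))"
        by (intro has_sum_imp_sums has_sum_infsum)
      moreover have "(\<lambda>j. x ^ i * (a (i, j) * y ^ j)) sums (x ^ i * c i y)"
        by (intro sums_mult a_sums xy)
      ultimately show ?thesis by (simp add: mult_ac sums_unique2)
    qed
    ultimately have "(\<lambda>i. c i y * x ^ i) sums infsum ?g UNIV" by (simp add: has_sum_imp_sums)
    then have eq: "infsum ?g UNIV = f (x, y)" by (rule sums_unique2[OF _ c_sums[OF xy]])
    show "(?g has_sum f (x, y)) UNIV" using has_sum_infsum[OF S] unfolding eq .
  qed
qed

subsection \<open>Parseval's identity on the circle and on the torus\<close>

lemma borel_measurable_cis [measurable]: "cis \<in> borel_measurable borel"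
  by (intro borel_measurable_continuous_onI continuous_intros)

lemma borel_measurable_cnj [measurable]: "cnj \<in> borel_measurable borel"
  by (intro borel_measurable_continuous_onI continuous_intros)

lemma prob_space_circle: "prob_space circle_measure"
proof -
  interpret u: prob_space "uniform_measure lborel {0..2 * pi}"
    by (rule prob_space_uniform_measure) auto
  show ?thesis unfolding circle_measure_def
    by (rule u.prob_space_distr) (simp add: uniform_measure_def)
qed

interpretation circle: prob_space circle_measure
  by (rule prob_space_circle)

lemma sets_circle_measure [simp, measurable_cong]: "sets circle_measure = sets borel"
  by (simp add: circle_measure_def)

lemma space_circle_measure [simp]: "space circle_measure = UNIV"
  by (simp add: circle_measure_def)

lemma AE_circle: "AE \<zeta> in circle_measure. cmod \<zeta> = 1"
proof -
  have "cis \<in> measurable (uniform_measure lborel {0..2 * pi}) borel"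
    by (simp add: uniform_measure_def)
  moreover have "{\<zeta> \<in> space borel. cmod \<zeta> = 1} \<in> sets borel" by simp
  ultimately show ?thesis
    unfolding circle_measure_def by (simp add: AE_distr_iff)
qed

lemma circle_integral_monomials:
  "(\<integral>\<zeta>. \<zeta> ^ m * cnj \<zeta> ^ n \<partial>circle_measure) = (if m = n then 1 else 0)"
proof -
  let ?k = "real m - real n"
  have [measurable]: "cis \<in> measurable (uniform_measure lborel {0..2 * pi}) borel"
    by (simp add: uniform_measure_def)
  have "(\<integral>\<zeta>. \<zeta> ^ m * cnj \<zeta> ^ n \<partial>circle_measure)
      = (\<integral>t. cis t ^ m * cnj (cis t) ^ n \<partial>uniform_measure lborel {0..2 * pi})"
    unfolding circle_measure_def by (rule integral_distr) measurable
  also have "\<dots> = (\<integral>t. cis (?k * t) \<partial>uniform_measure lborel {0..2 * pi})"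
    by (intro Bochner_Integration.integral_cong refl)
      (simp add: cis_cnj Complex.DeMoivre cis_mult algebra_simps)
  also have "uniform_measure lborel {0..2 * pi}
      = density lborel (\<lambda>t. ennreal (indicator {0..2 * pi} t / (2 * pi)))"
    unfolding uniform_measure_def
    by (intro arg_cong[where f = "density lborel"] ext)
       (simp add: divide_ennreal flip: ennreal_indicator)
  also have "(\<integral>t. cis (?k * t) \<partial>density lborel (\<lambda>t. ennreal (indicator {0..2 * pi} t / (2 * pi))))
      = (\<integral>t. (indicator {0..2 * pi} t / (2 * pi)) *\<^sub>R cis (?k * t) \<partial>lborel)"
    by (rule integral_density) auto
  also have "\<dots> = (\<integral>t. indicator {0..2 * pi} t *\<^sub>R (cis (?k * t) / (2 * pi)) \<partial>lborel)"
    by (intro Bochner_Integration.integral_cong refl) (auto simp: indicator_def scaleR_conv_of_real)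
  also have "\<dots> = (if m = n then 1 else 0)"
  proof (cases "m = n")
    case True
    have "(\<integral>t. indicator {0..2 * pi} t *\<^sub>R (cis (?k * t) / (2 * pi)) \<partial>lborel)
        = complex_of_real (2 * pi) / complex_of_real (2 * pi) - complex_of_real 0 / complex_of_real (2 * pi)"
      by (rule integral_FTC_Icc[where F = "\<lambda>t. complex_of_real t / complex_of_real (2 * pi)"])
        (use True in \<open>auto intro!: derivative_eq_intros has_vector_derivative_of_real simp: field_simps\<close>)
    then show ?thesis using True by simp
  next
    case False
    let ?F = "\<lambda>t. cis (?k * t) / (2 * pi * (\<i> * ?k))"
    have "(\<integral>t. indicator {0..2 * pi} t *\<^sub>R (cis (?k * t) / (2 * pi)) \<partial>lborel) = ?F (2 * pi) - ?F 0"
    proof (rule integral_FTC_Icc)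
      show "(?F has_vector_derivative cis (?k * t) / (2 * pi)) (at t within {0..2 * pi})" for t
      proof -
        define K where "K = complex_of_real ?k"
        have K: "K \<noteq> 0" using False by (simp add: K_def)
        have cis: "cis (?k * t) = exp (\<i> * K * complex_of_real t)" for t
          by (simp add: cis_conv_exp K_def mult_ac)
        show ?thesis unfolding cis K_def[symmetric]
          by (rule has_vector_derivative_real_field) (auto intro!: derivative_eq_intros simp: K)
      qed
      show "continuous_on {0..2 * pi} (\<lambda>t. cis (?k * t) / (2 * pi))"
        by (auto intro!: continuous_intros)
    qed auto
    also have "cis (?k * (2 * pi)) = 1"
      using cis_multiple_2pi[of "?k"] by (simp add: mult_ac Ints_diff)
    finally show ?thesis using False by simp
  qed
  finally show ?thesis .
qed

lemma circle_nn_integral_polynomial: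
  "(\<integral>\<^sup>+\<zeta>. ennreal ((cmod (\<Sum>n<N. b n * \<zeta> ^ n))\<^sup>2) \<partial>circle_measure) = (\<Sum>n<N. ennreal ((cmod (b n))\<^sup>2))"
proof -
  let ?g = "\<lambda>\<zeta>. \<Sum>n<N. b n * \<zeta> ^ n"
  have int: "integrable circle_measure (\<lambda>\<zeta>. \<zeta> ^ m * cnj \<zeta> ^ n)" for m n
    by (rule circle.integrable_const_bound[where B = 1])
      (use AE_circle in eventually_elim, simp add: norm_mult norm_power, measurable)
  have sq: "complex_of_real ((cmod (?g \<zeta>))\<^sup>2) = (\<Sum>m<N. \<Sum>n<N. (b m * cnj (b n)) * (\<zeta> ^ m * cnj \<zeta> ^ n))" for \<zeta>
    unfolding complex_norm_square cnj_sum sum_product by (intro sum.cong refl) (simp add: mult_ac)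
  have "integrable circle_measure (\<lambda>\<zeta>. complex_of_real ((cmod (?g \<zeta>))\<^sup>2))"
    unfolding sq by (intro Bochner_Integration.integrable_sum integrable_mult_right int)
  then have integ: "integrable circle_measure (\<lambda>\<zeta>. (cmod (?g \<zeta>))\<^sup>2)"
    by (simp only: complex_of_real_integrable_eq)
  have "complex_of_real (\<integral>\<zeta>. (cmod (?g \<zeta>))\<^sup>2 \<partial>circle_measure)
      = (\<integral>\<zeta>. complex_of_real ((cmod (?g \<zeta>))\<^sup>2) \<partial>circle_measure)"
    by (simp only: integral_complex_of_real)
  also have "\<dots> = (\<Sum>m<N. \<Sum>n<N. (b m * cnj (b n)) * (if m = n then 1 else 0))"
    unfolding sq by (subst Bochner_Integration.integral_sum, intro Bochner_Integration.integrable_sum integrable_mult_right int)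
      (intro sum.cong refl, subst Bochner_Integration.integral_sum, auto intro!: integrable_mult_right int simp: circle_integral_monomials)
  also have "\<dots> = (\<Sum>m<N. b m * cnj (b m))"
    by (intro sum.cong refl) (simp add: if_distrib[of "\<lambda>x. _ * x"] cong: if_cong)
  also have "\<dots> = complex_of_real (\<Sum>m<N. (cmod (b m))\<^sup>2)"
    by (simp only: of_real_sum complex_norm_square)
  finally have "(\<integral>\<zeta>. (cmod (?g \<zeta>))\<^sup>2 \<partial>circle_measure) = (\<Sum>m<N. (cmod (b m))\<^sup>2)"
    by (simp only: of_real_eq_iff)
  then show ?thesis
    using integ by (subst nn_integral_eq_integral) (auto simp: sum_ennreal)
qed

text \<open>Passes from polynomials to absolutely convergent series by dominated convergence, with
  the square of the sum of \<open>cmod (b n)\<close> as constant majorant.\<close>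

lemma circle_parseval:
  assumes b: "summable (\<lambda>n. cmod (b n))"
    and G: "\<And>\<zeta>. cmod \<zeta> = 1 \<Longrightarrow> (\<lambda>n. b n * \<zeta> ^ n) sums G \<zeta>"
  shows "(\<integral>\<^sup>+\<zeta>. ennreal ((cmod (G \<zeta>))\<^sup>2) \<partial>circle_measure) = (\<Sum>n. ennreal ((cmod (b n))\<^sup>2))"
proof -
  \<comment> \<open>\<open>G\<close> is controlled only on the circle; \<open>G'\<close> is a
    measurable function that agrees with it there, hence almost everywhere.\<close>
  define G' where "G' = (\<lambda>\<zeta>. \<Sum>n. b n * \<zeta> ^ n)"
  have [measurable]: "G' \<in> borel_measurable borel" unfolding G'_def by measurable
  have GG': "G \<zeta> = G' \<zeta>" if "cmod \<zeta> = 1" for \<zeta>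
    using sums_unique[OF G[OF that]] by (simp add: G'_def)
  have "(\<lambda>N. \<integral>\<^sup>+\<zeta>. ennreal ((cmod (\<Sum>n<N. b n * \<zeta> ^ n))\<^sup>2) \<partial>circle_measure)
      \<longlonglongrightarrow> (\<integral>\<^sup>+\<zeta>. ennreal ((cmod (G' \<zeta>))\<^sup>2) \<partial>circle_measure)"
  proof (rule nn_integral_dominated_convergence[where w = "\<lambda>_. ennreal ((\<Sum>n. cmod (b n))\<^sup>2)"])
    show "AE \<zeta> in circle_measure. ennreal ((cmod (\<Sum>n<N. b n * \<zeta> ^ n))\<^sup>2) \<le> ennreal ((\<Sum>n. cmod (b n))\<^sup>2)" for N
      using AE_circle
    proof eventually_elim
      case (elim \<zeta>)
      have "cmod (\<Sum>n<N. b n * \<zeta> ^ n) \<le> (\<Sum>n<N. cmod (b n))"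
        using elim by (intro sum_norm_le) (simp add: norm_mult norm_power)
      also have "\<dots> \<le> (\<Sum>n. cmod (b n))" using b by (intro sum_le_suminf) auto
      finally show ?case by (intro ennreal_leI power_mono) auto
    qed
    show "AE \<zeta> in circle_measure. (\<lambda>N. ennreal ((cmod (\<Sum>n<N. b n * \<zeta> ^ n))\<^sup>2)) \<longlonglongrightarrow> ennreal ((cmod (G' \<zeta>))\<^sup>2)"
      using AE_circle
    proof eventually_elim
      case (elim \<zeta>)
      show ?case using G[OF elim] unfolding GG'[OF elim, symmetric] sums_def
        by (intro tendsto_ennrealI tendsto_intros)
    qed
  qed (use circle.emeasure_space_1 in auto)
  moreover have "(\<lambda>N. \<Sum>n<N. ennreal ((cmod (b n))\<^sup>2)) \<longlonglongrightarrow> (\<Sum>n. ennreal ((cmod (b n))\<^sup>2))"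
    by (rule summable_LIMSEQ) auto
  ultimately have "(\<integral>\<^sup>+\<zeta>. ennreal ((cmod (G' \<zeta>))\<^sup>2) \<partial>circle_measure) = (\<Sum>n. ennreal ((cmod (b n))\<^sup>2))"
    unfolding circle_nn_integral_polynomial by (rule LIMSEQ_unique)
  moreover have "(\<integral>\<^sup>+\<zeta>. ennreal ((cmod (G \<zeta>))\<^sup>2) \<partial>circle_measure) = (\<integral>\<^sup>+\<zeta>. ennreal ((cmod (G' \<zeta>))\<^sup>2) \<partial>circle_measure)"
    by (rule nn_integral_cong_AE) (use AE_circle in eventually_elim, simp add: GG')
  ultimately show ?thesis by simp
qed

text \<open>Tonelli reduces this to the circle twice: for fixed \<open>y\<close> the slice is a
  power series in \<open>x\<close> with coefficients \<open>C i y\<close>, and each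
  \<open>C i\<close> is in turn a power series in \<open>y\<close>.\<close>

lemma torus_parseval:
  fixes a :: "nat \<times> nat \<Rightarrow> complex"
  assumes a: "(\<lambda>p. cmod (a p)) summable_on UNIV"
    and F: "\<And>x y. cmod x = 1 \<Longrightarrow> cmod y = 1 \<Longrightarrow> ((\<lambda>(i, j). a (i, j) * (x ^ i * y ^ j)) has_sum F (x, y)) UNIV"
    and [measurable]: "F \<in> borel_measurable borel"
  shows "(\<integral>\<^sup>+z. ennreal ((cmod (F z))\<^sup>2) \<partial>torus_measure) = (\<integral>\<^sup>+p. ennreal ((cmod (a p))\<^sup>2) \<partial>count_space UNIV)"
proof -
  have F_meas: "F \<in> borel_measurable (circle_measure \<Otimes>\<^sub>M circle_measure)"
  proof -
    have "sets (circle_measure \<Otimes>\<^sub>M circle_measure) = sets (borel :: (complex \<times> complex) measure)"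
      by (simp only: borel_prod[symmetric] sets_circle_measure cong: sets_pair_measure_cong)
    then show ?thesis using assms(3) by (simp cong: measurable_cong_sets)
  qed
  \<comment> \<open>An ordinary series is measurable in \<open>y\<close> everywhere; it is
    identified with the unordered sum only for unimodular \<open>y\<close>.\<close>
  define C where "C = (\<lambda>i y. \<Sum>j. a (i, j) * y ^ j)"
  have [measurable]: "C i \<in> borel_measurable borel" for i unfolding C_def by measurable
  have a': "(\<lambda>p. cmod (a p)) summable_on (UNIV \<times> UNIV)" using a by simp
  have row: "(\<lambda>j. cmod (a (i, j))) summable_on UNIV" for i
    using summable_on_SigmaD1[of "\<lambda>i j. cmod (a (i, j))" UNIV "\<lambda>_. UNIV" i] a' by (simp add: case_prod_unfold)
  have C_sums: "((\<lambda>j. a (i, j) * y ^ j) has_sum C i y) UNIV" if y: "cmod y = 1" for i y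
  proof -
    have "(\<lambda>j. cmod (a (i, j) * y ^ j)) summable_on UNIV"
      using row[of i] y by (simp add: norm_mult norm_power)
    then have "(\<lambda>j. a (i, j) * y ^ j) summable_on UNIV" by (rule abs_summable_summable)
    then have h: "((\<lambda>j. a (i, j) * y ^ j) has_sum (\<Sum>\<^sub>\<infinity>j. a (i, j) * y ^ j)) UNIV" by simp
    moreover have "C i y = (\<Sum>\<^sub>\<infinity>j. a (i, j) * y ^ j)"
      unfolding C_def using has_sum_imp_sums[OF h] by (rule sums_unique[symmetric])
    ultimately show ?thesis by simp
  qed
  have inner: "(\<integral>\<^sup>+x. ennreal ((cmod (F (x, y)))\<^sup>2) \<partial>circle_measure) = (\<Sum>i. ennreal ((cmod (C i y))\<^sup>2))"
    if y: "cmod y = 1" for y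
  proof (rule circle_parseval)
    have sumC: "((\<lambda>(i, j). a (i, j) * (x ^ i * y ^ j)) has_sum F (x, y)) (UNIV \<times> UNIV)" if "cmod x = 1" for x
      using F[OF that y] by simp
    show "(\<lambda>i. C i y * x ^ i) sums F (x, y)" if x: "cmod x = 1" for x
    proof -
      have "((\<lambda>i. C i y * x ^ i) has_sum F (x, y)) UNIV"
      proof (rule has_sum_SigmaD[OF sumC[OF x]])
        show "((\<lambda>j. case (i, j) of (i, j) \<Rightarrow> a (i, j) * (x ^ i * y ^ j)) has_sum C i y * x ^ i) UNIV" for i
          using has_sum_cmult_left[OF C_sums[OF y, of i], of "x ^ i"] by (simp add: mult_ac)
      qed
      then show ?thesis by (rule has_sum_imp_sums)
    qed
    show "summable (\<lambda>i. cmod (C i y))"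
    proof -
      have "(\<lambda>i. \<Sum>\<^sub>\<infinity>j. cmod (a (i, j))) summable_on UNIV"
        using summable_on_Sigma_banach[of "\<lambda>i j. cmod (a (i, j))" UNIV "\<lambda>_. UNIV"] a' by (simp add: case_prod_unfold)
      moreover have "cmod (C i y) \<le> (\<Sum>\<^sub>\<infinity>j. cmod (a (i, j)))" for i
        by (rule norm_infsum_le[OF C_sums[OF y] has_sum_infsum[OF row]])
          (use y in \<open>simp add: norm_mult norm_power\<close>)
      ultimately have "(\<lambda>i. cmod (C i y)) summable_on UNIV"
        by (rule summable_on_comparison_test) auto
      then show ?thesis by (rule summable_on_imp_summable)
    qed
  qed
  have "(\<integral>\<^sup>+z. ennreal ((cmod (F z))\<^sup>2) \<partial>torus_measure)
      = (\<integral>\<^sup>+y. \<integral>\<^sup>+x. ennreal ((cmod (F (x, y)))\<^sup>2) \<partial>circle_measure \<partial>circle_measure)"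
  proof -
    interpret P: pair_sigma_finite circle_measure circle_measure ..
    show ?thesis unfolding torus_measure_def
      using F_meas by (subst P.nn_integral_snd[symmetric]) auto
  qed
  also have "\<dots> = (\<integral>\<^sup>+y. (\<Sum>i. ennreal ((cmod (C i y))\<^sup>2)) \<partial>circle_measure)"
    by (rule nn_integral_cong_AE) (use AE_circle in eventually_elim, rule inner)
  also have "\<dots> = (\<Sum>i. \<integral>\<^sup>+y. ennreal ((cmod (C i y))\<^sup>2) \<partial>circle_measure)"
    by (rule nn_integral_suminf) measurable
  also have "\<dots> = (\<Sum>i. \<Sum>j. ennreal ((cmod (a (i, j)))\<^sup>2))"
    by (intro suminf_cong circle_parseval summable_on_imp_summable row has_sum_imp_sums C_sums)
  also have "\<dots> = (\<integral>\<^sup>+p. ennreal ((cmod (a p))\<^sup>2) \<partial>count_space UNIV)"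
    by (simp add: nn_integral_fst_count_space[symmetric] nn_integral_count_space_nat)
  finally show ?thesis .
qed

section \<open>Square sums as integrals, and the supremum over radii\<close>

lemma nn_integral_count_l2:
  assumes "a \<in> hcarrier l2"
  shows "(\<integral>\<^sup>+p. ennreal ((cmod (a p))\<^sup>2) \<partial>count_space UNIV) = ennreal ((hnorm l2 a)\<^sup>2)"
proof -
  have "Infinite_Set_Sum.abs_summable_on (\<lambda>p. (cmod (a p))\<^sup>2) UNIV"
    using assms by (simp add: l2_iff flip: abs_summable_equivalent)
  then show ?thesis
    by (simp add: nn_integral_conv_infsetsum infsetsum_infsum hnorm_l2_sq[OF assms])
qed

lemma l2_nn_integral_count:
  assumes "(\<integral>\<^sup>+p. ennreal ((cmod (a p))\<^sup>2) \<partial>count_space UNIV) < \<infinity>"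
  shows "a \<in> hcarrier l2"
proof -
  have "Infinite_Set_Sum.abs_summable_on (\<lambda>p. (cmod (a p))\<^sup>2) UNIV"
    using assms unfolding Infinite_Set_Sum.abs_summable_on_def
    by (intro integrableI_bounded) auto
  then show ?thesis by (simp add: l2_iff flip: abs_summable_equivalent)
qed

text \<open>Each term grows with r, so monotone convergence along radii tending to 1 recovers the
  full square sum. The exponent \<open>g\<close> is the degree in one variable and the total degree
  in two.\<close>

lemma SUP_radius_nn_integral_count:
  fixes a :: "'i \<Rightarrow> complex" and g :: "'i \<Rightarrow> nat"
  shows "(SUP r\<in>{0<..<1::real}. \<integral>\<^sup>+p. ennreal ((cmod (a p * of_real r ^ g p))\<^sup>2) \<partial>count_space UNIV)
    = (\<integral>\<^sup>+p. ennreal ((cmod (a p))\<^sup>2) \<partial>count_space UNIV)" (is "?S = ?I")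
proof (rule antisym)
  show "?S \<le> ?I"
  proof (intro SUP_least nn_integral_mono ennreal_leI power_mono)
    fix r :: real and p assume "r \<in> {0<..<1}"
    then show "cmod (a p * of_real r ^ g p) \<le> cmod (a p)"
      by (simp add: norm_mult norm_power mult_left_le power_le_one)
  qed auto
  \<comment> \<open>The offset 2 keeps every radius inside the open interval, the first one being
    1/2.\<close>
  define r where "r = (\<lambda>n. 1 - 1 / (real n + 2))"
  have r: "r n \<in> {0<..<1}" for n by (simp add: r_def field_simps)
  have mono: "r m \<le> r n" if "m \<le> n" for m n using that by (simp add: r_def field_simps)
  have "r \<longlonglongrightarrow> 1 - 0" unfolding r_def
    by (intro tendsto_diff tendsto_const) real_asymp
  then have lim: "r \<longlonglongrightarrow> 1" by simp
  let ?f = "\<lambda>n p. ennreal ((cmod (a p * of_real (r n) ^ g p))\<^sup>2)"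
  have inc: "incseq ?f"
  proof (intro incseq_SucI le_funI ennreal_leI power_mono)
    fix n p
    have "0 < r n" "r n \<le> r (Suc n)" using r[of n] mono[of n "Suc n"] by auto
    then show "cmod (a p * of_real (r n) ^ g p) \<le> cmod (a p * of_real (r (Suc n)) ^ g p)"
      by (simp add: norm_mult norm_power mult_left_mono power_mono)
  qed simp
  have "(SUP n. ?f n p) = ennreal ((cmod (a p))\<^sup>2)" for p
  proof (rule LIMSEQ_unique[OF LIMSEQ_SUP])
    show "incseq (\<lambda>n. ?f n p)" using inc by (auto simp: incseq_def le_fun_def)
    have "(\<lambda>n. ?f n p) \<longlonglongrightarrow> ennreal ((cmod (a p * of_real 1 ^ g p))\<^sup>2)"
      by (intro tendsto_ennrealI tendsto_intros lim)
    then show "(\<lambda>n. ?f n p) \<longlonglongrightarrow> ennreal ((cmod (a p))\<^sup>2)" by simp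
  qed
  then have "?I = (\<integral>\<^sup>+p. (SUP n. ?f n p) \<partial>count_space UNIV)" by simp
  also have "\<dots> = (SUP n. \<integral>\<^sup>+p. ?f n p \<partial>count_space UNIV)"
    by (rule nn_integral_monotone_convergence_SUP[OF inc]) auto
  also have "\<dots> \<le> ?S" using r by (intro SUP_mono) blast
  finally show "?I \<le> ?S" .
qed

lemma borel_measurable_zero_off:
  fixes f :: "'x::topological_space \<Rightarrow> complex"
  assumes "continuous_on S f" "zero_off S f" "open S"
  shows "f \<in> borel_measurable borel"
proof -
  have "(\<lambda>x. indicator S x *\<^sub>R f x) \<in> borel_measurable borel"
    using assms by (intro borel_measurable_continuous_on_indicator) auto
  also have "(\<lambda>x. indicator S x *\<^sub>R f x) = f"
    using assms(2) by (auto simp: zero_off_def indicator_def fun_eq_iff)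
  finally show ?thesis .
qed

lemma zero_off_cut [simp]: "zero_off S (cut S f)"
  by (simp add: zero_off_def cut_def)

lemma cut_eqI: "zero_off S g \<Longrightarrow> (\<And>x. x \<in> S \<Longrightarrow> f x = g x) \<Longrightarrow> cut S f = g"
  by (auto simp: cut_def zero_off_def)

lemma holomorphic2_on_cong:
  assumes "\<And>z. z \<in> S \<Longrightarrow> f z = g z"
  shows "f holomorphic2_on S \<longleftrightarrow> g holomorphic2_on S"
proof -
  have "g holomorphic2_on S" if eq: "\<And>z. z \<in> S \<Longrightarrow> g z = f z" and f: "f holomorphic2_on S" for f g
    unfolding holomorphic2_on_def
  proof
    fix z assume z: "z \<in> S"
    then obtain a b where "(f has_derivative (\<lambda>(h, k). a * h + b * k)) (at z within S)"
      using f unfolding holomorphic2_on_def by blast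
    from has_derivative_transform[OF z eq this]
    show "\<exists>a b. (g has_derivative (\<lambda>(h, k). a * h + b * k)) (at z within S)" by blast
  qed
  then show ?thesis using assms by metis
qed

subsection \<open>The Hardy space of the bidisc\<close>

definition mono2 :: "nat \<times> nat \<Rightarrow> complex \<times> complex \<Rightarrow> complex" where
  "mono2 = (\<lambda>(i, j) z. fst z ^ i * snd z ^ j)"

definition bidisc_synth :: "(nat \<times> nat \<Rightarrow> complex) \<Rightarrow> complex \<times> complex \<Rightarrow> complex" where
  "bidisc_synth a = cut bidisc (\<lambda>z. \<Sum>\<^sub>\<infinity>p. a p * mono2 p z)"

lemma in_bidisc: "z \<in> bidisc \<longleftrightarrow> cmod (fst z) < 1 \<and> cmod (snd z) < 1"
  by (cases z) (simp add: bidisc_def)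

lemma bidisc_nbhd:
  assumes "z \<in> bidisc"
  obtains r d where "0 < r" "r < 1" "d > 0"
    "\<And>w. dist z w < d \<Longrightarrow> cmod (fst w) \<le> r \<and> cmod (snd w) \<le> r"
proof -
  obtain r where r: "0 < r" "r < 1" "max (cmod (fst z)) (cmod (snd z)) < r"
    using power_lt_1_between[of "max (cmod (fst z)) (cmod (snd z))"] assms by (auto simp: in_bidisc)
  define d where "d = r - max (cmod (fst z)) (cmod (snd z))"
  have "cmod (fst w) \<le> r \<and> cmod (snd w) \<le> r" if "dist z w < d" for w
  proof -
    have "cmod (fst w) \<le> cmod (fst z) + dist z w" "cmod (snd w) \<le> cmod (snd z) + dist z w"
      using dist_fst_le[of z w] dist_snd_le[of z w]
        norm_triangle_sub[of "fst w" "fst z"] norm_triangle_sub[of "snd w" "snd z"]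
      by (simp_all add: dist_norm norm_minus_commute)
    then show ?thesis using that by (auto simp: d_def)
  qed
  with r show ?thesis by (intro that[of r d]) (auto simp: d_def)
qed

lemma mono2_le: "cmod (fst w) \<le> r \<Longrightarrow> cmod (snd w) \<le> r \<Longrightarrow> cmod (mono2 p w) \<le> r ^ fst p * r ^ snd p"
  by (cases p) (simp add: mono2_def norm_mult norm_power mult_mono power_mono order_trans[OF norm_ge_zero])

lemma bidisc_majorant:
  fixes r C :: real
  assumes "0 \<le> r" "r < 1"
  shows "(\<lambda>p. C * (r ^ fst p * r ^ snd p)) summable_on UNIV"
proof -
  have "(\<lambda>(i, j). r ^ i * r ^ j) summable_on UNIV"
    using assms by (intro summable_on_times[of "\<lambda>i. r ^ i" "\<lambda>i. r ^ i"] summable_on_geometric) auto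
  then show ?thesis by (intro summable_on_cmult_right) (simp add: case_prod_unfold)
qed

lemma bidisc_synth_summable:
  assumes "a \<in> hcarrier l2" "z \<in> bidisc"
  shows "(\<lambda>p. a p * mono2 p z) summable_on UNIV"
proof -
  obtain r d where r: "0 < r" "r < 1" "d > 0"
    "\<And>w. dist z w < d \<Longrightarrow> cmod (fst w) \<le> r \<and> cmod (snd w) \<le> r" using bidisc_nbhd[OF assms(2)] by metis
  have "cmod (a p * mono2 p z) \<le> hnorm l2 a * (r ^ fst p * r ^ snd p)" for p
    unfolding norm_mult using r(4)[of z] r(3)
    by (intro mult_mono l2_coord_le assms mono2_le hnorm_l2_nonneg) auto
  then have "(\<lambda>p. cmod (a p * mono2 p z)) summable_on UNIV"
    using r by (intro summable_on_comparison_test[OF bidisc_majorant[of r "hnorm l2 a"]]) auto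
  then show ?thesis by (rule abs_summable_summable)
qed

lemma holomorphic2_bidisc_synth:
  assumes "a \<in> hcarrier l2"
  shows "bidisc_synth a holomorphic2_on bidisc"
proof -
  have "(\<lambda>z. \<Sum>\<^sub>\<infinity>p. a p * mono2 p z) holomorphic2_on bidisc"
  proof (rule holomorphic2_on_infsum[OF open_bidisc])
    show "(\<lambda>x. a p * mono2 p (x, y)) holomorphic_on UNIV" "(\<lambda>y. a p * mono2 p (x, y)) holomorphic_on UNIV" for p x y
      by (cases p; auto simp: mono2_def intro!: holomorphic_intros)+
    fix z assume "z \<in> bidisc"
    then obtain r d where r: "0 < r" "r < 1" "d > 0"
      "\<And>w. dist z w < d \<Longrightarrow> cmod (fst w) \<le> r \<and> cmod (snd w) \<le> r" using bidisc_nbhd by metis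
    have "cmod (a p * mono2 p w) \<le> hnorm l2 a * (r ^ fst p * r ^ snd p)" if "dist z w < d" for p w
      unfolding norm_mult using r(4)[OF that]
      by (intro mult_mono l2_coord_le assms mono2_le hnorm_l2_nonneg) auto
    then show "\<exists>d>0. \<exists>M. M summable_on UNIV \<and> (\<forall>w\<in>bidisc. dist z w < d \<longrightarrow> (\<forall>p. cmod (a p * mono2 p w) \<le> M p))"
      using r bidisc_majorant[of r "hnorm l2 a"] by (intro exI[of _ d] conjI exI[of _ "\<lambda>p. hnorm l2 a * (r ^ fst p * r ^ snd p)"]) auto
  qed
  then show ?thesis
    by (subst holomorphic2_on_cong[where g = "\<lambda>z. \<Sum>\<^sub>\<infinity>p. a p * mono2 p z"]) (auto simp: bidisc_synth_def cut_def)
qed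

text \<open>On the torus of radius r the coefficients are damped by r to the total degree; Parseval
  applies at each radius and the supremum removes the damping. Both directions of the identification
  with \<open>l2\<close> use it: the isometry, and square-summability of Taylor
  coefficients.\<close>

lemma mean_sq2_power_series:
  fixes a :: "nat \<times> nat \<Rightarrow> complex"
  assumes f: "f holomorphic2_on bidisc" "zero_off bidisc f"
    and bound: "\<And>r. 0 < r \<Longrightarrow> r < 1 \<Longrightarrow> \<exists>M. \<forall>i j. cmod (a (i, j)) \<le> M / r ^ (i + j)"
    and has_sum: "\<And>x y. cmod x < 1 \<Longrightarrow> cmod y < 1 \<Longrightarrow> ((\<lambda>(i, j). a (i, j) * (x ^ i * y ^ j)) has_sum f (x, y)) UNIV"
  shows "mean_sq2 f = (\<integral>\<^sup>+p. ennreal ((cmod (a p))\<^sup>2) \<partial>count_space UNIV)"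
proof -
  have [measurable]: "f \<in> borel_measurable borel"
    using holomorphic2_on_imp_continuous_on[OF f(1)] f(2) open_bidisc by (rule borel_measurable_zero_off)
  have "(\<integral>\<^sup>+\<zeta>. ennreal ((cmod (f (of_real r * fst \<zeta>, of_real r * snd \<zeta>)))\<^sup>2) \<partial>torus_measure)
      = (\<integral>\<^sup>+p. ennreal ((cmod (a p * of_real r ^ (fst p + snd p)))\<^sup>2) \<partial>count_space UNIV)"
    if r: "r \<in> {0<..<1}" for r :: real
  proof (rule torus_parseval[where F = "\<lambda>\<zeta>. f (of_real r * fst \<zeta>, of_real r * snd \<zeta>)"])
    \<comment> \<open>A second radius beyond \<open>r\<close> turns the coefficient bound into
      absolute summability with ratio r/s.\<close>
    obtain s where s: "r < s" "s < 1" using r dense[of r 1] by auto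
    then obtain M where M: "\<And>i j. cmod (a (i, j)) \<le> M / s ^ (i + j)" using bound[of s] r by auto
    show "(\<lambda>p. cmod (a p * of_real r ^ (fst p + snd p))) summable_on UNIV"
    proof (rule summable_on_comparison_test[OF bidisc_majorant[of "r / s" M]])
      fix p :: "nat \<times> nat"
      have "cmod (a p * of_real r ^ (fst p + snd p)) \<le> M / s ^ (fst p + snd p) * r ^ (fst p + snd p)"
        using r mult_right_mono[OF M[of "fst p" "snd p"], of "r ^ (fst p + snd p)"]
        by (simp add: norm_mult norm_power)
      then show "cmod (a p * of_real r ^ (fst p + snd p)) \<le> M * ((r / s) ^ fst p * (r / s) ^ snd p)"
        by (simp add: power_add power_divide)
    qed (use r s in auto)
    show "((\<lambda>(i, j). a (i, j) * of_real r ^ (fst (i, j) + snd (i, j)) * (x ^ i * y ^ j)) has_sum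
        f (of_real r * fst (x, y), of_real r * snd (x, y))) UNIV" if "cmod x = 1" "cmod y = 1" for x y
    proof -
      have "((\<lambda>(i, j). a (i, j) * ((of_real r * x) ^ i * (of_real r * y) ^ j)) has_sum f (of_real r * x, of_real r * y)) UNIV"
        using r that by (intro has_sum) (auto simp: norm_mult)
      then show ?thesis by (simp add: power_mult_distrib power_add mult_ac)
    qed
    have "(\<lambda>\<zeta>. (complex_of_real r * fst \<zeta>, complex_of_real r * snd \<zeta>)) \<in> borel_measurable borel"
      by (intro borel_measurable_continuous_onI continuous_intros)
    then show "(\<lambda>\<zeta>. f (of_real r * fst \<zeta>, of_real r * snd \<zeta>)) \<in> borel_measurable borel"
      by measurable
  qed
  then have "mean_sq2 f = (SUP r\<in>{0<..<1::real}.
      \<integral>\<^sup>+p. ennreal ((cmod (a p * of_real r ^ (fst p + snd p)))\<^sup>2) \<partial>count_space UNIV)"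
    unfolding mean_sq2_def by (rule SUP_cong[OF refl])
  then show ?thesis by (simp only: SUP_radius_nn_integral_count)
qed

lemma mean_sq2_bidisc_synth:
  assumes "a \<in> hcarrier l2"
  shows "mean_sq2 (bidisc_synth a) = ennreal ((hnorm l2 a)\<^sup>2)"
proof (subst mean_sq2_power_series[of _ a])
  show "bidisc_synth a holomorphic2_on bidisc" by (rule holomorphic2_bidisc_synth[OF assms])
  show "zero_off bidisc (bidisc_synth a)" by (simp add: bidisc_synth_def)
  show "\<exists>M. \<forall>i j. cmod (a (i, j)) \<le> M / r ^ (i + j)" if "0 < r" "r < 1" for r :: real
  proof (intro exI allI)
    fix i j
    have "cmod (a (i, j)) \<le> hnorm l2 a" by (rule l2_coord_le[OF assms])
    also have "\<dots> \<le> hnorm l2 a / r ^ (i + j)"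
      using that hnorm_l2_nonneg[OF assms] by (simp add: le_divide_eq mult_left_le power_le_one)
    finally show "cmod (a (i, j)) \<le> hnorm l2 a / r ^ (i + j)" .
  qed
  show "((\<lambda>(i, j). a (i, j) * (x ^ i * y ^ j)) has_sum bidisc_synth a (x, y)) UNIV"
    if "cmod x < 1" "cmod y < 1" for x y
    using has_sum_infsum[OF bidisc_synth_summable[OF assms, of "(x, y)"]] that
    by (simp add: in_bidisc bidisc_synth_def cut_def mono2_def case_prod_unfold)
qed (rule nn_integral_count_l2[OF assms])

lemma bidisc_synth_onto:
  assumes "f holomorphic2_on bidisc" "zero_off bidisc f" "mean_sq2 f < \<infinity>"
  shows "\<exists>a\<in>hcarrier l2. bidisc_synth a = f"
proof -
  obtain a where a: "\<And>r. 0 < r \<Longrightarrow> r < 1 \<Longrightarrow> \<exists>M. \<forall>i j. cmod (a (i, j)) \<le> M / r ^ (i + j)"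
    "\<And>x y. cmod x < 1 \<Longrightarrow> cmod y < 1 \<Longrightarrow> ((\<lambda>(i, j). a (i, j) * (x ^ i * y ^ j)) has_sum f (x, y)) UNIV"
    using holomorphic2_on_bidisc_power_series[OF assms(1)] by blast
  have "a \<in> hcarrier l2"
    using assms(3) mean_sq2_power_series[OF assms(1,2) a] by (intro l2_nn_integral_count) simp
  moreover have "bidisc_synth a = f"
    unfolding bidisc_synth_def
  proof (rule cut_eqI[OF assms(2)])
    fix z assume "z \<in> bidisc"
    then show "(\<Sum>\<^sub>\<infinity>p. a p * mono2 p z) = f z"
      using infsumI[OF a(2)[of "fst z" "snd z"]] by (simp add: in_bidisc mono2_def case_prod_unfold)
  qed
  ultimately show ?thesis by blast
qed

lemma bidisc_synth_add:
  "a \<in> hcarrier l2 \<Longrightarrow> b \<in> hcarrier l2 \<Longrightarrow> bidisc_synth (a + b) = bidisc_synth a + bidisc_synth b"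
  by (auto simp: bidisc_synth_def cut_def fun_eq_iff distrib_right infsum_add bidisc_synth_summable)

lemma bidisc_synth_scale: "bidisc_synth (fun_scale c a) = fun_scale c (bidisc_synth a)"
  by (auto simp: bidisc_synth_def cut_def fun_eq_iff mult.assoc infsum_cmult_right')

lemma H2_bidisc_iff:
  "f \<in> hcarrier H2_bidisc \<longleftrightarrow> f holomorphic2_on bidisc \<and> zero_off bidisc f \<and> mean_sq2 f < \<infinity>"
  by (simp add: H2_bidisc_def hspace_of_norm_def)

lemma unitary_bidisc_synth: "unitary_map l2 H2_bidisc bidisc_synth"
  unfolding H2_bidisc_def
proof (rule unitary_l2_hspace_of_norm)
  show "sqrt (enn2real (mean_sq2 (bidisc_synth a))) = hnorm l2 a" if "a \<in> hcarrier l2" for a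
    using that by (simp add: mean_sq2_bidisc_synth hnorm_l2_nonneg)
  show "\<exists>a\<in>hcarrier l2. bidisc_synth a = f"
    if "f \<in> {f. f holomorphic2_on bidisc \<and> zero_off bidisc f \<and> mean_sq2 f < \<infinity>}" for f
    using that by (intro bidisc_synth_onto) auto
qed (simp_all add: bidisc_synth_add bidisc_synth_scale holomorphic2_bidisc_synth mean_sq2_bidisc_synth,
     simp add: bidisc_synth_def)

lemma hscale_H2 [simp]:
  "hscale H2_bidisc = fun_scale" "hscale H2_anti = fun_scale" "hscale H2_disc = fun_scale"
  "hscale H2_sym = fun_scale" "hscale E_space = fun_scale"
  by (simp_all add: H2_bidisc_def H2_anti_def H2_disc_def H2_sym_def E_space_def hspace_of_norm_def)

lemma sets_torus_measure [simp, measurable_cong]: "sets torus_measure = sets borel"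
  unfolding torus_measure_def
  by (simp only: borel_prod[symmetric] sets_circle_measure cong: sets_pair_measure_cong)

subsection \<open>The Hardy space of the disc\<close>

definition disc_synth :: "(nat \<Rightarrow> complex) \<Rightarrow> complex \<Rightarrow> complex" where
  "disc_synth a = cut (ball 0 1) (\<lambda>z. \<Sum>\<^sub>\<infinity>n. a n * z ^ n)"

lemma disc_synth_abs_summable:
  assumes "a \<in> hcarrier l2" "cmod z < 1"
  shows "(\<lambda>n. cmod (a n * z ^ n)) summable_on UNIV"
proof (rule summable_on_comparison_test)
  show "(\<lambda>n. hnorm l2 a * cmod z ^ n) summable_on UNIV"
    using assms by (intro summable_on_cmult_right summable_on_geometric) auto
  show "cmod (a n * z ^ n) \<le> hnorm l2 a * cmod z ^ n" for n
    using assms by (simp add: norm_mult norm_power mult_right_mono l2_coord_le)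
qed auto

lemma disc_synth_has_sum:
  assumes "a \<in> hcarrier l2" "cmod z < 1"
  shows "((\<lambda>n. a n * z ^ n) has_sum disc_synth a z) UNIV"
  using has_sum_infsum[OF abs_summable_summable[OF disc_synth_abs_summable[OF assms]]] assms
  by (simp add: disc_synth_def cut_def)

lemma holomorphic_disc_synth:
  assumes "a \<in> hcarrier l2"
  shows "disc_synth a holomorphic_on ball 0 1"
proof (rule power_series_holomorphic)
  fix w :: complex assume "w \<in> ball 0 1"
  then show "(\<lambda>n. a n * (w - 0) ^ n) sums disc_synth a w"
    using has_sum_imp_sums[OF disc_synth_has_sum[OF assms, of w]] by simp
qed

lemma mean_sq1_power_series:
  assumes abs: "\<And>z. cmod z < 1 \<Longrightarrow> (\<lambda>n. cmod (a n * z ^ n)) summable_on UNIV"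
    and sums: "\<And>z. cmod z < 1 \<Longrightarrow> (\<lambda>n. a n * z ^ n) sums f z"
  shows "mean_sq1 f = (\<integral>\<^sup>+n. ennreal ((cmod (a n))\<^sup>2) \<partial>count_space UNIV)"
proof -
  have "(\<integral>\<^sup>+\<zeta>. ennreal ((cmod (f (of_real r * \<zeta>)))\<^sup>2) \<partial>circle_measure)
      = (\<integral>\<^sup>+n. ennreal ((cmod (a n * of_real r ^ n))\<^sup>2) \<partial>count_space UNIV)"
    if r: "r \<in> {0<..<1}" for r :: real
    unfolding nn_integral_count_space_nat
  proof (rule circle_parseval)
    show "summable (\<lambda>n. cmod (a n * of_real r ^ n))"
      using r by (intro summable_on_imp_summable abs) auto
    show "(\<lambda>n. a n * of_real r ^ n * \<zeta> ^ n) sums f (of_real r * \<zeta>)" if "cmod \<zeta> = 1" for \<zeta>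
      using sums[of "of_real r * \<zeta>"] that r by (simp add: norm_mult power_mult_distrib mult_ac)
  qed
  then have "mean_sq1 f = (SUP r\<in>{0<..<1::real}.
      \<integral>\<^sup>+n. ennreal ((cmod (a n * of_real r ^ n))\<^sup>2) \<partial>count_space UNIV)"
    unfolding mean_sq1_def by (rule SUP_cong[OF refl])
  then show ?thesis by (simp only: SUP_radius_nn_integral_count)
qed

lemma mean_sq1_disc_synth:
  assumes "a \<in> hcarrier l2"
  shows "mean_sq1 (disc_synth a) = ennreal ((hnorm l2 a)\<^sup>2)"
  using mean_sq1_power_series[OF disc_synth_abs_summable[OF assms] has_sum_imp_sums[OF disc_synth_has_sum[OF assms]]]
  by (simp add: nn_integral_count_l2[OF assms])

lemma disc_synth_onto:
  assumes f: "f holomorphic_on ball 0 1" "zero_off (ball 0 1) f" "mean_sq1 f < \<infinity>"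
  shows "\<exists>a\<in>hcarrier l2. disc_synth a = f"
proof -
  define a where "a = (\<lambda>n. (deriv ^^ n) f 0 / fact n)"
  have sums: "(\<lambda>n. a n * z ^ n) sums f z" if "cmod z < 1" for z
    using holomorphic_power_series[OF f(1), of z] that by (simp add: a_def)
  have abs: "(\<lambda>n. cmod (a n * z ^ n)) summable_on UNIV" if z: "cmod z < 1" for z
  proof -
    obtain r where r: "0 < r" "r < 1" "cmod z < r" using power_lt_1_between[OF z] by blast
    have "summable (\<lambda>n. a n * of_real r ^ n)" using sums[of "of_real r"] r by (auto intro: sums_summable)
    then have "summable (\<lambda>n. cmod (a n * z ^ n))" using r by (intro powser_insidea) auto
    then show ?thesis by (intro summable_nonneg_imp_summable_on) auto
  qed
  have "a \<in> hcarrier l2"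
    using f(3) mean_sq1_power_series[OF abs sums] by (intro l2_nn_integral_count) simp
  moreover have "disc_synth a = f" unfolding disc_synth_def
  proof (rule cut_eqI[OF f(2)])
    fix z :: complex assume "z \<in> ball 0 1"
    then have z: "cmod z < 1" by simp
    show "(\<Sum>\<^sub>\<infinity>n. a n * z ^ n) = f z"
      using has_sum_imp_sums[OF has_sum_infsum[OF abs_summable_summable[OF abs[OF z]]]] sums[OF z]
      by (rule sums_unique2)
  qed
  ultimately show ?thesis by blast
qed

lemma unitary_disc_synth: "unitary_map l2 H2_disc disc_synth"
  unfolding H2_disc_def
proof (rule unitary_l2_hspace_of_norm)
  show "sqrt (enn2real (mean_sq1 (disc_synth a))) = hnorm l2 a" if "a \<in> hcarrier l2" for a
    using that by (simp add: mean_sq1_disc_synth hnorm_l2_nonneg)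
  show "\<exists>a\<in>hcarrier l2. disc_synth a = f"
    if "f \<in> {f. f holomorphic_on ball 0 1 \<and> zero_off (ball 0 1) f \<and> mean_sq1 f < \<infinity>}" for f
    using that by (intro disc_synth_onto) auto
  show "disc_synth a \<in> {f. f holomorphic_on ball 0 1 \<and> zero_off (ball 0 1) f \<and> mean_sq1 f < \<infinity>}"
    if "a \<in> hcarrier l2" for a
    using that by (simp add: holomorphic_disc_synth mean_sq1_disc_synth) (simp add: disc_synth_def)
  show "disc_synth (fun_scale c a) = fun_scale c (disc_synth a)" for c a
    by (auto simp: disc_synth_def cut_def fun_eq_iff mult.assoc infsum_cmult_right')
  show "disc_synth (a + b) = disc_synth a + disc_synth b" if "a \<in> hcarrier l2" "b \<in> hcarrier l2" for a b
    using that
    by (auto simp: disc_synth_def cut_def fun_eq_iff distrib_right infsum_add abs_summable_summable[OF disc_synth_abs_summable])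
qed

lemma unitary_l2_in: "unitary_map l2 H \<Psi> \<Longrightarrow> a \<in> hcarrier l2 \<Longrightarrow> \<Psi> a \<in> hcarrier H"
  by (auto simp: unitary_map_def hlinear_def)

lemma unitary_l2_cases:
  assumes "unitary_map l2 H \<Psi>" "h \<in> hcarrier H"
  obtains a where "a \<in> hcarrier l2" "h = \<Psi> a"
proof -
  have "h \<in> \<Psi> ` hcarrier l2" using assms by (simp add: unitary_map_def bij_betw_def)
  then show ?thesis using that by blast
qed

lemma mult_op_disc_synth:
  assumes "a \<in> hcarrier l2"
  shows "mult_op H2_disc (\<lambda>z. z) (disc_synth a) = disc_synth (push Suc a)"
proof -
  have "z * (\<Sum>\<^sub>\<infinity>n. a n * z ^ n) = (\<Sum>\<^sub>\<infinity>n. push Suc a n * z ^ n)" for z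
    using push_infsum[of Suc "\<lambda>n x. x * z ^ n" a]
    by (simp add: mult_ac flip: infsum_cmult_right')
  then show ?thesis
    using unitary_l2_in[OF unitary_disc_synth assms]
    by (auto simp: mult_op_def disc_synth_def cut_def fun_eq_iff)
qed

subsection \<open>Hilbert modules modelled on a pair of shifts\<close>

definition shift1 :: "(nat \<times> nat \<Rightarrow> complex) \<Rightarrow> nat \<times> nat \<Rightarrow> complex" where
  "shift1 = push (\<lambda>(i, j). (Suc i, j))"

definition shift2 :: "(nat \<times> nat \<Rightarrow> complex) \<Rightarrow> nat \<times> nat \<Rightarrow> complex" where
  "shift2 = push (\<lambda>(i, j). (i, Suc j))"

lemma inj_shifts: "inj (\<lambda>(i, j). (Suc i, j :: 'a))" "inj (\<lambda>(i :: 'a, j). (i, Suc j))"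
  by (auto simp: inj_on_def)

lemma shift_l2 [simp]: "shift1 a \<in> hcarrier l2 \<longleftrightarrow> a \<in> hcarrier l2" "shift2 a \<in> hcarrier l2 \<longleftrightarrow> a \<in> hcarrier l2"
  by (simp_all add: shift1_def shift2_def push_l2_iff inj_shifts)

text \<open>\<open>unitary_map\<close> speaks only about carriers, whereas
  \<open>hilbert_space\<close> asks for the vector space laws on the whole ambient type; hence the
  extra conjunct.\<close>

definition shift_model ::
    "('a::ab_group_add) hspace \<Rightarrow> ('a \<Rightarrow> 'a) \<Rightarrow> ('a \<Rightarrow> 'a) \<Rightarrow> ((nat \<times> nat \<Rightarrow> complex) \<Rightarrow> 'a) \<Rightarrow> bool" where
  "shift_model H A B \<Psi> \<longleftrightarrow> unitary_map l2 H \<Psi> \<and> vector_space (hscale H) \<and>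
     (\<forall>a\<in>hcarrier l2. A (\<Psi> a) = \<Psi> (shift1 a) \<and> B (\<Psi> a) = \<Psi> (shift2 a))"

lemma hmodule_of_ops_simps [simp]:
  "hcarrier (hmodule_of_ops H A B) = hcarrier H" "hscale (hmodule_of_ops H A B) = hscale H"
  "hinner (hmodule_of_ops H A B) = hinner H" "hnorm (hmodule_of_ops H A B) = hnorm H"
  "act (hmodule_of_ops H A B) \<xi> = op_poly2 H \<xi> A B"
  by (simp_all add: hmodule_of_ops_def hspace.defs hnorm_def fun_eq_iff)

lemma hilbert_space_hmodule_of_ops:
  assumes "hilbert_space H"
  shows "hilbert_space (hmodule_of_ops H A B)"
proof (rule hilbert_space_unitary[OF _ assms])
  show "unitary_map H (hmodule_of_ops H A B) id"
    using hilbert_space.subspace_carrier[OF assms] by (simp add: unitary_map_def hlinear_def)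
  show "vector_space (hscale (hmodule_of_ops H A B))"
    using assms by (simp add: hilbert_space_def)
qed

lemma shift_model_hilbert_space: "shift_model H A B \<Psi> \<Longrightarrow> hilbert_space H"
  using hilbert_space_unitary[OF _ hilbert_space_l2] by (auto simp: shift_model_def)

lemma shift_model_funpow:
  assumes "shift_model H A B \<Psi>" "a \<in> hcarrier l2"
  shows "(A ^^ i) ((B ^^ j) (\<Psi> a)) = \<Psi> ((shift1 ^^ i) ((shift2 ^^ j) a))"
    "(shift1 ^^ i) ((shift2 ^^ j) a) \<in> hcarrier l2"
proof -
  have B: "(shift2 ^^ j) a \<in> hcarrier l2 \<and> (B ^^ j) (\<Psi> a) = \<Psi> ((shift2 ^^ j) a)"
    using assms by (induction j) (auto simp: shift_model_def)
  then have "(shift1 ^^ i) ((shift2 ^^ j) a) \<in> hcarrier l2 \<and>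
      (A ^^ i) ((B ^^ j) (\<Psi> a)) = \<Psi> ((shift1 ^^ i) ((shift2 ^^ j) a))"
    using assms by (induction i) (auto simp: shift_model_def)
  then show "(A ^^ i) ((B ^^ j) (\<Psi> a)) = \<Psi> ((shift1 ^^ i) ((shift2 ^^ j) a))"
    "(shift1 ^^ i) ((shift2 ^^ j) a) \<in> hcarrier l2" by auto
qed

lemma unitary_l2_sum:
  assumes \<Psi>: "unitary_map l2 H \<Psi>" and "\<And>i. i \<in> I \<Longrightarrow> g i \<in> hcarrier l2"
  shows "(\<Sum>i\<in>I. g i) \<in> hcarrier l2 \<and> \<Psi> (\<Sum>i\<in>I. g i) = (\<Sum>i\<in>I. \<Psi> (g i))"
proof -
  have "\<Psi> (0 + 0) = \<Psi> 0 + \<Psi> 0" using \<Psi> l2_0 unfolding unitary_map_def hlinear_def by blast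
  then have "\<Psi> 0 = 0" by simp
  then show ?thesis
    using assms(2)
  proof (induction I rule: infinite_finite_induct)
    case (insert i I)
    then have IH: "sum g I \<in> hcarrier l2" "\<Psi> (sum g I) = (\<Sum>i\<in>I. \<Psi> (g i))" "g i \<in> hcarrier l2"
      by auto
    then have "\<Psi> (g i + sum g I) = \<Psi> (g i) + \<Psi> (sum g I)"
      using \<Psi> by (simp only: unitary_map_def hlinear_def)
    then show ?case using IH l2_add[OF IH(3,1)] by (simp only: sum.insert[OF insert.hyps])
  qed (simp_all add: l2_0)
qed

lemma shift_model_op_poly2:
  assumes M: "shift_model H A B \<Psi>" and a: "a \<in> hcarrier l2"
  shows "op_poly2 l2 \<xi> shift1 shift2 a \<in> hcarrier l2 \<and>
    op_poly2 H \<xi> A B (\<Psi> a) = \<Psi> (op_poly2 l2 \<xi> shift1 shift2 a)"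
proof -
  have \<Psi>: "unitary_map l2 H \<Psi>" using M by (simp add: shift_model_def)
  have sc: "\<Psi> (fun_scale c b) = hscale H c (\<Psi> b)" if "b \<in> hcarrier l2" for b c
    using \<Psi> that by (simp add: unitary_map_def hlinear_def)
  show ?thesis
    by (simp add: op_poly2_def unitary_l2_sum[OF \<Psi>] l2_scale shift_model_funpow[OF M a] sc)
qed

text \<open>Both actions are the same polynomial in the two shifts when read on \<open>l2\<close>,
  so composing one synthesis map with the inverse of the other intertwines them.\<close>

lemma shift_models_iso:
  assumes M: "shift_model H A B \<Psi>" and N: "shift_model K C D \<Phi>"
  shows "hmodule_of_ops H A B \<cong>\<^sub>H hmodule_of_ops K C D"
proof -
  let ?F = "\<Phi> \<circ> inv_into (hcarrier l2) \<Psi>"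
  have \<Psi>: "unitary_map l2 H \<Psi>" and \<Phi>: "unitary_map l2 K \<Phi>"
    using M N by (auto simp: shift_model_def)
  have F: "unitary_map H K ?F"
    using \<Phi> by (intro unitary_map_comp[OF unitary_map_inv[OF \<Psi>]])
      (use l2.subspace_carrier vector_space_fun_scale in auto)
  have F\<Psi>: "?F (\<Psi> a) = \<Phi> a" if "a \<in> hcarrier l2" for a
  proof -
    have "bij_betw \<Psi> (hcarrier l2) (hcarrier H)" using \<Psi> by (simp add: unitary_map_def)
    from bij_betw_inv_into_left[OF this that] show ?thesis by simp
  qed
  have "?F (op_poly2 H \<xi> A B h) = op_poly2 K \<xi> C D (?F h)" if "h \<in> hcarrier H" for \<xi> h
  proof -
    obtain a where a: "a \<in> hcarrier l2" "h = \<Psi> a" using unitary_l2_cases[OF \<Psi> \<open>h \<in> hcarrier H\<close>] .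
    then show ?thesis
      using F\<Psi> shift_model_op_poly2[OF M a(1), of \<xi>] shift_model_op_poly2[OF N a(1), of \<xi>]
      by (simp del: o_apply)
  qed
  moreover have "unitary_map (hmodule_of_ops H A B) (hmodule_of_ops K C D) ?F"
    using F by (simp add: unitary_map_def hlinear_def)
  ultimately show ?thesis unfolding hmodule_iso_def by auto
qed

text \<open>The axioms known for \<open>K\<close> are pulled back through the injective
  \<open>\<Phi>\<close> to identities between polynomials in the shifts on \<open>l2\<close>, then
  pushed forward by \<open>\<Psi>\<close>. Multiplicativity of the action is thereby never computed
  from the coefficients of a product of polynomials.\<close>

lemma shift_model_hilbert_module:
  assumes M: "shift_model H A B \<Psi>" and N: "shift_model K C D \<Phi>"
    and mod: "hilbert_module (hmodule_of_ops K C D)" "bidisc_contractive (hmodule_of_ops K C D)"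
  shows "hilbert_module (hmodule_of_ops H A B)" "bidisc_contractive (hmodule_of_ops H A B)"
proof -
  interpret K: hilbert_module "hmodule_of_ops K C D" by (rule mod)
  interpret H: hilbert_space "hmodule_of_ops H A B"
    by (intro hilbert_space_hmodule_of_ops shift_model_hilbert_space[OF M])
  let ?P = "\<lambda>\<xi>. op_poly2 l2 \<xi> shift1 shift2"
  have \<Psi>: "unitary_map l2 H \<Psi>" and \<Phi>: "unitary_map l2 K \<Phi>"
    using M N by (auto simp: shift_model_def)
  note PM = shift_model_op_poly2[OF M] and PN = shift_model_op_poly2[OF N]
  have inj: "a = b" if "\<Phi> a = \<Phi> b" "a \<in> hcarrier l2" "b \<in> hcarrier l2" for a b
    using \<Phi> that by (auto simp: unitary_map_def bij_betw_def inj_on_def)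
  have lin: "\<Psi> (a + b) = \<Psi> a + \<Psi> b" "\<Phi> (a + b) = \<Phi> a + \<Phi> b"
      "\<Psi> (fun_scale c a) = hscale H c (\<Psi> a)" "\<Phi> (fun_scale c a) = hscale K c (\<Phi> a)"
    if "a \<in> hcarrier l2" "b \<in> hcarrier l2" for a b c
    using \<Psi> \<Phi> that by (auto simp: unitary_map_def hlinear_def)
  note \<Phi>in = unitary_l2_in[OF \<Phi>]
  have add_right: "?P \<xi> (a + b) = ?P \<xi> a + ?P \<xi> b" if "a \<in> hcarrier l2" "b \<in> hcarrier l2" for \<xi> a b
    using K.act_add_right[of "\<Phi> a" "\<Phi> b" \<xi>] that PN by (intro inj) (simp_all add: \<Phi>in l2_add flip: lin)
  have add_left: "?P (\<xi> + \<eta>) a = ?P \<xi> a + ?P \<eta> a" if "a \<in> hcarrier l2" for \<xi> \<eta> a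
    using K.act_add_left[of "\<Phi> a" \<xi> \<eta>] that PN by (intro inj) (simp_all add: \<Phi>in l2_add flip: lin)
  have mult: "?P (\<xi> * \<eta>) a = ?P \<xi> (?P \<eta> a)" if "a \<in> hcarrier l2" for \<xi> \<eta> a
    using K.act_mult[of "\<Phi> a" \<xi> \<eta>] that PN by (intro inj) (simp_all add: \<Phi>in)
  have const: "?P [:[:c:]:] a = fun_scale c a" if "a \<in> hcarrier l2" for c a
    using K.act_const[of "\<Phi> a" c] that PN lin(4)[OF that that] by (intro inj) (simp_all add: \<Phi>in l2_scale)
  show "hilbert_module (hmodule_of_ops H A B)"
  proof (unfold_locales, simp_all)
    fix h \<xi> assume "h \<in> hcarrier H"
    then obtain a where a: "a \<in> hcarrier l2" "h = \<Psi> a" using unitary_l2_cases[OF \<Psi>] by blast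
    show "op_poly2 H \<xi> A B h \<in> hcarrier H"
      using a PM[OF a(1)] unitary_l2_in[OF \<Psi>] by simp
    show "op_poly2 H (\<xi> + \<eta>) A B h = op_poly2 H \<xi> A B h + op_poly2 H \<eta> A B h" for \<eta>
      using a PM[OF a(1)] add_left[OF a(1)] by (simp add: lin)
    show "op_poly2 H (\<xi> * \<eta>) A B h = op_poly2 H \<xi> A B (op_poly2 H \<eta> A B h)" for \<eta>
      using a PM mult[OF a(1)] by simp
    show "op_poly2 H [:[:c:]:] A B h = hscale H c h" for c
      using a PM const[OF a(1)] lin(3)[OF a(1) a(1)] by simp
    fix k assume "k \<in> hcarrier H"
    then obtain b where b: "b \<in> hcarrier l2" "k = \<Psi> b" using unitary_l2_cases[OF \<Psi>] by blast
    show "op_poly2 H \<xi> A B (h + k) = op_poly2 H \<xi> A B h + op_poly2 H \<xi> A B k"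
      using a b PM add_right[OF a(1) b(1)] by (simp add: l2_add flip: lin(1))
  qed
  show "bidisc_contractive (hmodule_of_ops H A B)"
    unfolding bidisc_contractive_def
  proof (simp, intro allI ballI)
    fix \<xi> h assume "h \<in> hcarrier H"
    then obtain a where a: "a \<in> hcarrier l2" "h = \<Psi> a" using unitary_l2_cases[OF \<Psi>] by blast
    have "hnorm K (op_poly2 K \<xi> C D (\<Phi> a)) \<le> supnorm_bidisc \<xi> * hnorm K (\<Phi> a)"
      using mod(2) \<Phi>in[OF a(1)] unfolding bidisc_contractive_def by simp
    then show "hnorm H (op_poly2 H \<xi> A B h) \<le> supnorm_bidisc \<xi> * hnorm H h"
      using a PM[OF a(1), of \<xi>] PN[OF a(1), of \<xi>]
      by (simp add: unitary_hnorm[OF \<Psi>] unitary_hnorm[OF \<Phi>])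
  qed
qed

section \<open>The coordinate multiplications on the bidisc\<close>

lemma mult_op_bidisc_synth:
  assumes "a \<in> hcarrier l2"
  shows "mult_op H2_bidisc fst (bidisc_synth a) = bidisc_synth (shift1 a)"
    "mult_op H2_bidisc snd (bidisc_synth a) = bidisc_synth (shift2 a)"
proof -
  have "fst z * (\<Sum>\<^sub>\<infinity>p. a p * mono2 p z) = (\<Sum>\<^sub>\<infinity>p. shift1 a p * mono2 p z)"
    "snd z * (\<Sum>\<^sub>\<infinity>p. a p * mono2 p z) = (\<Sum>\<^sub>\<infinity>p. shift2 a p * mono2 p z)" for z
    using push_infsum[OF inj_shifts(1), of "\<lambda>p x. x * mono2 p z" a]
      push_infsum[OF inj_shifts(2), of "\<lambda>p x. x * mono2 p z" a]
    by (simp_all add: mult_ac mono2_def case_prod_unfold shift1_def shift2_def flip: infsum_cmult_right')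
  then show "mult_op H2_bidisc fst (bidisc_synth a) = bidisc_synth (shift1 a)"
    "mult_op H2_bidisc snd (bidisc_synth a) = bidisc_synth (shift2 a)"
    using unitary_l2_in[OF unitary_bidisc_synth assms]
    by (simp_all add: mult_op_def) (auto simp: bidisc_synth_def cut_def fun_eq_iff)
qed

lemma shift_model_HM4: "shift_model H2_bidisc (mult_op H2_bidisc fst) (mult_op H2_bidisc snd) bidisc_synth"
  by (simp add: shift_model_def unitary_bidisc_synth mult_op_bidisc_synth vector_space_fun_scale)

lemma sum_fun_apply: "(\<Sum>i\<in>I. f i) x = (\<Sum>i\<in>I. f i x)"
  for f :: "'i \<Rightarrow> 'x \<Rightarrow> 'y::comm_monoid_add"
  by (induction I rule: infinite_finite_induct) auto

lemma eval2_sum: "eval2 \<xi> z = (\<Sum>i\<le>degree \<xi>. \<Sum>j\<le>degree (coeff \<xi> i). coeff (coeff \<xi> i) j * (fst z ^ i * snd z ^ j))"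
proof -
  have "eval2 \<xi> z = (\<Sum>i\<le>degree \<xi>. poly (coeff \<xi> i) (snd z) * fst z ^ i)"
    by (simp add: eval2_def poly_altdef[of \<xi>] poly_sum)
  also have "\<dots> = (\<Sum>i\<le>degree \<xi>. \<Sum>j\<le>degree (coeff \<xi> i). coeff (coeff \<xi> i) j * (fst z ^ i * snd z ^ j))"
    by (simp add: poly_altdef[of "coeff \<xi> _"] sum_distrib_left sum_distrib_right mult_ac)
  finally show ?thesis .
qed

lemma funpow_mult_op:
  assumes "\<And>h. h \<in> hcarrier H \<Longrightarrow> mult_op H \<phi> h \<in> hcarrier H" "h \<in> hcarrier H"
  shows "(mult_op H \<phi> ^^ i) h = (\<lambda>z. \<phi> z ^ i * h z) \<and> (mult_op H \<phi> ^^ i) h \<in> hcarrier H"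
proof (induction i)
  case (Suc i)
  then have IH: "(mult_op H \<phi> ^^ i) h \<in> hcarrier H" "(mult_op H \<phi> ^^ i) h = (\<lambda>z. \<phi> z ^ i * h z)" by auto
  have "mult_op H \<phi> ((mult_op H \<phi> ^^ i) h) = (\<lambda>z. \<phi> z * (mult_op H \<phi> ^^ i) h z)"
    using IH(1) by (simp add: mult_op_def)
  also have "\<dots> = (\<lambda>z. \<phi> z ^ Suc i * h z)" unfolding IH(2) by (simp add: mult.assoc)
  finally show ?case using assms(1)[OF IH(1)] by simp
qed (use assms in auto)

lemma op_poly2_H2_bidisc:
  assumes h: "h \<in> hcarrier H2_bidisc"
  shows "op_poly2 H2_bidisc \<xi> (mult_op H2_bidisc fst) (mult_op H2_bidisc snd) h = (\<lambda>z. eval2 \<xi> z * h z)"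
proof -
  have cl: "mult_op H2_bidisc fst h \<in> hcarrier H2_bidisc" "mult_op H2_bidisc snd h \<in> hcarrier H2_bidisc"
    if h: "h \<in> hcarrier H2_bidisc" for h
  proof -
    obtain a where "a \<in> hcarrier l2" "h = bidisc_synth a"
      using unitary_l2_cases[OF unitary_bidisc_synth h] .
    then show "mult_op H2_bidisc fst h \<in> hcarrier H2_bidisc" "mult_op H2_bidisc snd h \<in> hcarrier H2_bidisc"
      by (auto simp: mult_op_bidisc_synth intro!: unitary_l2_in[OF unitary_bidisc_synth])
  qed
  have "(mult_op H2_bidisc fst ^^ i) ((mult_op H2_bidisc snd ^^ j) h) = (\<lambda>z. fst z ^ i * (snd z ^ j * h z))" for i j
  proof -
    note snd = funpow_mult_op[OF cl(2) h, of j]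
    show ?thesis using funpow_mult_op[OF cl(1) snd[THEN conjunct2], of i] snd by simp
  qed
  then show ?thesis
    by (auto simp: op_poly2_def fun_eq_iff sum_fun_apply eval2_sum sum_distrib_right mult.assoc intro!: sum.cong)
qed

text \<open>A real-valued supremum dominates its members only if they are bounded; compactness of
  the closed bidisc provides this.\<close>

lemma supnorm_bidisc_ge: "z \<in> bidisc \<Longrightarrow> cmod (eval2 \<xi> z) \<le> supnorm_bidisc \<xi>"
  unfolding supnorm_bidisc_def
proof (rule cSUP_upper)
  have "compact ((\<lambda>z. cmod (eval2 \<xi> z)) ` (cball 0 1 \<times> cball 0 1))"
    unfolding eval2_sum by (intro compact_continuous_image compact_Times continuous_intros) auto
  then have "bdd_above ((\<lambda>z. cmod (eval2 \<xi> z)) ` (cball 0 1 \<times> cball 0 1))"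
    by (rule bounded_imp_bdd_above[OF compact_imp_bounded])
  then show "bdd_above ((\<lambda>z. cmod (eval2 \<xi> z)) ` bidisc)"
    by (rule bdd_above_mono) (auto simp: bidisc_def)
qed

lemma mean_sq2_mult_le:
  assumes h: "h \<in> hcarrier H2_bidisc" and C: "\<And>z. z \<in> bidisc \<Longrightarrow> cmod (g z) \<le> C" "0 \<le> C"
  shows "mean_sq2 (\<lambda>z. g z * h z) \<le> ennreal (C\<^sup>2) * mean_sq2 h"
  unfolding mean_sq2_def
proof (rule SUP_least)
  fix r :: real assume r: "r \<in> {0<..<1}"
  let ?z = "\<lambda>\<zeta>. (complex_of_real r * fst \<zeta>, complex_of_real r * snd \<zeta>)"
  have [measurable]: "h \<in> borel_measurable borel"
    using h holomorphic2_on_imp_continuous_on open_bidisc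
    by (intro borel_measurable_zero_off[of bidisc]) (auto simp: H2_bidisc_iff)
  have [measurable]: "?z \<in> borel_measurable borel"
    by (intro borel_measurable_continuous_onI continuous_intros)
  \<comment> \<open>The integrands are compared at every point of the plane squared, not only on the
    torus: outside the bidisc \<open>g\<close> is uncontrolled but \<open>h\<close>
    vanishes.\<close>
  have le: "cmod (g z * h z) \<le> C * cmod (h z)" for z
  proof (cases "z \<in> bidisc")
    case True
    then show ?thesis by (simp add: norm_mult mult_right_mono C)
  next
    case False
    then have "h z = 0" using h unfolding H2_bidisc_iff zero_off_def by blast
    then show ?thesis by simp
  qed
  have "(\<integral>\<^sup>+\<zeta>. ennreal ((cmod (g (?z \<zeta>) * h (?z \<zeta>)))\<^sup>2) \<partial>torus_measure)
      \<le> (\<integral>\<^sup>+\<zeta>. ennreal (C\<^sup>2) * ennreal ((cmod (h (?z \<zeta>)))\<^sup>2) \<partial>torus_measure)"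
  proof (rule nn_integral_mono)
    fix \<zeta>
    have "(cmod (g (?z \<zeta>) * h (?z \<zeta>)))\<^sup>2 \<le> (C * cmod (h (?z \<zeta>)))\<^sup>2" by (intro power_mono le) auto
    then show "ennreal ((cmod (g (?z \<zeta>) * h (?z \<zeta>)))\<^sup>2) \<le> ennreal (C\<^sup>2) * ennreal ((cmod (h (?z \<zeta>)))\<^sup>2)"
      by (simp add: power_mult_distrib flip: ennreal_mult)
  qed
  also have "\<dots> = ennreal (C\<^sup>2) * (\<integral>\<^sup>+\<zeta>. ennreal ((cmod (h (?z \<zeta>)))\<^sup>2) \<partial>torus_measure)"
    by (rule nn_integral_cmult) measurable
  also have "\<dots> \<le> ennreal (C\<^sup>2) * (SUP r\<in>{0<..<1::real}. \<integral>\<^sup>+\<zeta>. ennreal ((cmod (h (of_real r * fst \<zeta>, of_real r * snd \<zeta>)))\<^sup>2) \<partial>torus_measure)"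
    by (intro mult_left_mono SUP_upper r) auto
  finally show "(\<integral>\<^sup>+\<zeta>. ennreal ((cmod (g (?z \<zeta>) * h (?z \<zeta>)))\<^sup>2) \<partial>torus_measure) \<le> \<dots>" .
qed

lemma mean_sq2_H2_bidisc:
  assumes "h \<in> hcarrier H2_bidisc"
  shows "mean_sq2 h = ennreal ((hnorm H2_bidisc h)\<^sup>2)" "0 \<le> hnorm H2_bidisc h"
proof -
  obtain a where a: "a \<in> hcarrier l2" "h = bidisc_synth a"
    using unitary_l2_cases[OF unitary_bidisc_synth assms] .
  then show "mean_sq2 h = ennreal ((hnorm H2_bidisc h)\<^sup>2)" "0 \<le> hnorm H2_bidisc h"
    by (simp_all add: mean_sq2_bidisc_synth unitary_hnorm[OF unitary_bidisc_synth] hnorm_l2_nonneg)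
qed

lemma HM4_module: "hilbert_module HM4" "bidisc_contractive HM4"
proof -
  interpret hilbert_space "hmodule_of_ops H2_bidisc (mult_op H2_bidisc fst) (mult_op H2_bidisc snd)"
    by (intro hilbert_space_hmodule_of_ops shift_model_hilbert_space[OF shift_model_HM4])
  have cl: "op_poly2 H2_bidisc \<xi> (mult_op H2_bidisc fst) (mult_op H2_bidisc snd) h \<in> hcarrier H2_bidisc"
    if "h \<in> hcarrier H2_bidisc" for \<xi> h
  proof -
    obtain a where a: "a \<in> hcarrier l2" "h = bidisc_synth a"
      using unitary_l2_cases[OF unitary_bidisc_synth \<open>h \<in> hcarrier H2_bidisc\<close>] .
    then show ?thesis using shift_model_op_poly2[OF shift_model_HM4 a(1), of \<xi>]
      by (auto intro: unitary_l2_in[OF unitary_bidisc_synth])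
  qed
  have add: "h + k \<in> hcarrier H2_bidisc" if "h \<in> hcarrier H2_bidisc" "k \<in> hcarrier H2_bidisc" for h k
    using subspace_add[OF subspace_carrier] that by simp
  show "hilbert_module HM4"
    unfolding HM4_def
  proof (unfold_locales, simp_all add: cl)
    fix h :: "complex \<times> complex \<Rightarrow> complex" and \<xi> \<eta> c
    assume h: "h \<in> hcarrier H2_bidisc"
    note op = op_poly2_H2_bidisc
    let ?P = "\<lambda>\<xi>. op_poly2 H2_bidisc \<xi> (mult_op H2_bidisc fst) (mult_op H2_bidisc snd)"
    show "?P (\<xi> + \<eta>) h = ?P \<xi> h + ?P \<eta> h"
      by (simp add: op h eval2_def fun_eq_iff distrib_right)
    show "?P (\<xi> * \<eta>) h = ?P \<xi> (?P \<eta> h)"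
      unfolding op[OF cl[OF h]] by (simp add: op h eval2_def fun_eq_iff mult_ac)
    show "?P [:[:c:]:] h = fun_scale c h"
      by (simp add: op h eval2_def fun_eq_iff)
    fix k :: "complex \<times> complex \<Rightarrow> complex"
    assume k: "k \<in> hcarrier H2_bidisc"
    show "?P \<xi> (h + k) = ?P \<xi> h + ?P \<xi> k"
      unfolding op[OF add[OF h k]] by (simp add: op h k fun_eq_iff distrib_left)
  qed
  show "bidisc_contractive HM4"
    unfolding HM4_def bidisc_contractive_def
  proof (simp, intro allI ballI)
    fix \<xi> and h :: "complex \<times> complex \<Rightarrow> complex"
    assume h: "h \<in> hcarrier H2_bidisc"
    let ?k = "op_poly2 H2_bidisc \<xi> (mult_op H2_bidisc fst) (mult_op H2_bidisc snd) h"
    have s: "0 \<le> supnorm_bidisc \<xi>"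
      using order_trans[OF norm_ge_zero supnorm_bidisc_ge[of "(0, 0)" \<xi>]] by (simp add: in_bidisc)
    have "ennreal ((hnorm H2_bidisc ?k)\<^sup>2) = mean_sq2 (\<lambda>z. eval2 \<xi> z * h z)"
      using mean_sq2_H2_bidisc(1)[OF cl[OF h, of \<xi>]] by (simp add: op_poly2_H2_bidisc[OF h])
    also have "\<dots> \<le> ennreal ((supnorm_bidisc \<xi>)\<^sup>2) * mean_sq2 h"
      by (intro mean_sq2_mult_le h supnorm_bidisc_ge s)
    also have "\<dots> = ennreal ((supnorm_bidisc \<xi> * hnorm H2_bidisc h)\<^sup>2)"
      by (simp add: mean_sq2_H2_bidisc(1)[OF h] power_mult_distrib flip: ennreal_mult)
    finally have "(hnorm H2_bidisc ?k)\<^sup>2 \<le> (supnorm_bidisc \<xi> * hnorm H2_bidisc h)\<^sup>2"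
      by (simp add: ennreal_le_iff)
    then show "hnorm H2_bidisc ?k \<le> supnorm_bidisc \<xi> * hnorm H2_bidisc h"
      by (rule power2_le_imp_le) (simp add: s mean_sq2_H2_bidisc(2)[OF h])
  qed
qed

subsection \<open>Antisymmetric functions\<close>

lemma hinner_push:
  assumes "inj \<sigma>"
  shows "hinner l2 (push \<sigma> a) (push \<sigma> b) = hinner l2 a b"
  using push_infsum[OF assms, of "\<lambda>k x. x * cnj (push \<sigma> b k)" a] by (simp add: hinner_l2 assms)

text \<open>Exponents of the two monomials in (z1 z2)^i (z1^(j+1) - z2^(j+1)). As (i, j) varies,
  \<open>lower\<close> fills the pairs with larger first entry exactly once and \<open>upper\<close>
  those with larger second entry, so that only the diagonal is left out.\<close>

definition lower :: "nat \<times> nat \<Rightarrow> nat \<times> nat" where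
  "lower = (\<lambda>(i, j). (Suc (i + j), i))"

definition upper :: "nat \<times> nat \<Rightarrow> nat \<times> nat" where
  "upper = (\<lambda>(i, j). (i, Suc (i + j)))"

lemma inj_lower: "inj lower" and inj_upper: "inj upper"
  by (auto simp: inj_on_def lower_def upper_def)

lemma lower_neq_upper: "lower p \<noteq> upper q"
  by (auto simp: lower_def upper_def split: prod.splits)

lemma pair_cases:
  obtains (diag) m where "p = (m, m)" | (lower) q where "p = lower q" | (upper) q where "p = upper q"
proof -
  obtain m n where p: "p = (m, n)" by (cases p)
  consider "m = n" | "n < m" | "m < n" by linarith
  then show thesis
  proof cases
    case 1 then show ?thesis using diag p by simp
  next
    case 2
    then have "p = lower (n, m - Suc n)" using p by (simp add: lower_def)
    then show ?thesis by (rule lower)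
  next
    case 3
    then have "p = upper (m, n - Suc m)" using p by (simp add: upper_def)
    then show ?thesis by (rule upper)
  qed
qed

text \<open>Turns coordinates in the antisymmetric basis into monomial coefficients. Every
  coordinate is used twice, on either side of the diagonal; the factor restores the norm.\<close>

definition alternate :: "(nat \<times> nat \<Rightarrow> complex) \<Rightarrow> nat \<times> nat \<Rightarrow> complex" where
  "alternate b = fun_scale (1 / sqrt 2) (push lower b - push upper b)"

lemma push_lower_upper [simp]:
  "push lower b (lower q) = b q" "push upper b (upper q) = b q"
  "push lower b (upper q) = 0" "push upper b (lower q) = 0"
  "push lower b (m, m) = 0" "push upper b (m, m) = 0"
proof -
  have "upper q \<notin> range lower" "lower q \<notin> range upper"
    using lower_neq_upper[of _ q] lower_neq_upper[of q] by (metis rangeE)+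
  moreover have "(m, m) \<notin> range lower" "(m, m) \<notin> range upper"
    by (auto simp: lower_def upper_def)
  ultimately show "push lower b (lower q) = b q" "push upper b (upper q) = b q"
    "push lower b (upper q) = 0" "push upper b (lower q) = 0"
    "push lower b (m, m) = 0" "push upper b (m, m) = 0"
    using inj_lower inj_upper by (simp_all add: push_outside)
qed

lemma alternate_l2: "b \<in> hcarrier l2 \<Longrightarrow> alternate b \<in> hcarrier l2"
  unfolding alternate_def by (intro l2_scale l2_diff) (simp_all add: push_l2_iff inj_lower inj_upper)

text \<open>The two triangles are disjoint, so no cross terms arise and each triangle contributes
  half of the inner product.\<close>

lemma hinner_alternate:
  assumes b: "b \<in> hcarrier l2" "c \<in> hcarrier l2"
  shows "hinner l2 (alternate b) (alternate c) = hinner l2 b c"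
proof -
  let ?L = "\<lambda>p. push lower b p * cnj (push lower c p)" and ?U = "\<lambda>p. push upper b p * cnj (push upper c p)"
  have "complex_of_real (sqrt 2) * complex_of_real (sqrt 2) = 2"
    by (metis of_real_mult of_real_numeral real_sqrt_mult_self abs_numeral)
  then have pt: "alternate b p * cnj (alternate c p) = (1 / 2) * (?L p + ?U p)" for p
    by (cases p rule: pair_cases) (simp_all add: alternate_def)
  have "hinner l2 (alternate b) (alternate c) = (1 / 2) * (\<Sum>\<^sub>\<infinity>p. ?L p + ?U p)"
    unfolding hinner_l2 pt by (rule infsum_cmult_right')
  also have "(\<Sum>\<^sub>\<infinity>p. ?L p + ?U p) = hinner l2 (push lower b) (push lower c) + hinner l2 (push upper b) (push upper c)"
    unfolding hinner_l2 using b
    by (intro infsum_add l2_prod_summable) (simp_all add: push_l2_iff inj_lower inj_upper)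
  finally show ?thesis by (simp add: hinner_push inj_lower inj_upper)
qed

definition anti_synth :: "(nat \<times> nat \<Rightarrow> complex) \<Rightarrow> complex \<times> complex \<Rightarrow> complex" where
  "anti_synth b = bidisc_synth (alternate b)"

definition anti_mono :: "nat \<times> nat \<Rightarrow> complex \<times> complex \<Rightarrow> complex" where
  "anti_mono p z = (1 / sqrt 2) * (mono2 (lower p) z - mono2 (upper p) z)"

lemma bidisc_synth_push:
  "inj \<sigma> \<Longrightarrow> bidisc_synth (push \<sigma> b) = cut bidisc (\<lambda>z. \<Sum>\<^sub>\<infinity>p. b p * mono2 (\<sigma> p) z)"
  using push_infsum[of \<sigma> "\<lambda>p x. x * mono2 p z" b for z] by (simp add: bidisc_synth_def)

lemma bidisc_synth_diff:
  assumes "a \<in> hcarrier l2" "b \<in> hcarrier l2"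
  shows "bidisc_synth (a - b) = bidisc_synth a - bidisc_synth b"
  using bidisc_synth_add[OF l2_diff[OF assms] assms(2)] by simp

lemma anti_synth_eq:
  assumes b: "b \<in> hcarrier l2"
  shows "anti_synth b = cut bidisc (\<lambda>z. \<Sum>\<^sub>\<infinity>p. b p * anti_mono p z)"
proof
  fix z
  show "anti_synth b z = cut bidisc (\<lambda>z. \<Sum>\<^sub>\<infinity>p. b p * anti_mono p z) z"
  proof (cases "z \<in> bidisc")
    case True
    have s: "(\<lambda>p. b p * mono2 (\<sigma> p) z) summable_on UNIV" if "inj \<sigma>" for \<sigma> :: "nat \<times> nat \<Rightarrow> nat \<times> nat"
      using bidisc_synth_summable[of "push \<sigma> b" z] b that True
        push_summable[of \<sigma> "\<lambda>p x. x * mono2 p z" b] by (simp add: push_l2_iff)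
    have "anti_synth b z = (1 / sqrt 2) * (bidisc_synth (push lower b) z - bidisc_synth (push upper b) z)"
      unfolding anti_synth_def alternate_def using b
      by (simp add: bidisc_synth_scale bidisc_synth_diff push_l2_iff inj_lower inj_upper)
    also have "\<dots> = (1 / sqrt 2) * ((\<Sum>\<^sub>\<infinity>p. b p * mono2 (lower p) z) + (\<Sum>\<^sub>\<infinity>p. - (b p * mono2 (upper p) z)))"
      using True by (simp add: bidisc_synth_push inj_lower inj_upper cut_def infsum_uminus)
    also have "\<dots> = (\<Sum>\<^sub>\<infinity>p. (1 / sqrt 2) * (b p * mono2 (lower p) z + - (b p * mono2 (upper p) z)))"
      using s[OF inj_lower] s[OF inj_upper]
      by (simp only: infsum_add[symmetric] summable_on_uminus infsum_cmult_right')
    also have "\<dots> = (\<Sum>\<^sub>\<infinity>p. b p * anti_mono p z)"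
      by (simp add: anti_mono_def algebra_simps)
    finally show ?thesis using True by (simp add: cut_def)
  qed (simp add: anti_synth_def bidisc_synth_def cut_def)
qed

lemma hcarrier_H2_anti:
  "hcarrier H2_anti = {f \<in> hcarrier H2_bidisc. \<forall>x y. f (x, y) = - f (y, x)}"
  by (simp add: H2_anti_def)

lemma H2_anti_simps [simp]:
  "hinner H2_anti = hinner H2_bidisc" "hnorm H2_anti = hnorm H2_bidisc"
  by (simp_all add: H2_anti_def hnorm_def fun_eq_iff)

lemma mono2_swap: "mono2 p (y, x) = mono2 (prod.swap p) (x, y)"
  by (cases p) (simp add: mono2_def)

lemma lower_swap: "prod.swap (lower p) = upper p" "prod.swap (upper p) = lower p"
  by (cases p; simp add: lower_def upper_def)+

text \<open>By injectivity of \<open>bidisc_synth\<close>, antisymmetry of the function is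
  antisymmetry of its coefficients under exchange of the indices. The diagonal coefficients then
  vanish and those below the diagonal determine the rest.\<close>

lemma anti_synth_onto:
  assumes f: "f \<in> hcarrier H2_anti"
  shows "\<exists>b\<in>hcarrier l2. anti_synth b = f"
proof -
  obtain a where a: "a \<in> hcarrier l2" "f = bidisc_synth a"
    using unitary_l2_cases[OF unitary_bidisc_synth, of f] f unfolding hcarrier_H2_anti by blast
  have swap: "inj (prod.swap :: nat \<times> nat \<Rightarrow> nat \<times> nat)" by simp
  have "bidisc_synth (push prod.swap a) (x, y) = bidisc_synth (fun_scale (-1) a) (x, y)" for x y
  proof -
    have "bidisc_synth (push prod.swap a) (x, y) = f (y, x)"
      unfolding bidisc_synth_push[OF swap] a(2)
      by (simp add: bidisc_synth_def cut_def mono2_swap[of _ y x] in_bidisc conj_commute)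
    also have "\<dots> = - f (x, y)" using f unfolding hcarrier_H2_anti by blast
    finally show ?thesis by (simp add: bidisc_synth_scale a(2))
  qed
  then have eq: "bidisc_synth (push prod.swap a) = bidisc_synth (fun_scale (-1) a)" by auto
  have "inj_on bidisc_synth (hcarrier l2)"
    using unitary_bidisc_synth by (simp add: unitary_map_def bij_betw_def)
  from inj_onD[OF this, OF eq] have "push prod.swap a = fun_scale (-1) a"
    using a(1) by (simp add: push_l2_iff l2_scale)
  then have "fun_scale (-1) a (prod.swap p) = a p" for p
    using push_apply[OF swap, of a p] by (simp only:)
  then have "- a (prod.swap p) = a p" for p by simp
  then have anti: "a (prod.swap p) = - a p" for p by (metis minus_minus)
  \<comment> \<open>The factor undoes the normalization in \<open>alternate\<close>.\<close>
  define b where "b = fun_scale (sqrt 2) (a \<circ> lower)"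
  have "(\<lambda>p. (cmod (a p))\<^sup>2) summable_on range lower"
    using a(1) unfolding l2_iff by (rule summable_on_subset_banach) simp
  then have "a \<circ> lower \<in> hcarrier l2"
    unfolding l2_iff using summable_on_reindex[OF inj_lower, of "\<lambda>p. (cmod (a p))\<^sup>2"] by (simp add: o_def)
  then have b: "b \<in> hcarrier l2" unfolding b_def by (rule l2_scale)
  have "alternate b = a"
  proof
    fix p show "alternate b p = a p"
    proof (cases p rule: pair_cases)
      case (diag m)
      then show ?thesis using anti[of p] by (simp add: alternate_def)
    next
      case (lower q)
      then show ?thesis by (simp add: alternate_def b_def)
    next
      case (upper q)
      then show ?thesis using anti[of "lower q"] by (simp add: alternate_def b_def lower_swap)
    qed
  qed
  then show ?thesis using b a(2) by (auto simp: anti_synth_def)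
qed

lemma unitary_anti_synth: "unitary_map l2 H2_anti anti_synth"
proof -
  have into: "anti_synth b \<in> hcarrier H2_anti" if b: "b \<in> hcarrier l2" for b
  proof -
    have "anti_mono p (x, y) = - anti_mono p (y, x)" for p x y
      by (simp add: anti_mono_def mono2_swap[of _ y x] lower_swap algebra_simps)
    then have eq: "(\<lambda>p. b p * anti_mono p (x, y)) = (\<lambda>p. - (b p * anti_mono p (y, x)))" for x y
      by (metis mult_minus_right)
    have "(\<Sum>\<^sub>\<infinity>p. b p * anti_mono p (x, y)) = - (\<Sum>\<^sub>\<infinity>p. b p * anti_mono p (y, x))" for x y
      by (subst eq) (rule infsum_uminus)
    note sum = this
    have "anti_synth b (x, y) = - anti_synth b (y, x)" for x y
    proof (cases "(x, y) \<in> bidisc")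
      case True
      then have "(y, x) \<in> bidisc" by (simp add: in_bidisc)
      then show ?thesis using sum[of x y] by (simp only: anti_synth_eq[OF b] cut_def True if_True)
    next
      case False
      then have "(y, x) \<notin> bidisc" by (auto simp: in_bidisc)
      then show ?thesis by (simp only: anti_synth_eq[OF b] cut_def False if_False minus_zero)
    qed
    moreover have "anti_synth b \<in> hcarrier H2_bidisc"
      using unitary_l2_in[OF unitary_bidisc_synth alternate_l2[OF b]] by (simp add: anti_synth_def)
    ultimately show ?thesis unfolding hcarrier_H2_anti by blast
  qed
  have lin: "alternate (b + c) = alternate b + alternate c" "alternate (fun_scale r b) = fun_scale r (alternate b)" for b c r
    by (simp_all add: alternate_def push_add push_scale fun_eq_iff algebra_simps)
  have inj: "inj_on anti_synth (hcarrier l2)"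
  proof (rule inj_onI)
    fix b c assume bc: "b \<in> hcarrier l2" "c \<in> hcarrier l2" "anti_synth b = anti_synth c"
    have "inj_on bidisc_synth (hcarrier l2)"
      using unitary_bidisc_synth by (simp add: unitary_map_def bij_betw_def)
    then have "alternate b = alternate c"
      using bc by (auto simp: anti_synth_def inj_on_def alternate_l2)
    then have "alternate b (lower p) = alternate c (lower p)" for p by simp
    then show "b = c" by (simp add: alternate_def fun_eq_iff)
  qed
  show ?thesis
    unfolding unitary_map_def hlinear_def bij_betw_def
  proof (intro conjI ballI allI inj)
    show "anti_synth ` hcarrier l2 = hcarrier H2_anti"
      using into anti_synth_onto by blast
    fix b c :: "nat \<times> nat \<Rightarrow> complex" assume b: "b \<in> hcarrier l2"
    show "anti_synth b \<in> hcarrier H2_anti" by (rule into[OF b])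
    show "anti_synth (hscale l2 r b) = hscale H2_anti r (anti_synth b)" for r
      by (simp add: anti_synth_def lin bidisc_synth_scale)
    assume c: "c \<in> hcarrier l2"
    show "anti_synth (b + c) = anti_synth b + anti_synth c"
      by (simp add: anti_synth_def lin bidisc_synth_add alternate_l2 b c)
    show "hinner H2_anti (anti_synth b) (anti_synth c) = hinner l2 b c"
      using unitary_bidisc_synth alternate_l2[OF b] alternate_l2[OF c]
      by (simp add: anti_synth_def unitary_map_def hinner_alternate b c)
  qed
qed

lemma anti_mono_Pair:
  fixes x y :: complex
  shows "anti_mono (i, j) (x, y) = (1 / sqrt 2) * ((x * y) ^ i * (x ^ Suc j - y ^ Suc j))"
  by (simp add: anti_mono_def mono2_def lower_def upper_def power_mult_distrib power_add algebra_simps)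

text \<open>Coordinates count from 0 while the basis counts its second index from 1; the square root
  of 2 is the norm of each basis function.\<close>

lemma anti_basis_eq: "anti_basis i (Suc j) = fun_scale (sqrt 2) (anti_synth (unit_seq (i, j)))"
proof -
  have "(\<Sum>\<^sub>\<infinity>p. unit_seq (i, j) p * anti_mono p z) = anti_mono (i, j) z" for z
    using unit_seq_finite_sum[of "\<lambda>p. anti_mono p z" "(i, j)"] by (simp add: mult.commute)
  then show ?thesis
    unfolding anti_synth_eq[OF unit_seq_l2]
    by (simp add: anti_basis_def cut_def fun_eq_iff anti_mono_Pair del: power_Suc)
qed

lemma anti_synth_unit_seq: "anti_synth (unit_seq (i, j)) = fun_scale (1 / sqrt 2) (anti_basis i (Suc j))"
  by (simp add: anti_basis_eq fun_eq_iff)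

lemma mult_op_anti_synth:
  assumes b: "b \<in> hcarrier l2"
  shows "mult_op H2_anti (\<lambda>(z\<^sub>1, z\<^sub>2). z\<^sub>1 * z\<^sub>2) (anti_synth b) = anti_synth (shift1 b)"
proof -
  have "(x * y) * (\<Sum>\<^sub>\<infinity>p. b p * anti_mono p (x, y)) = (\<Sum>\<^sub>\<infinity>p. shift1 b p * anti_mono p (x, y))" for x y
  proof -
    have step: "anti_mono (case p of (i, j) \<Rightarrow> (Suc i, j)) (x, y) = x * y * anti_mono p (x, y)" for p
      by (cases p) (simp add: anti_mono_Pair)
    have "(\<Sum>\<^sub>\<infinity>p. shift1 b p * anti_mono p (x, y))
        = (\<Sum>\<^sub>\<infinity>p. b p * anti_mono (case p of (i, j) \<Rightarrow> (Suc i, j)) (x, y))"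
      unfolding shift1_def by (rule push_infsum[OF inj_shifts(1)]) simp
    also have "\<dots> = (\<Sum>\<^sub>\<infinity>p. (x * y) * (b p * anti_mono p (x, y)))"
      by (simp only: step mult_ac)
    also have "\<dots> = (x * y) * (\<Sum>\<^sub>\<infinity>p. b p * anti_mono p (x, y))"
      by (rule infsum_cmult_right')
    finally show ?thesis ..
  qed
  moreover have "anti_synth b \<in> hcarrier H2_anti" by (rule unitary_l2_in[OF unitary_anti_synth b])
  ultimately show ?thesis
    using b by (auto simp: mult_op_def anti_synth_eq cut_def fun_eq_iff)
qed

section \<open>Operators induced by index maps, and the operator X\<close>

text \<open>The existence half for operators introduced by \<open>THE\<close>: conjugating
  \<open>push\<close> by the synthesis map and restricting to the carrier gives an extensional
  operator of norm at most 1.\<close>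

lemma push_operator:
  assumes \<Psi>: "unitary_map l2 H \<Psi>" and \<sigma>: "inj \<sigma>"
  obtains S where "S \<in> bounded_ops H H" "\<And>a. a \<in> hcarrier l2 \<Longrightarrow> S (\<Psi> a) = \<Psi> (push \<sigma> a)"
proof -
  have bij: "bij_betw \<Psi> (hcarrier l2) (hcarrier H)" using \<Psi> by (simp add: unitary_map_def)
  define S where "S = restrict (\<lambda>h. \<Psi> (push \<sigma> (inv_into (hcarrier l2) \<Psi> h))) (hcarrier H)"
  note \<Psi>in = unitary_l2_in[OF \<Psi>]
  have S: "S (\<Psi> a) = \<Psi> (push \<sigma> a)" if "a \<in> hcarrier l2" for a
    using bij_betw_inv_into_left[OF bij that] \<Psi>in[OF that] by (simp add: S_def)
  have lin: "\<Psi> a + \<Psi> b = \<Psi> (a + b)" "hscale H c (\<Psi> a) = \<Psi> (fun_scale c a)"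
    if "a \<in> hcarrier l2" "b \<in> hcarrier l2" for a b c
    using \<Psi> that by (simp_all add: unitary_map_def hlinear_def)
  have hl: "hlinear H H S"
    unfolding hlinear_def
  proof (intro conjI ballI allI)
    fix x assume "x \<in> hcarrier H"
    then obtain a where a: "a \<in> hcarrier l2" "x = \<Psi> a" using unitary_l2_cases[OF \<Psi>] by blast
    show "S x \<in> hcarrier H" using a by (simp add: S \<Psi>in push_l2_iff \<sigma>)
    show "S (hscale H c x) = hscale H c (S x)" for c
      using a by (simp add: lin[OF a(1) a(1)] S l2_scale push_scale lin[of "push \<sigma> a" "push \<sigma> a"] push_l2_iff \<sigma>)
    fix y assume "y \<in> hcarrier H"
    then obtain b where b: "b \<in> hcarrier l2" "y = \<Psi> b" using unitary_l2_cases[OF \<Psi>] by blast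
    show "S (x + y) = S x + S y"
      using a b by (simp add: lin S l2_add push_add push_l2_iff \<sigma>)
  qed
  have "hnorm H (S x) \<le> 1 * hnorm H x" if "x \<in> hcarrier H" for x
  proof -
    obtain a where a: "a \<in> hcarrier l2" "x = \<Psi> a"
      using unitary_l2_cases[OF \<Psi> \<open>x \<in> hcarrier H\<close>] by blast
    then show ?thesis by (simp add: S unitary_hnorm[OF \<Psi>] push_l2_iff \<sigma> hnorm_push)
  qed
  moreover have "S \<in> extensional (hcarrier H)" by (simp add: S_def)
  ultimately have "S \<in> bounded_ops H H" unfolding bounded_ops_def using hl by blast
  then show ?thesis using S that by blast
qed

text \<open>The conditions that define \<open>X_op\<close> prescribe values on multiples of
  coordinate vectors. The push along the second index meets them, and \<open>bounded_ops_eqI\<close>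
  excludes any other bounded operator.\<close>

lemma X_op_anti_synth:
  assumes b: "b \<in> hcarrier l2"
  shows "X_op (anti_synth b) = anti_synth (shift2 b)"
proof -
  obtain S where S: "S \<in> bounded_ops H2_anti H2_anti"
    "\<And>b. b \<in> hcarrier l2 \<Longrightarrow> S (anti_synth b) = anti_synth (shift2 b)"
    using push_operator[OF unitary_anti_synth inj_shifts(2)] unfolding shift2_def by metis
  have scale: "T (fun_scale c (anti_synth b)) = fun_scale c (T (anti_synth b))"
    if "T \<in> bounded_ops H2_anti H2_anti" "b \<in> hcarrier l2" for T b c
    using that unitary_l2_in[OF unitary_anti_synth that(2)]
    by (simp add: bounded_ops_def hlinear_def)
  have shift_unit: "shift2 (unit_seq (i, j)) = unit_seq (i, Suc j)" for i j
    using push_unit_seq[OF inj_shifts(2), of "(i, j)"] by (simp add: shift2_def)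
  have basis: "S (anti_basis i (Suc j)) = anti_basis i (Suc (Suc j))" for i j
    by (simp add: anti_basis_eq scale[OF S(1)] S(2) unit_seq_l2 shift_unit)
  have "X_op = S"
    unfolding X_op_def
  proof (rule the_equality)
    show "S \<in> bounded_ops H2_anti H2_anti \<and> (\<forall>i j. j \<ge> 1 \<longrightarrow> S (anti_basis i j) = anti_basis i (j + 1))"
      using S(1) basis by (metis Suc_eq_plus1 One_nat_def Suc_le_D)
    fix T assume T: "T \<in> bounded_ops H2_anti H2_anti \<and> (\<forall>i j. j \<ge> 1 \<longrightarrow> T (anti_basis i j) = anti_basis i (j + 1))"
    show "T = S"
    proof (rule bounded_ops_eqI[OF unitary_anti_synth unitary_anti_synth conjunct1[OF T] S(1)])
      fix p :: "nat \<times> nat"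
      obtain i j where p: "p = (i, j)" by (cases p)
      have "T (anti_synth (unit_seq (i, j))) = fun_scale (1 / sqrt 2) (fun_scale (sqrt 2) (T (anti_synth (unit_seq (i, j)))))"
        by (simp add: fun_eq_iff)
      also have "fun_scale (sqrt 2) (T (anti_synth (unit_seq (i, j)))) = T (anti_basis i (Suc j))"
        using scale[OF conjunct1[OF T] unit_seq_l2] by (simp add: anti_basis_eq)
      also have "\<dots> = anti_basis i (Suc (Suc j))" using T by simp
      also have "fun_scale (1 / sqrt 2) (anti_basis i (Suc (Suc j))) = S (anti_synth (unit_seq (i, j)))"
        by (simp add: S(2) unit_seq_l2 shift_unit anti_synth_unit_seq[of i "Suc j"])
      finally show "T (anti_synth (unit_seq p)) = S (anti_synth (unit_seq p))" using p by simp
    qed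
  qed
  then show ?thesis using S(2)[OF b] by simp
qed

lemma shift_model_HM2: "shift_model H2_anti (mult_op H2_anti (\<lambda>(z\<^sub>1, z\<^sub>2). z\<^sub>1 * z\<^sub>2)) X_op anti_synth"
  by (simp add: shift_model_def unitary_anti_synth mult_op_anti_synth X_op_anti_synth vector_space_fun_scale
     )

subsection \<open>The symmetrized bidisc\<close>

text \<open>For fixed unimodular \<open>y\<close>, \<open>J\<close> is a polynomial of degree one in
  \<open>x\<close> with unimodular coefficients, so the inner integral is 1 + 1.\<close>

lemma J_norm_eq: "J_norm = sqrt 2"
proof -
  have inner: "(\<integral>\<^sup>+x. ennreal ((cmod (J (x, y)))\<^sup>2) \<partial>circle_measure) = 2" if "cmod y = 1" for y
  proof -
    have "J (x, y) = (\<Sum>n<2. (if n = 0 then - y else 1) * x ^ n)" for x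
      by (simp add: J_def numeral_2_eq_2)
    then show ?thesis
      using that by (simp only: circle_nn_integral_polynomial) (simp add: numeral_2_eq_2)
  qed
  have cont: "continuous_on UNIV (\<lambda>z. (cmod (J z))\<^sup>2)"
    unfolding J_def case_prod_unfold by (intro continuous_intros)
  have meas: "(\<lambda>z. (cmod (J z))\<^sup>2) \<in> borel_measurable torus_measure"
    unfolding measurable_cong_sets[OF sets_torus_measure refl]
    by (rule borel_measurable_continuous_onI[OF cont])
  then have meas': "(\<lambda>z. ennreal ((cmod (J z))\<^sup>2)) \<in> borel_measurable (circle_measure \<Otimes>\<^sub>M circle_measure)"
    unfolding torus_measure_def by measurable
  interpret P: pair_sigma_finite circle_measure circle_measure ..
  have "(\<integral>\<^sup>+z. ennreal ((cmod (J z))\<^sup>2) \<partial>torus_measure)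
      = (\<integral>\<^sup>+y. \<integral>\<^sup>+x. ennreal ((cmod (J (x, y)))\<^sup>2) \<partial>circle_measure \<partial>circle_measure)"
    unfolding torus_measure_def by (rule P.nn_integral_snd[OF meas', symmetric])
  also have "\<dots> = (\<integral>\<^sup>+y. 2 \<partial>circle_measure)"
    by (rule nn_integral_cong_AE) (use AE_circle in eventually_elim, rule inner)
  also have "\<dots> = 2" using circle.emeasure_space_1 by simp
  finally have nn: "(\<integral>\<^sup>+z. ennreal ((cmod (J z))\<^sup>2) \<partial>torus_measure) = 2" .
  show ?thesis
    unfolding J_norm_def using meas by (subst integral_eq_nn_integral) (simp_all add: nn)
qed

text \<open>The recursion reflects that both roots of t^2 - s t + p satisfy t^(k+2) = s t^(k+1) - p
  t^k. It gives polynomials in s and p without dividing by z1 - z2, so they make sense over the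
  diagonal too.\<close>

fun complete_sym :: "nat \<Rightarrow> complex \<times> complex \<Rightarrow> complex" where
  "complete_sym 0 w = 1"
| "complete_sym (Suc 0) w = fst w"
| "complete_sym (Suc (Suc k)) w = fst w * complete_sym (Suc k) w - snd w * complete_sym k w"

lemma complete_sym_Suc:
  "complete_sym (Suc k) (x + y, x * y) = x ^ Suc k + y * complete_sym k (x + y, x * y)"
  by (induction k) (simp_all add: algebra_simps)

lemma diff_mult_complete_sym: "(x - y) * complete_sym k (x + y, x * y) = x ^ Suc k - y ^ Suc k"
proof (induction k)
  case (Suc k)
  have "(x - y) * complete_sym (Suc k) (x + y, x * y)
      = (x - y) * x ^ Suc k + y * ((x - y) * complete_sym k (x + y, x * y))"
    unfolding complete_sym_Suc by (simp only: distrib_left mult_ac)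
  also have "\<dots> = x ^ Suc (Suc k) - y ^ Suc (Suc k)"
    unfolding Suc.IH by (simp add: algebra_simps)
  finally show ?case .
qed simp

text \<open>In the roots, the polynomial is a sum of k + 1 monomials of degree k.\<close>

lemma complete_sym_le:
  assumes "cmod x \<le> r" "cmod y \<le> r"
  shows "cmod (complete_sym k (x + y, x * y)) \<le> real (Suc k) * r ^ k"
proof (induction k)
  case (Suc k)
  have r: "0 \<le> r" using assms(1) by (rule order_trans[OF norm_ge_zero])
  have "cmod (complete_sym (Suc k) (x + y, x * y)) \<le> cmod x ^ Suc k + cmod y * cmod (complete_sym k (x + y, x * y))"
    unfolding complete_sym_Suc by (rule order_trans[OF norm_triangle_ineq]) (simp add: norm_mult norm_power)
  also have "\<dots> \<le> r ^ Suc k + r * (real (Suc k) * r ^ k)"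
    using assms r Suc.IH by (intro add_mono power_mono mult_mono) auto
  finally show ?case by (simp add: algebra_simps)
qed simp

lemma complete_sym_holomorphic:
  "(\<lambda>x. complete_sym k (x, y)) holomorphic_on UNIV" "(\<lambda>y. complete_sym k (x, y)) holomorphic_on UNIV"
proof -
  have "(\<lambda>x. complete_sym k (x, y)) holomorphic_on UNIV \<and> (\<lambda>x. complete_sym (Suc k) (x, y)) holomorphic_on UNIV"
    by (induction k) (auto intro!: holomorphic_intros)
  moreover have "(\<lambda>y. complete_sym k (x, y)) holomorphic_on UNIV \<and> (\<lambda>y. complete_sym (Suc k) (x, y)) holomorphic_on UNIV"
    by (induction k) (auto intro!: holomorphic_intros)
  ultimately show "(\<lambda>x. complete_sym k (x, y)) holomorphic_on UNIV" "(\<lambda>y. complete_sym k (x, y)) holomorphic_on UNIV"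
    by auto
qed

text \<open>The squared modulus of the larger root of \<open>t\<^sup>2 - s t + p\<close>, as a continuous function of
  \<open>(s, p)\<close>: if \<open>x\<close> and \<open>y\<close> are the roots, then \<open>\<bar>x\<bar>\<^sup>2 + \<bar>y\<bar>\<^sup>2 = (\<bar>s\<bar>\<^sup>2 + \<bar>s\<^sup>2 - 4 p\<bar>) / 2\<close> by
  the parallelogram law.\<close>

definition root_radius :: "complex \<times> complex \<Rightarrow> real" where
  "root_radius w = (let T = ((cmod (fst w))\<^sup>2 + cmod ((fst w)\<^sup>2 - 4 * snd w)) / 2
     in (T + sqrt (T\<^sup>2 - 4 * (cmod (snd w))\<^sup>2)) / 2)"

lemma continuous_root_radius: "continuous_on S root_radius"
  unfolding root_radius_def Let_def by (intro continuous_intros) auto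

text \<open>Here T = |x|^2 + |y|^2, and |p|^2 is the product of the two summands. Hence T^2 - 4
  |p|^2 is the square of |x|^2 - |y|^2, and the formula picks the larger root of u^2 - T u +
  |p|^2.\<close>

lemma root_radius_sym_map: "root_radius (sym_map (x, y)) = max ((cmod x)\<^sup>2) ((cmod y)\<^sup>2)"
proof -
  let ?T = "((cmod (x + y))\<^sup>2 + cmod ((x + y)\<^sup>2 - 4 * (x * y))) / 2"
  have "(x + y)\<^sup>2 - 4 * (x * y) = (x - y)\<^sup>2" by (simp add: power2_eq_square algebra_simps)
  then have "?T = ((cmod (x + y))\<^sup>2 + (cmod (x - y))\<^sup>2) / 2" by (simp add: norm_power)
  also have "\<dots> = (cmod x)\<^sup>2 + (cmod y)\<^sup>2"
    unfolding cmod_power2 by (simp add: power2_eq_square algebra_simps)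
  finally have T: "?T = (cmod x)\<^sup>2 + (cmod y)\<^sup>2" .
  have "((cmod x)\<^sup>2 + (cmod y)\<^sup>2)\<^sup>2 - 4 * (cmod (x * y))\<^sup>2 = ((cmod x)\<^sup>2 - (cmod y)\<^sup>2)\<^sup>2"
    by (simp add: norm_mult power2_eq_square algebra_simps)
  then have "sqrt (?T\<^sup>2 - 4 * (cmod (x * y))\<^sup>2) = \<bar>(cmod x)\<^sup>2 - (cmod y)\<^sup>2\<bar>"
    unfolding T by simp
  then show ?thesis unfolding root_radius_def sym_map_def Let_def case_prod_conv fst_conv snd_conv T by simp
qed

lemma sym_map_surj: obtains x y where "w = sym_map (x, y)"
proof
  let ?r = "csqrt ((fst w)\<^sup>2 - 4 * snd w)"
  have "?r * ?r = (fst w)\<^sup>2 - 4 * snd w" by (metis power2_csqrt power2_eq_square)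
  then show "w = sym_map ((fst w + ?r) / 2, (fst w - ?r) / 2)"
    by (cases w) (simp add: sym_map_def field_simps power2_eq_square)
qed

text \<open>\<open>root_radius\<close> depends only on the image point, so no point outside the
  bidisc has its image in \<open>symm_bidisc\<close>. The description by a strict inequality for a
  continuous function also yields openness.\<close>

lemma sym_map_in_symm_bidisc: "sym_map z \<in> symm_bidisc \<longleftrightarrow> z \<in> bidisc"
  and symm_bidisc_eq: "symm_bidisc = {w. root_radius w < 1}"
proof -
  have *: "root_radius (sym_map z) < 1 \<longleftrightarrow> z \<in> bidisc" for z
  proof -
    have "(cmod u)\<^sup>2 < 1 \<longleftrightarrow> cmod u < 1" for u by (simp add: power_less_one_iff)
    then show ?thesis by (cases z) (simp add: root_radius_sym_map in_bidisc)
  qed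
  show eq: "symm_bidisc = {w. root_radius w < 1}"
  proof (intro set_eqI iffI)
    fix w assume "w \<in> {w. root_radius w < 1}"
    moreover obtain x y where "w = sym_map (x, y)" by (rule sym_map_surj)
    ultimately show "w \<in> symm_bidisc" using * by (auto simp: symm_bidisc_def)
  qed (use * in \<open>auto simp: symm_bidisc_def\<close>)
  show "sym_map z \<in> symm_bidisc \<longleftrightarrow> z \<in> bidisc" by (simp add: eq *)
qed

lemma open_symm_bidisc: "open symm_bidisc"
  unfolding symm_bidisc_eq by (intro open_Collect_less continuous_root_radius continuous_intros)

section \<open>Series in s and p on the symmetrized bidisc\<close>

definition sym_mono :: "nat \<times> nat \<Rightarrow> complex \<times> complex \<Rightarrow> complex" where
  "sym_mono = (\<lambda>(i, j) w. snd w ^ i * complete_sym j w)"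

definition sym_synth :: "(nat \<times> nat \<Rightarrow> complex) \<Rightarrow> complex \<times> complex \<Rightarrow> complex" where
  "sym_synth b = cut symm_bidisc (\<lambda>w. \<Sum>\<^sub>\<infinity>p. b p * sym_mono p w)"

lemma sym_mono_le:
  assumes "root_radius w \<le> r\<^sup>2" "0 \<le> r"
  shows "cmod (sym_mono p w) \<le> (r\<^sup>2) ^ fst p * (real (Suc (snd p)) * r ^ snd p)"
proof -
  obtain x y where w: "w = sym_map (x, y)" by (rule sym_map_surj)
  have xy: "cmod x \<le> r" "cmod y \<le> r"
    using assms by (simp_all add: w root_radius_sym_map power_mono_iff)
  have "cmod (snd w) \<le> r\<^sup>2"
    using mult_mono[OF xy assms(2) norm_ge_zero] by (simp add: w sym_map_def norm_mult power2_eq_square)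
  moreover have "cmod (complete_sym (snd p) w) \<le> real (Suc (snd p)) * r ^ snd p"
    using complete_sym_le[OF xy] by (simp add: w sym_map_def)
  ultimately show ?thesis
    by (cases p) (simp add: sym_mono_def norm_mult norm_power mult_mono power_mono)
qed

lemma sym_majorant:
  fixes r C :: real
  assumes "0 \<le> r" "r < 1"
  shows "(\<lambda>p. C * ((r\<^sup>2) ^ fst p * (real (Suc (snd p)) * r ^ snd p))) summable_on UNIV"
proof -
  have "(\<lambda>n. real (Suc n) * r ^ n) summable_on UNIV"
    using geometric_deriv_sums[of r] assms
    by (intro summable_nonneg_imp_summable_on) (auto simp: sums_iff)
  moreover have "r\<^sup>2 < 1" using assms by (simp add: power_less_one_iff)
  ultimately have "(\<lambda>(i, j). (r\<^sup>2) ^ i * (real (Suc j) * r ^ j)) summable_on UNIV"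
    using assms by (intro summable_on_times[of "\<lambda>i. (r\<^sup>2) ^ i" "\<lambda>j. real (Suc j) * r ^ j"] summable_on_geometric) auto
  then show ?thesis by (intro summable_on_cmult_right) (simp add: case_prod_unfold)
qed

lemma symm_bidisc_nbhd:
  assumes "w \<in> symm_bidisc"
  obtains r d where "0 \<le> r" "r < 1" "d > 0" "\<And>v. dist w v < d \<Longrightarrow> root_radius v \<le> r\<^sup>2"
proof -
  have "root_radius w < 1" using assms by (simp add: symm_bidisc_eq)
  then obtain q where q: "0 < q" "q < 1" "root_radius w < q" using power_lt_1_between by blast
  have "open {v. root_radius v < q}" by (intro open_Collect_less continuous_root_radius continuous_intros)
  then obtain d where d: "d > 0" "ball w d \<subseteq> {v. root_radius v < q}"
    using q(3) unfolding open_contains_ball by blast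
  \<comment> \<open>\<open>root_radius\<close> is a squared modulus, hence the square root.\<close>
  show thesis
  proof (rule that[of "sqrt q" d])
    show "root_radius v \<le> (sqrt q)\<^sup>2" if "dist w v < d" for v
    proof -
      have "v \<in> ball w d" using that by simp
      then show ?thesis using d(2) q by (auto dest: subsetD)
    qed
  qed (use q d in auto)
qed

lemma sym_synth_term_le:
  assumes b: "b \<in> hcarrier l2" and w: "root_radius w \<le> r\<^sup>2" "0 \<le> r"
  shows "cmod (b p * sym_mono p w) \<le> hnorm l2 b * ((r\<^sup>2) ^ fst p * (real (Suc (snd p)) * r ^ snd p))"
  unfolding norm_mult by (intro mult_mono l2_coord_le b sym_mono_le w hnorm_l2_nonneg) simp

lemma sym_synth_summable:
  assumes b: "b \<in> hcarrier l2" and w: "w \<in> symm_bidisc"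
  shows "(\<lambda>p. b p * sym_mono p w) summable_on UNIV"
proof -
  obtain r d where r: "0 \<le> r" "r < 1" "d > 0" "\<And>v. dist w v < d \<Longrightarrow> root_radius v \<le> r\<^sup>2"
    using symm_bidisc_nbhd[OF w] by metis
  then have "root_radius w \<le> r\<^sup>2" by simp
  then have "(\<lambda>p. cmod (b p * sym_mono p w)) summable_on UNIV"
    using r by (intro summable_on_comparison_test[OF sym_majorant[of r "hnorm l2 b"]] sym_synth_term_le[OF b]) auto
  then show ?thesis by (rule abs_summable_summable)
qed

lemma holomorphic2_sym_synth:
  assumes b: "b \<in> hcarrier l2"
  shows "sym_synth b holomorphic2_on symm_bidisc"
proof -
  have "(\<lambda>w. \<Sum>\<^sub>\<infinity>p. b p * sym_mono p w) holomorphic2_on symm_bidisc"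
  proof (rule holomorphic2_on_infsum[OF open_symm_bidisc])
    show "(\<lambda>x. b p * sym_mono p (x, y)) holomorphic_on UNIV" "(\<lambda>y. b p * sym_mono p (x, y)) holomorphic_on UNIV" for p x y
      by (cases p; auto simp: sym_mono_def intro!: holomorphic_intros complete_sym_holomorphic)+
    fix w assume "w \<in> symm_bidisc"
    then obtain r d where r: "0 \<le> r" "r < 1" "d > 0" "\<And>v. dist w v < d \<Longrightarrow> root_radius v \<le> r\<^sup>2"
      using symm_bidisc_nbhd by metis
    show "\<exists>d>0. \<exists>M. M summable_on UNIV \<and> (\<forall>v\<in>symm_bidisc. dist w v < d \<longrightarrow> (\<forall>p. cmod (b p * sym_mono p v) \<le> M p))"
      using sym_synth_term_le[OF b r(4) r(1)] r(3) sym_majorant[OF r(1,2), of "hnorm l2 b"] by blast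
  qed
  then show ?thesis
    by (subst holomorphic2_on_cong[where g = "\<lambda>w. \<Sum>\<^sub>\<infinity>p. b p * sym_mono p w"]) (auto simp: sym_synth_def cut_def)
qed

lemma anti_mono_sym_mono: "anti_mono p z = (1 / sqrt 2) * (J z * sym_mono p (sym_map z))"
proof (cases p; cases z)
  fix i j x y assume p: "p = (i, j)" and z: "z = (x, y)"
  have "J z * sym_mono p (sym_map z) = (x * y) ^ i * ((x - y) * complete_sym j (x + y, x * y))"
    by (simp add: p z J_def sym_mono_def sym_map_def mult_ac)
  then show ?thesis by (simp only: diff_mult_complete_sym p z anti_mono_Pair)
qed

text \<open>Termwise this is the factorization of z1^(j+1) - z2^(j+1) by z1 - z2. It carries the
  isometry from antisymmetric functions to \<open>H2_sym\<close>; the square root of 2 is cancelled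
  there by \<open>J_norm\<close>.\<close>

lemma sym_synth_times_J:
  assumes b: "b \<in> hcarrier l2"
  shows "(\<lambda>z. sym_synth b (sym_map z) * J z) = fun_scale (sqrt 2) (anti_synth b)"
proof
  fix z
  show "sym_synth b (sym_map z) * J z = fun_scale (sqrt 2) (anti_synth b) z"
  proof (cases "z \<in> bidisc")
    case True
    have "anti_synth b z = (\<Sum>\<^sub>\<infinity>p. ((1 / sqrt 2) * J z) * (b p * sym_mono p (sym_map z)))"
      using True by (simp add: anti_synth_eq[OF b] cut_def anti_mono_sym_mono mult_ac)
    also have "\<dots> = ((1 / sqrt 2) * J z) * (\<Sum>\<^sub>\<infinity>p. b p * sym_mono p (sym_map z))"
      by (rule infsum_cmult_right')
    finally show ?thesis using True by (simp add: sym_synth_def cut_def sym_map_in_symm_bidisc)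
  next
    case False
    then show ?thesis
      by (simp add: sym_synth_def cut_def sym_map_in_symm_bidisc anti_synth_eq[OF b])
  qed
qed

lemma hnorm_anti_synth: "b \<in> hcarrier l2 \<Longrightarrow> hnorm H2_bidisc (anti_synth b) = hnorm l2 b"
  using unitary_hnorm[OF unitary_anti_synth] by simp

lemma mean_sq2_sym_synth:
  assumes b: "b \<in> hcarrier l2"
  shows "mean_sq2 (\<lambda>z. sym_synth b (sym_map z) * J z) = ennreal ((sqrt 2 * hnorm l2 b)\<^sup>2)"
proof -
  have b': "fun_scale (sqrt 2) b \<in> hcarrier l2" using b by (rule l2_scale)
  have "fun_scale (sqrt 2) (anti_synth b) = anti_synth (fun_scale (sqrt 2) b)"
    using unitary_anti_synth b by (simp add: unitary_map_def hlinear_def)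
  then have "mean_sq2 (\<lambda>z. sym_synth b (sym_map z) * J z) = mean_sq2 (anti_synth (fun_scale (sqrt 2) b))"
    by (simp add: sym_synth_times_J[OF b])
  also have "\<dots> = ennreal ((hnorm l2 (fun_scale (sqrt 2) b))\<^sup>2)"
    using mean_sq2_H2_bidisc(1)[of "anti_synth (fun_scale (sqrt 2) b)"]
      unitary_l2_in[OF unitary_anti_synth b'] hnorm_anti_synth[OF b'] by (simp add: hcarrier_H2_anti)
  also have "(hnorm l2 (fun_scale (sqrt 2) b))\<^sup>2 = (sqrt 2 * hnorm l2 b)\<^sup>2"
    by (simp add: hnorm_l2_sq[OF b'] hnorm_l2_sq[OF b] power_mult_distrib norm_mult infsum_cmult_right')
  finally show ?thesis .
qed

lemma holomorphic2_sym_map_times_J: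
  assumes f: "f holomorphic2_on symm_bidisc"
  shows "(\<lambda>z. f (sym_map z) * J z) holomorphic2_on bidisc"
  unfolding holomorphic2_on_def
proof
  fix z assume z: "z \<in> bidisc"
  obtain x y where xy: "z = (x, y)" by (cases z)
  have "sym_map z \<in> symm_bidisc" using z by (simp add: sym_map_in_symm_bidisc)
  then obtain a b where "(f has_derivative (\<lambda>(h, k). a * h + b * k)) (at (sym_map z))"
    using f open_symm_bidisc unfolding holomorphic2_on_def by (metis at_within_open)
  moreover have "(sym_map has_derivative (\<lambda>v. (fst v + snd v, x * snd v + fst v * y))) (at z)"
    unfolding sym_map_def case_prod_unfold xy by (auto intro!: derivative_eq_intros)
  ultimately have "((\<lambda>z. f (sym_map z)) has_derivative (\<lambda>v. a * (fst v + snd v) + b * (x * snd v + fst v * y))) (at z)"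
    using has_derivative_compose[where g = f and f = sym_map] by fastforce
  moreover have "(J has_derivative (\<lambda>v. fst v - snd v)) (at z)"
    unfolding J_def case_prod_unfold by (auto intro!: derivative_eq_intros)
  ultimately have "((\<lambda>z. f (sym_map z) * J z) has_derivative
      (\<lambda>v. f (sym_map z) * (fst v - snd v) + (a * (fst v + snd v) + b * (x * snd v + fst v * y)) * J z)) (at z within bidisc)"
    by (intro has_derivative_mult) (auto intro: has_derivative_at_withinI)
  also have "(\<lambda>v. f (sym_map z) * (fst v - snd v) + (a * (fst v + snd v) + b * (x * snd v + fst v * y)) * J z)
      = (\<lambda>(h, k). (f (sym_map z) + (a + b * y) * J z) * h + (- f (sym_map z) + (a + b * x) * J z) * k)"
    by (auto simp: fun_eq_iff algebra_simps)
  finally show "\<exists>a b. ((\<lambda>z. f (sym_map z) * J z) has_derivative (\<lambda>(h, k). a * h + b * k)) (at z within bidisc)"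
    by blast
qed

text \<open>Equality after multiplication by \<open>J\<close> says nothing at points (x, x). These
  are limits of (x, x + t) with t tending to 0 through nonzero values, where equality is
  known.\<close>

lemma continuous_eq_off_diagonal:
  assumes f: "continuous_on symm_bidisc f" and g: "continuous_on symm_bidisc g"
    and eq: "\<And>x y. (x, y) \<in> bidisc \<Longrightarrow> x \<noteq> y \<Longrightarrow> f (sym_map (x, y)) = g (sym_map (x, y))"
    and z: "z \<in> bidisc"
  shows "f (sym_map z) = (g (sym_map z) :: complex)"
proof -
  obtain x y where xy: "z = (x, y)" by (cases z)
  show ?thesis
  proof (cases "x = y")
    case False
    then show ?thesis using eq z xy by simp
  next
    case True
    define D where "D = (\<lambda>w. f w - g w)"
    have "isCont D (sym_map z)"
      using f g z sym_map_in_symm_bidisc[of z] open_symm_bidisc unfolding D_def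
      by (intro continuous_diff) (auto simp: continuous_on_eq_continuous_at)
    moreover have lim: "((\<lambda>t. sym_map (x, x + t)) \<longlongrightarrow> sym_map (x, x + 0)) (at 0)"
      unfolding sym_map_def case_prod_conv by (intro tendsto_intros)
    ultimately have "((\<lambda>t. D (sym_map (x, x + t))) \<longlongrightarrow> D (sym_map z)) (at 0)"
      using True xy by (auto intro: isCont_tendsto_compose)
    moreover have "eventually (\<lambda>t. D (sym_map (x, x + t)) = 0) (at 0)"
    proof -
      have "((\<lambda>t. x + t) \<longlongrightarrow> x + 0) (at 0)" by (intro tendsto_intros)
      then have "eventually (\<lambda>t. x + t \<in> ball 0 1) (at 0)"
        using z xy True by (intro topological_tendstoD) (auto simp: in_bidisc)
      moreover have "eventually (\<lambda>t. t \<noteq> 0) (at (0 :: complex))" by (simp add: eventually_at_filter)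
      ultimately show ?thesis
        by eventually_elim (use z xy eq in \<open>auto simp: D_def in_bidisc\<close>)
    qed
    ultimately have "((\<lambda>_. 0) \<longlongrightarrow> D (sym_map z)) (at (0 :: complex))"
      using tendsto_cong by force
    then have "D (sym_map z) = 0" by (simp add: tendsto_const_iff)
    then show ?thesis by (simp add: D_def)
  qed
qed

text \<open>The pullback times \<open>J\<close> is antisymmetric and lies in the Hardy space of the
  bidisc, so its coordinates there suggest \<open>b\<close>. The two functions agree where
  \<open>J\<close> is nonzero, and by continuity everywhere.\<close>

lemma sym_synth_onto:
  assumes f: "f holomorphic2_on symm_bidisc" "zero_off symm_bidisc f" "mean_sq2 (\<lambda>z. f (sym_map z) * J z) < \<infinity>"
  shows "\<exists>b\<in>hcarrier l2. sym_synth b = f"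
proof -
  let ?g = "\<lambda>z. f (sym_map z) * J z"
  have "f w = 0" if "w \<notin> symm_bidisc" for w using f(2) that unfolding zero_off_def by blast
  then have "zero_off bidisc ?g" unfolding zero_off_def by (simp add: sym_map_in_symm_bidisc)
  then have "?g \<in> hcarrier H2_bidisc"
    using f(3) holomorphic2_sym_map_times_J[OF f(1)] by (simp add: H2_bidisc_iff)
  moreover have "?g (x, y) = - ?g (y, x)" for x y
    by (simp add: sym_map_def J_def add.commute[of y x] mult.commute[of y x]) (simp add: algebra_simps)
  ultimately have "?g \<in> hcarrier H2_anti" unfolding hcarrier_H2_anti by blast
  then obtain c where c: "c \<in> hcarrier l2" "anti_synth c = ?g" using anti_synth_onto by blast
  define b where "b = fun_scale (1 / sqrt 2) c"
  have b: "b \<in> hcarrier l2" unfolding b_def using c(1) by (rule l2_scale)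
  have "anti_synth b = fun_scale (1 / sqrt 2) (anti_synth c)"
    using unitary_anti_synth c(1) by (simp add: b_def unitary_map_def hlinear_def)
  then have eq: "sym_synth b (sym_map z) * J z = f (sym_map z) * J z" for z
    using fun_cong[OF sym_synth_times_J[OF b], of z] by (simp add: c(2))
  have "sym_synth b (sym_map z) = f (sym_map z)" if "z \<in> bidisc" for z
  proof (rule continuous_eq_off_diagonal[OF _ _ _ that])
    show "continuous_on symm_bidisc (sym_synth b)" "continuous_on symm_bidisc f"
      using holomorphic2_sym_synth[OF b] f(1) by (simp_all add: holomorphic2_on_imp_continuous_on)
    show "sym_synth b (sym_map (x, y)) = f (sym_map (x, y))" if "x \<noteq> y" for x y
      using eq[of "(x, y)"] that by (simp add: J_def)
  qed
  then have "sym_synth b w = f w" for w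
  proof (cases "w \<in> symm_bidisc")
    case False
    then have "f w = 0" using f(2) unfolding zero_off_def by blast
    then show ?thesis using False by (simp add: sym_synth_def cut_def)
  qed (auto simp: symm_bidisc_def)
  then have "sym_synth b = f" by (rule ext)
  then show ?thesis using b by blast
qed

lemma unitary_sym_synth: "unitary_map l2 H2_sym sym_synth"
  unfolding H2_sym_def
proof (rule unitary_l2_hspace_of_norm)
  let ?V = "{f. f holomorphic2_on symm_bidisc \<and> zero_off symm_bidisc f \<and> mean_sq2 (\<lambda>z. f (sym_map z) * J z) < \<infinity>}"
  show "inverse J_norm * sqrt (enn2real (mean_sq2 (\<lambda>z. sym_synth b (sym_map z) * J z))) = hnorm l2 b" if "b \<in> hcarrier l2" for b
    using that by (simp add: mean_sq2_sym_synth hnorm_l2_nonneg J_norm_eq)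
  show "\<exists>b\<in>hcarrier l2. sym_synth b = f" if "f \<in> ?V" for f
    using that by (intro sym_synth_onto) auto
  show "sym_synth b \<in> ?V" if "b \<in> hcarrier l2" for b
    using that by (simp add: holomorphic2_sym_synth mean_sq2_sym_synth) (simp add: sym_synth_def)
  show "sym_synth (fun_scale c b) = fun_scale c (sym_synth b)" for c b
    by (auto simp: sym_synth_def cut_def fun_eq_iff mult.assoc infsum_cmult_right')
  show "sym_synth (a + b) = sym_synth a + sym_synth b" if "a \<in> hcarrier l2" "b \<in> hcarrier l2" for a b
    using that by (auto simp: sym_synth_def cut_def fun_eq_iff distrib_right infsum_add sym_synth_summable)
qed

section \<open>The unitary U and the operators of the first module\<close>

lemma U_op_sym_synth:
  assumes b: "b \<in> hcarrier l2"
  shows "U_op (sym_synth b) = anti_synth b"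
proof -
  have "of_real (1 / J_norm) * J z * sym_synth b (sym_map z) = anti_synth b z" for z
    using fun_cong[OF sym_synth_times_J[OF b], of z] by (simp add: J_norm_eq field_simps)
  then have "U_op (sym_synth b) = cut bidisc (anti_synth b)"
    using unitary_l2_in[OF unitary_sym_synth b] by (simp add: U_op_def)
  then show ?thesis by (simp add: anti_synth_eq[OF b] cut_def fun_eq_iff)
qed

text \<open>\<open>U_op\<close> identifies the two synthesis maps, so its adjoint has to be its
  inverse, \<open>sym_synth\<close> composed with the coordinates in \<open>H2_anti\<close>. This
  candidate is checked against the definition of the adjoint and shown to be the only one.\<close>

lemma adjoint_U_op:
  assumes b: "b \<in> hcarrier l2"
  shows "adjoint_op H2_sym H2_anti U_op (anti_synth b) = sym_synth b"
proof -
  interpret H: hilbert_space H2_sym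
    by (rule hilbert_space_unitary[OF unitary_sym_synth hilbert_space_l2]) (simp add: vector_space_fun_scale)
  define G where "G = inv_into (hcarrier l2) anti_synth"
  have unitary_G: "unitary_map H2_anti l2 G" unfolding G_def
    by (rule unitary_map_inv[OF unitary_anti_synth]) (use l2.subspace_carrier vector_space_fun_scale in auto)
  have G: "G (anti_synth c) = c" if "c \<in> hcarrier l2" for c
  proof -
    have "bij_betw anti_synth (hcarrier l2) (hcarrier H2_anti)" using unitary_anti_synth by (simp add: unitary_map_def)
    from bij_betw_inv_into_left[OF this that] show ?thesis by (simp add: G_def)
  qed
  define S where "S = restrict (sym_synth \<circ> G) (hcarrier H2_anti)"
  have SG: "S x = (sym_synth \<circ> G) x" if "x \<in> hcarrier H2_anti" for x using that by (simp add: S_def)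
  have u: "unitary_map H2_anti H2_sym (sym_synth \<circ> G)" by (rule unitary_map_comp[OF unitary_G unitary_sym_synth])
  interpret A: hilbert_space H2_anti
    by (rule hilbert_space_unitary[OF unitary_anti_synth hilbert_space_l2]) (simp add: vector_space_fun_scale)
  have "hlinear H2_anti H2_sym S"
    using u A.subspace_add[OF A.subspace_carrier] A.subspace_scale[OF A.subspace_carrier]
    unfolding unitary_map_def hlinear_def by (simp add: SG del: o_apply)
  moreover have "hnorm H2_sym (S x) \<le> 1 * hnorm H2_anti x" if "x \<in> hcarrier H2_anti" for x
    using unitary_hnorm[OF u that] by (simp add: SG[OF that] del: o_apply)
  moreover have "S \<in> extensional (hcarrier H2_anti)" by (simp add: S_def)
  ultimately have S: "S \<in> bounded_ops H2_anti H2_sym" unfolding bounded_ops_def by blast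
  have S_anti: "S (anti_synth c) = sym_synth c" if "c \<in> hcarrier l2" for c
    using unitary_l2_in[OF unitary_anti_synth that] G[OF that] by (simp add: S_def)
  have adj: "hinner H2_anti (U_op f) g = hinner H2_sym f (S g)" if f: "f \<in> hcarrier H2_sym" and g: "g \<in> hcarrier H2_anti" for f g
  proof -
    obtain c where c: "c \<in> hcarrier l2" "f = sym_synth c" using unitary_l2_cases[OF unitary_sym_synth f] .
    obtain d where d: "d \<in> hcarrier l2" "g = anti_synth d" using unitary_l2_cases[OF unitary_anti_synth g] .
    show ?thesis using c d unitary_anti_synth unitary_sym_synth
      by (simp add: U_op_sym_synth S_anti unitary_map_def del: H2_anti_simps)
  qed
  have "adjoint_op H2_sym H2_anti U_op = S"
    unfolding adjoint_op_def
  proof (rule the_equality)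
    show "S \<in> bounded_ops H2_anti H2_sym \<and>
      (\<forall>x\<in>hcarrier H2_sym. \<forall>y\<in>hcarrier H2_anti. hinner H2_anti (U_op x) y = hinner H2_sym x (S y))"
      using S adj by blast
    fix T assume T: "T \<in> bounded_ops H2_anti H2_sym \<and>
      (\<forall>x\<in>hcarrier H2_sym. \<forall>y\<in>hcarrier H2_anti. hinner H2_anti (U_op x) y = hinner H2_sym x (T y))"
    show "T = S"
    proof (rule extensionalityI)
      show "T \<in> extensional (hcarrier H2_anti)" "S \<in> extensional (hcarrier H2_anti)"
        using T S by (auto simp: bounded_ops_def)
      fix y assume y: "y \<in> hcarrier H2_anti"
      have TS: "T y \<in> hcarrier H2_sym" "S y \<in> hcarrier H2_sym"
        using T S y by (auto simp: bounded_ops_def hlinear_def)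
      let ?d = "T y - S y"
      have d: "?d \<in> hcarrier H2_sym" by (rule H.subspace_diff[OF H.subspace_carrier TS])
      \<comment> \<open>The adjoint identities for \<open>T\<close> and \<open>S\<close> are tested
        against the difference itself, which makes it orthogonal to itself.\<close>
      have "hinner H2_sym ?d (T y) = hinner H2_sym ?d (S y)" using T adj[OF d y] d y by metis
      then have "hinner H2_sym (T y) ?d = hinner H2_sym (S y) ?d"
        using H.inner_commute[OF d TS(1)] H.inner_commute[OF d TS(2)] by metis
      moreover have "hinner H2_sym (T y) ?d = hinner H2_sym ?d ?d + hinner H2_sym (S y) ?d"
        using H.inner_add_left[OF d TS(2) d] by simp
      ultimately have "hinner H2_sym ?d ?d = 0" by simp
      then show "T y = S y" using H.inner_definite[OF d] by simp
    qed
  qed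
  then show ?thesis using S_anti[OF b] by simp
qed

lemma Y_op_sym_synth:
  assumes b: "b \<in> hcarrier l2"
  shows "Y_op (sym_synth b) = sym_synth (shift2 b)"
  using unitary_l2_in[OF unitary_sym_synth b] b
  by (simp add: Y_op_def U_op_sym_synth X_op_anti_synth adjoint_U_op)

lemma mult_op_sym_synth:
  assumes b: "b \<in> hcarrier l2"
  shows "mult_op H2_sym snd (sym_synth b) = sym_synth (shift1 b)"
proof -
  have "snd w * (\<Sum>\<^sub>\<infinity>p. b p * sym_mono p w) = (\<Sum>\<^sub>\<infinity>p. shift1 b p * sym_mono p w)" for w
  proof -
    have step: "sym_mono (case p of (i, j) \<Rightarrow> (Suc i, j)) w = snd w * sym_mono p w" for p
      by (cases p) (simp add: sym_mono_def)
    have "(\<Sum>\<^sub>\<infinity>p. shift1 b p * sym_mono p w)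
        = (\<Sum>\<^sub>\<infinity>p. b p * sym_mono (case p of (i, j) \<Rightarrow> (Suc i, j)) w)"
      unfolding shift1_def by (rule push_infsum[OF inj_shifts(1)]) simp
    also have "\<dots> = (\<Sum>\<^sub>\<infinity>p. snd w * (b p * sym_mono p w))"
      by (simp only: step mult_ac)
    also have "\<dots> = snd w * (\<Sum>\<^sub>\<infinity>p. b p * sym_mono p w)"
      by (rule infsum_cmult_right')
    finally show ?thesis ..
  qed
  moreover have "sym_synth b \<in> hcarrier H2_sym" by (rule unitary_l2_in[OF unitary_sym_synth b])
  ultimately show ?thesis
    by (auto simp: mult_op_def sym_synth_def cut_def fun_eq_iff)
qed

lemma shift_model_HM1: "shift_model H2_sym (mult_op H2_sym snd) Y_op sym_synth"
  by (simp add: shift_model_def unitary_sym_synth mult_op_sym_synth Y_op_sym_synth vector_space_fun_scale)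

subsection \<open>The subspace E\<close>

lemma push_comp:
  assumes "inj \<sigma>" "inj \<tau>"
  shows "push \<sigma> (push \<tau> a) = push (\<sigma> \<circ> \<tau>) a"
proof
  fix k
  have inj: "inj (\<sigma> \<circ> \<tau>)" using assms by (rule inj_compose)
  show "push \<sigma> (push \<tau> a) k = push (\<sigma> \<circ> \<tau>) a k"
  proof (cases "\<exists>i. k = \<sigma> (\<tau> i)")
    case True
    then obtain i where "k = \<sigma> (\<tau> i)" by blast
    then show ?thesis using push_apply[OF inj, of a i] by (simp add: assms)
  next
    case False
    then have "push (\<sigma> \<circ> \<tau>) a k = 0" by (intro push_outside) auto
    moreover have "push \<sigma> (push \<tau> a) k = 0"
    proof (cases "k \<in> range \<sigma>")
      case True
      then obtain j where j: "k = \<sigma> j" by blast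
      then have "j \<notin> range \<tau>" using False by blast
      then show ?thesis by (simp add: j assms push_outside)
    qed (rule push_outside)
    ultimately show ?thesis by simp
  qed
qed

text \<open>E consists of the antisymmetric functions whose coordinates live on i = 0, hence the
  embedding \<open>Pair 0\<close>.\<close>

definition E_synth :: "(nat \<Rightarrow> complex) \<Rightarrow> complex \<times> complex \<Rightarrow> complex" where
  "E_synth b = anti_synth (push (Pair 0) b)"

lemma inj_Pair0: "inj (Pair (0 :: nat))"
  by (simp add: inj_on_def)

lemma push0_l2: "push (Pair (0 :: nat)) b \<in> hcarrier l2 \<longleftrightarrow> b \<in> hcarrier l2"
  by (rule push_l2_iff[OF inj_Pair0])

lemma anti_synth_lin:
  "a \<in> hcarrier l2 \<Longrightarrow> b \<in> hcarrier l2 \<Longrightarrow> anti_synth (a + b) = anti_synth a + anti_synth b"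
  "a \<in> hcarrier l2 \<Longrightarrow> anti_synth (fun_scale c a) = fun_scale c (anti_synth a)"
  using unitary_anti_synth by (simp_all add: unitary_map_def hlinear_def)

lemma E_synth_lin:
  "a \<in> hcarrier l2 \<Longrightarrow> b \<in> hcarrier l2 \<Longrightarrow> E_synth (a + b) = E_synth a + E_synth b"
  "a \<in> hcarrier l2 \<Longrightarrow> E_synth (fun_scale c a) = fun_scale c (E_synth a)"
  by (simp_all add: E_synth_def push_add push_scale anti_synth_lin push0_l2)

lemma anti_synth_diff:
  assumes "a \<in> hcarrier l2" "b \<in> hcarrier l2"
  shows "anti_synth (a - b) = anti_synth a - anti_synth b"
  using anti_synth_lin(1)[OF l2_diff[OF assms] assms(2)] by simp

lemma E_space_simps [simp]:
  "hinner E_space = hinner H2_bidisc" "hnorm E_space = hnorm H2_bidisc"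
  by (simp_all add: E_space_def hnorm_def fun_eq_iff)

lemma E_synth_unit_seq: "E_synth (unit_seq j) = fun_scale (1 / sqrt 2) (anti_basis 0 (Suc j))"
  by (simp add: E_synth_def push_unit_seq inj_Pair0 anti_synth_unit_seq)

text \<open>Coordinates with positive first index vanish on the span and are continuous, so they
  vanish on its closure. Conversely, finite truncations lie in the span and approximate in
  norm.\<close>

lemma hcarrier_E_space: "hcarrier E_space = E_synth ` hcarrier l2"
proof -
  interpret V: vector_space "fun_scale :: complex \<Rightarrow> (complex \<times> complex \<Rightarrow> complex) \<Rightarrow> _"
    by (rule vector_space_fun_scale)
  let ?S = "{anti_basis 0 j | j. j \<ge> 1}"
  have car: "hcarrier E_space = {x \<in> hcarrier H2_anti. \<forall>e>0. \<exists>y\<in>V.span ?S. hnorm H2_bidisc (x - y) < e}"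
    by (simp add: E_space_def closed_span_def)
  have "V.subspace (E_synth ` hcarrier l2)"
    unfolding V.subspace_def
  proof (intro conjI ballI allI)
    show "0 \<in> E_synth ` hcarrier l2"
      using E_synth_lin(2)[OF l2_0, of 0] l2_0 by (intro image_eqI[of _ _ 0]) auto
    fix x assume "x \<in> E_synth ` hcarrier l2"
    then obtain a where a: "a \<in> hcarrier l2" "x = E_synth a" by blast
    show "fun_scale c x \<in> E_synth ` hcarrier l2" for c
      using a l2_scale by (auto simp flip: E_synth_lin)
    fix y assume "y \<in> E_synth ` hcarrier l2"
    then obtain b where b: "b \<in> hcarrier l2" "y = E_synth b" by blast
    show "x + y \<in> E_synth ` hcarrier l2"
      using a b l2_add by (auto simp flip: E_synth_lin)
  qed
  moreover have "?S \<subseteq> E_synth ` hcarrier l2"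
  proof
    fix x assume "x \<in> ?S"
    then obtain j where "x = anti_basis 0 (Suc j)" by (auto simp: Suc_le_eq gr0_conv_Suc)
    then have "x = E_synth (fun_scale (sqrt 2) (unit_seq j))"
      by (simp add: E_synth_lin unit_seq_l2 E_synth_unit_seq fun_eq_iff)
    then show "x \<in> E_synth ` hcarrier l2"
      by (simp only:) (rule imageI[OF l2_scale[OF unit_seq_l2]])
  qed
  ultimately have span: "V.span ?S \<subseteq> E_synth ` hcarrier l2" by (rule V.span_minimal[rotated])
  show ?thesis unfolding car
  proof (intro set_eqI iffI)
    fix x assume x: "x \<in> {x \<in> hcarrier H2_anti. \<forall>e>0. \<exists>y\<in>V.span ?S. hnorm H2_bidisc (x - y) < e}"
    then obtain c where c: "c \<in> hcarrier l2" "x = anti_synth c"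
      using unitary_l2_cases[OF unitary_anti_synth] by blast
    have "c (Suc i, j) = 0" for i j
    proof -
      have "cmod (c (Suc i, j)) \<le> e" if "e > 0" for e
      proof -
        obtain y where y: "y \<in> V.span ?S" "hnorm H2_bidisc (x - y) < e" using x \<open>e > 0\<close> by blast
        then obtain b where b: "b \<in> hcarrier l2" "y = E_synth b" using span by blast
        let ?d = "c - push (Pair 0) b"
        have d: "?d \<in> hcarrier l2" using c b by (intro l2_diff) (simp_all add: push0_l2)
        \<comment> \<open>The approximant has no coordinate off the row 0, so this coordinate of x
          equals that of x - y.\<close>
        have "(Suc i, j) \<notin> range (Pair 0)" by auto
        then have "c (Suc i, j) = ?d (Suc i, j)" by (simp add: push_outside)
        then have "cmod (c (Suc i, j)) \<le> hnorm l2 ?d" using l2_coord_le[OF d, of "(Suc i, j)"] by simp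
        also have "\<dots> = hnorm H2_bidisc (x - y)"
          using unitary_hnorm[OF unitary_anti_synth d] c b by (simp add: anti_synth_diff push0_l2 E_synth_def)
        finally show ?thesis using y(2) by simp
      qed
      note le = this
      have "cmod (c (Suc i, j)) \<le> 0"
      proof (rule field_le_epsilon)
        fix e :: real assume "e > 0"
        from le[OF this] show "cmod (c (Suc i, j)) \<le> 0 + e" by simp
      qed
      then show ?thesis by simp
    qed
    then have eq: "c = push (Pair 0) (\<lambda>j. c (0, j))"
    proof (intro ext)
      fix p :: "nat \<times> nat"
      assume 0: "\<And>i j. c (Suc i, j) = 0"
      obtain i j where p: "p = (i, j)" by (cases p)
      show "c p = push (Pair 0) (\<lambda>j. c (0, j)) p"
      proof (cases i)
        case 0
        then show ?thesis using push_apply[OF inj_Pair0, of "\<lambda>j. c (0, j)" j] p by simp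
      next
        case (Suc i')
        then have "p \<notin> range (Pair 0)" using p by auto
        then show ?thesis using 0 p Suc by (simp add: push_outside)
      qed
    qed
    then have c0: "(\<lambda>j. c (0, j)) \<in> hcarrier l2" using c(1) push0_l2 by metis
    have "x = E_synth (\<lambda>j. c (0, j))"
      unfolding E_synth_def c(2) by (rule arg_cong[OF eq])
    then show "x \<in> E_synth ` hcarrier l2" by (simp only:) (rule imageI[OF c0])
  next
    fix x assume "x \<in> E_synth ` hcarrier l2"
    then obtain b where b: "b \<in> hcarrier l2" "x = E_synth b" by blast
    have "\<exists>y\<in>V.span ?S. hnorm H2_bidisc (x - y) < e" if e: "e > 0" for e
    proof -
      obtain F where F: "finite F" "hnorm l2 (b - (\<lambda>i. if i \<in> F then b i else 0)) < e"
        using l2_approx[OF b(1) e] by blast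
      let ?t = "\<lambda>F i. if i \<in> F then b i else 0"
      have "E_synth (?t F) \<in> V.span ?S"
        using F(1)
      proof (induction F)
        case empty
        have "?t {} = 0" by (simp add: zero_fun_def)
        moreover have "E_synth 0 = 0" using E_synth_lin(2)[OF l2_0, of 0] by simp
        ultimately have "E_synth (?t {}) = 0" by (simp only:)
        then show ?case using V.span_zero by (simp only:)
      next
        case (insert j F)
        have "?t (insert j F) = ?t F + fun_scale (b j) (unit_seq j)"
          using insert.hyps by (auto simp: fun_eq_iff unit_seq_def)
        then have "E_synth (?t (insert j F)) = E_synth (?t F) + fun_scale (b j) (E_synth (unit_seq j))"
          by (simp only: E_synth_lin l2_trunc[OF b(1)] unit_seq_l2 l2_scale)
        moreover have "anti_basis 0 (Suc j) \<in> V.span ?S" by (intro V.span_base) auto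
        ultimately show ?case
          using insert.IH V.span_add V.span_scale by (simp only: E_synth_unit_seq)
      qed
      moreover have "hnorm H2_bidisc (x - E_synth (?t F)) < e"
      proof -
        have t: "?t F \<in> hcarrier l2" by (rule l2_trunc[OF b(1)])
        have d: "push (Pair (0::nat)) (b - ?t F) \<in> hcarrier l2" using l2_diff[OF b(1) t] by (simp add: push0_l2)
        have "b - ?t F = b + fun_scale (-1) (?t F)" by (auto simp: fun_eq_iff)
        then have "E_synth (b - ?t F) = E_synth b + fun_scale (-1) (E_synth (?t F))"
          by (simp only: E_synth_lin b(1) t l2_scale)
        also have "\<dots> = x - E_synth (?t F)" using b(2) by (auto simp: fun_eq_iff)
        finally have "hnorm H2_bidisc (x - E_synth (?t F)) = hnorm l2 (push (Pair (0::nat)) (b - ?t F))"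
          using unitary_hnorm[OF unitary_anti_synth d] by (simp add: E_synth_def)
        also have "\<dots> = hnorm l2 (b - ?t F)" by (rule hnorm_push[OF inj_Pair0 l2_diff[OF b(1) t]])
        finally show ?thesis using F(2) by simp
      qed
      ultimately show ?thesis by blast
    qed
    moreover have "x \<in> hcarrier H2_anti"
      unfolding b(2) E_synth_def by (rule unitary_l2_in[OF unitary_anti_synth]) (simp add: push0_l2 b)
    ultimately show "x \<in> {x \<in> hcarrier H2_anti. \<forall>e>0. \<exists>y\<in>V.span ?S. hnorm H2_bidisc (x - y) < e}" by blast
  qed
qed

lemma unitary_E_synth: "unitary_map l2 E_space E_synth"
  unfolding unitary_map_def hlinear_def bij_betw_def
proof (intro conjI ballI allI)
  show "inj_on E_synth (hcarrier l2)"
  proof (rule inj_onI)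
    fix a b assume ab: "a \<in> hcarrier l2" "b \<in> hcarrier l2" "E_synth a = E_synth b"
    have "inj_on anti_synth (hcarrier l2)"
      using unitary_anti_synth by (simp add: unitary_map_def bij_betw_def)
    then have "push (Pair (0::nat)) a = push (Pair 0) b"
      by (rule inj_onD) (use ab in \<open>simp_all add: push0_l2 E_synth_def\<close>)
    then show "a = b" by (metis ext push_apply[OF inj_Pair0])
  qed
  show "E_synth ` hcarrier l2 = hcarrier E_space" by (rule hcarrier_E_space[symmetric])
  fix a b :: "nat \<Rightarrow> complex" assume a: "a \<in> hcarrier l2"
  show "E_synth a \<in> hcarrier E_space" using a by (simp add: hcarrier_E_space)
  show "E_synth (hscale l2 c a) = hscale E_space c (E_synth a)" for c by (simp add: E_synth_lin a)
  assume b: "b \<in> hcarrier l2"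
  show "E_synth (a + b) = E_synth a + E_synth b" by (rule E_synth_lin(1)[OF a b])
  show "hinner E_space (E_synth a) (E_synth b) = hinner l2 a b"
    using unitary_anti_synth by (simp add: E_synth_def unitary_map_def push0_l2 a b hinner_push inj_Pair0)
qed

lemma X0_op_E_synth:
  assumes b: "b \<in> hcarrier l2"
  shows "X0_op (E_synth b) = E_synth (push Suc b)"
proof -
  have "shift2 (push (Pair (0::nat)) b) = push ((\<lambda>(i, j). (i, Suc j)) \<circ> Pair (0::nat)) b"
    unfolding shift2_def by (rule push_comp[OF inj_shifts(2) inj_Pair0])
  also have "(\<lambda>(i, j). (i, Suc j)) \<circ> Pair (0::nat) = Pair (0::nat) \<circ> Suc" by (simp add: fun_eq_iff)
  also have "push (Pair (0::nat) \<circ> Suc) b = push (Pair (0::nat)) (push Suc b)"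
    by (rule push_comp[symmetric]) (simp_all add: inj_Pair0)
  finally have "shift2 (push (Pair (0::nat)) b) = push (Pair (0::nat)) (push Suc b)" .
  then show ?thesis
    using b by (simp add: X0_op_def hcarrier_E_space) (simp add: E_synth_def X_op_anti_synth push0_l2)
qed

subsection \<open>Hilbert tensor products\<close>

definition tens :: "('i \<Rightarrow> complex) \<Rightarrow> ('k \<Rightarrow> complex) \<Rightarrow> 'i \<times> 'k \<Rightarrow> complex" where
  "tens a b = (\<lambda>(i, k). a i * b k)"

lemma tens_add:
  "tens (a + a') b = tens a b + tens a' b" "tens a (b + b') = tens a b + tens a b'"
  by (auto simp: tens_def fun_eq_iff algebra_simps)

lemma tens_scale:
  "tens (fun_scale c a) b = fun_scale c (tens a b)" "tens a (fun_scale c b) = fun_scale c (tens a b)"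
  by (auto simp: tens_def fun_eq_iff)

lemma tens_unit_seq: "tens (unit_seq i) (unit_seq k) = unit_seq (i, k)"
  by (auto simp: tens_def fun_eq_iff unit_seq_def)

lemma tens_l2:
  assumes "a \<in> hcarrier l2" "b \<in> hcarrier l2"
  shows "tens a b \<in> hcarrier l2"
  unfolding l2_iff
proof -
  have "(\<lambda>(i, k). (cmod (a i))\<^sup>2 * (cmod (b k))\<^sup>2) summable_on UNIV"
    using assms by (intro summable_on_times[of "\<lambda>i. (cmod (a i))\<^sup>2" "\<lambda>k. (cmod (b k))\<^sup>2"]) (auto simp: l2_iff)
  then show "(\<lambda>p. (cmod (tens a b p))\<^sup>2) summable_on UNIV"
    by (simp add: tens_def case_prod_unfold norm_mult power_mult_distrib)
qed

lemma hinner_tens: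
  assumes "a \<in> hcarrier l2" "b \<in> hcarrier l2" "a' \<in> hcarrier l2" "b' \<in> hcarrier l2"
  shows "hinner l2 (tens a b) (tens a' b') = hinner l2 a a' * hinner l2 b b'"
proof -
  have "(\<lambda>p. tens a b p * cnj (tens a' b' p)) summable_on UNIV"
    using assms by (intro l2_prod_summable tens_l2)
  then have s: "(\<lambda>(i, k). (a i * cnj (a' i)) * (b k * cnj (b' k))) summable_on UNIV \<times> UNIV"
    by (simp add: tens_def case_prod_unfold mult_ac)
  have "hinner l2 (tens a b) (tens a' b') = (\<Sum>\<^sub>\<infinity>(i, k). (a i * cnj (a' i)) * (b k * cnj (b' k)))"
    unfolding hinner_l2 by (rule infsum_cong) (auto simp: tens_def mult_ac)
  also have "\<dots> = (\<Sum>\<^sub>\<infinity>i. \<Sum>\<^sub>\<infinity>k. (a i * cnj (a' i)) * (b k * cnj (b' k)))"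
    using infsum_Sigma'_banach[OF s] by simp
  also have "\<dots> = hinner l2 a a' * hinner l2 b b'"
    by (simp only: infsum_cmult_right' infsum_cmult_left' hinner_l2)
  finally show ?thesis .
qed

lemma hinner_l2_right:
  assumes "a \<in> hcarrier l2" "b \<in> hcarrier l2" "c \<in> hcarrier l2"
  shows "hinner l2 a (b + c) = hinner l2 a b + hinner l2 a c"
    "hinner l2 a (fun_scale r b) = cnj r * hinner l2 a b"
  using assms
  by (simp_all add: hinner_l2 distrib_left infsum_add l2_prod_summable mult.left_commute infsum_cmult_right')

lemma hinner_l2_sum:
  assumes "\<And>t. t \<in> T \<Longrightarrow> v t \<in> hcarrier l2" "a \<in> hcarrier l2"
  shows "(\<Sum>t\<in>T. v t) \<in> hcarrier l2" "hinner l2 (\<Sum>t\<in>T. v t) a = (\<Sum>t\<in>T. hinner l2 (v t) a)"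
proof -
  have "(\<Sum>t\<in>T. v t) \<in> hcarrier l2 \<and> hinner l2 (\<Sum>t\<in>T. v t) a = (\<Sum>t\<in>T. hinner l2 (v t) a)"
    using assms(1)
  proof (induction T rule: infinite_finite_induct)
    case (insert t T)
    then have v: "v t \<in> hcarrier l2" "sum v T \<in> hcarrier l2"
      "hinner l2 (sum v T) a = (\<Sum>t\<in>T. hinner l2 (v t) a)" by auto
    then show ?case
      using l2_add[OF v(1,2)] l2.inner_add_left[OF v(1,2) assms(2)] by (simp only: sum.insert[OF insert.hyps])
  qed (simp_all add: l2_0, simp_all add: hinner_l2)
  then show "(\<Sum>t\<in>T. v t) \<in> hcarrier l2" "hinner l2 (\<Sum>t\<in>T. v t) a = (\<Sum>t\<in>T. hinner l2 (v t) a)" by auto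
qed

text \<open>\<open>hs_norm_sq\<close> ranges over arbitrary finite orthonormal sets, not only over
  coordinate vectors; Bessel's inequality bounds them all by one norm. It expresses that the squared
  distance from \<open>c\<close> to its projection \<open>w\<close> is nonnegative.\<close>

lemma bessel_l2:
  assumes c: "c \<in> hcarrier l2" and T: "finite T" and v: "\<And>t. t \<in> T \<Longrightarrow> v t \<in> hcarrier l2"
    and on: "\<And>s t. s \<in> T \<Longrightarrow> t \<in> T \<Longrightarrow> hinner l2 (v s) (v t) = (if s = t then 1 else 0)"
  shows "(\<Sum>t\<in>T. (cmod (hinner l2 c (v t)))\<^sup>2) \<le> (hnorm l2 c)\<^sup>2"
proof -
  define k where "k = (\<lambda>t. hinner l2 c (v t))"
  define w where "w = (\<Sum>t\<in>T. fun_scale (k t) (v t))"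
  have kv: "fun_scale (k t) (v t) \<in> hcarrier l2" if "t \<in> T" for t using v[OF that] by (rule l2_scale)
  have w: "w \<in> hcarrier l2" unfolding w_def by (rule hinner_l2_sum(1)[OF kv c])
  have d: "c - w \<in> hcarrier l2" by (rule l2_diff[OF c w])
  let ?S = "\<Sum>t\<in>T. (cmod (k t))\<^sup>2"
  have wc: "hinner l2 w x = (\<Sum>t\<in>T. k t * hinner l2 (v t) x)" if "x \<in> hcarrier l2" for x
  proof -
    have "hinner l2 w x = (\<Sum>t\<in>T. hinner l2 (fun_scale (k t) (v t)) x)"
      unfolding w_def by (rule hinner_l2_sum(2)[OF kv that])
    also have "\<dots> = (\<Sum>t\<in>T. k t * hinner l2 (v t) x)"
      by (rule sum.cong[OF refl]) (use l2.inner_scale_left[OF v that] in simp)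
    finally show ?thesis .
  qed
  have vw: "hinner l2 (v t) w = cnj (k t)" if t: "t \<in> T" for t
  proof -
    have "hinner l2 w (v t) = (\<Sum>s\<in>T. if s = t then k t else 0)"
      unfolding wc[OF v[OF t]] by (rule sum.cong) (use on t in auto)
    also have "\<dots> = k t" using T t by simp
    finally show ?thesis using l2.inner_commute[OF w v[OF t]] by simp
  qed
  have ww: "hinner l2 w w = of_real ?S"
    unfolding wc[OF w] of_real_sum by (intro sum.cong refl) (simp only: vw complex_norm_square)
  have wc': "hinner l2 w c = of_real ?S"
    unfolding wc[OF c] of_real_sum
  proof (intro sum.cong refl)
    fix t assume t: "t \<in> T"
    have "hinner l2 (v t) c = cnj (k t)" using l2.inner_commute[OF c v[OF t]] by (simp add: k_def)
    then show "k t * hinner l2 (v t) c = of_real ((cmod (k t))\<^sup>2)" by (simp only: complex_norm_square)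
  qed
  have cw: "hinner l2 c w = of_real ?S" using l2.inner_commute[OF w c] by (simp add: wc')
  have cc: "hinner l2 c c = of_real ((hnorm l2 c)\<^sup>2)" by (simp add: hinner_l2_self[OF c] hnorm_l2_sq[OF c])
  have left: "hinner l2 (c - w) x = hinner l2 c x - hinner l2 w x" if "x \<in> hcarrier l2" for x
    using l2.inner_add_left[OF d w that] by simp
  have "hinner l2 c (c - w) = cnj (hinner l2 (c - w) c)" "hinner l2 w (c - w) = cnj (hinner l2 (c - w) w)"
    by (rule l2.inner_commute[OF d c], rule l2.inner_commute[OF d w])
  then have "hinner l2 (c - w) (c - w) = of_real ((hnorm l2 c)\<^sup>2) - of_real ?S"
    unfolding left[OF d] left[OF c] left[OF w] by (simp only: cc wc' cw ww) simp
  also have "\<dots> = of_real ((hnorm l2 c)\<^sup>2 - ?S)" by simp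
  finally have "0 \<le> (hnorm l2 c)\<^sup>2 - ?S"
    using l2.inner_nonneg[OF d] by (simp only: Re_complex_of_real)
  then show ?thesis by (simp add: k_def)
qed

section \<open>Hilbert-Schmidt functionals as square-summable matrices\<close>

locale tensor_model =
  fixes H :: "('a::ab_group_add) hspace" and K :: "('b::ab_group_add) hspace"
    and \<Psi> :: "('i \<Rightarrow> complex) \<Rightarrow> 'a" and \<Phi> :: "('k \<Rightarrow> complex) \<Rightarrow> 'b"
  assumes \<Psi>: "unitary_map l2 H \<Psi>" and \<Phi>: "unitary_map l2 K \<Phi>"
begin

definition hcoord :: "'a \<Rightarrow> 'i \<Rightarrow> complex" where
  "hcoord = inv_into (hcarrier l2) \<Psi>"

definition kcoord :: "'b \<Rightarrow> 'k \<Rightarrow> complex" where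
  "kcoord = inv_into (hcarrier l2) \<Phi>"

lemma coord [simp]: "a \<in> hcarrier l2 \<Longrightarrow> hcoord (\<Psi> a) = a" "b \<in> hcarrier l2 \<Longrightarrow> kcoord (\<Phi> b) = b"
proof -
  have "bij_betw \<Psi> (hcarrier l2) (hcarrier H)" "bij_betw \<Phi> (hcarrier l2) (hcarrier K)"
    using \<Psi> \<Phi> by (simp_all add: unitary_map_def)
  note this[THEN bij_betw_inv_into_left]
  then show "a \<in> hcarrier l2 \<Longrightarrow> hcoord (\<Psi> a) = a" "b \<in> hcarrier l2 \<Longrightarrow> kcoord (\<Phi> b) = b"
    by (simp_all add: hcoord_def kcoord_def)
qed

lemma in_carrier [simp]: "a \<in> hcarrier l2 \<Longrightarrow> \<Psi> a \<in> hcarrier H" "b \<in> hcarrier l2 \<Longrightarrow> \<Phi> b \<in> hcarrier K"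
  using unitary_l2_in[OF \<Psi>] unitary_l2_in[OF \<Phi>] by auto

lemma H_cases:
  assumes "x \<in> hcarrier H" obtains a where "a \<in> hcarrier l2" "x = \<Psi> a"
  using unitary_l2_cases[OF \<Psi> assms] by blast

lemma K_cases:
  assumes "y \<in> hcarrier K" obtains b where "b \<in> hcarrier l2" "y = \<Phi> b"
  using unitary_l2_cases[OF \<Phi> assms] by blast

lemma lin:
  "a \<in> hcarrier l2 \<Longrightarrow> a' \<in> hcarrier l2 \<Longrightarrow> \<Psi> a + \<Psi> a' = \<Psi> (a + a')"
  "b \<in> hcarrier l2 \<Longrightarrow> b' \<in> hcarrier l2 \<Longrightarrow> \<Phi> b + \<Phi> b' = \<Phi> (b + b')"
  "a \<in> hcarrier l2 \<Longrightarrow> hscale H c (\<Psi> a) = \<Psi> (fun_scale c a)"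
  "b \<in> hcarrier l2 \<Longrightarrow> hscale K c (\<Phi> b) = \<Phi> (fun_scale c b)"
  using \<Psi> \<Phi> by (simp_all add: unitary_map_def hlinear_def)

lemma inner:
  "a \<in> hcarrier l2 \<Longrightarrow> a' \<in> hcarrier l2 \<Longrightarrow> hinner H (\<Psi> a) (\<Psi> a') = hinner l2 a a'"
  "b \<in> hcarrier l2 \<Longrightarrow> b' \<in> hcarrier l2 \<Longrightarrow> hinner K (\<Phi> b) (\<Phi> b') = hinner l2 b b'"
  using \<Psi> \<Phi> by (simp_all add: unitary_map_def)

text \<open>The functional that sends (x, y) to the inner product of \<open>c\<close> with the
  tensor of their coordinates. Placing the arguments in the second slot makes it conjugate-linear in
  each.\<close>

definition tensor_synth :: "('i \<times> 'k \<Rightarrow> complex) \<Rightarrow> 'a \<times> 'b \<Rightarrow> complex" where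
  "tensor_synth c = (\<lambda>(x, y). if x \<in> hcarrier H \<and> y \<in> hcarrier K
     then hinner l2 c (tens (hcoord x) (kcoord y)) else 0)"

lemma tensor_synth_coord:
  "a \<in> hcarrier l2 \<Longrightarrow> b \<in> hcarrier l2 \<Longrightarrow> tensor_synth c (\<Psi> a, \<Phi> b) = hinner l2 c (tens a b)"
  by (simp add: tensor_synth_def)

text \<open>Tensors of two orthonormal sets form an orthonormal set, so each sum in the supremum is
  a Bessel sum for \<open>c\<close>.\<close>

lemma hs_norm_tensor_synth_le:
  assumes c: "c \<in> hcarrier l2"
  shows "hs_norm_sq H K (tensor_synth c) \<le> ennreal ((hnorm l2 c)\<^sup>2)"
  unfolding hs_norm_sq_def
proof (rule SUP_least, clarify)
  fix A B assume A: "finite A" "orthonormal H A" and B: "finite B" "orthonormal K B"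
  let ?v = "\<lambda>p. tens (hcoord (fst p)) (kcoord (snd p))"
  have Ax: "hcoord x \<in> hcarrier l2 \<and> \<Psi> (hcoord x) = x" if "x \<in> A" for x
  proof -
    have "x \<in> hcarrier H" using A that by (auto simp: orthonormal_def)
    then show ?thesis by (elim H_cases) simp
  qed
  have By: "kcoord y \<in> hcarrier l2 \<and> \<Phi> (kcoord y) = y" if "y \<in> B" for y
  proof -
    have "y \<in> hcarrier K" using B that by (auto simp: orthonormal_def)
    then show ?thesis by (elim K_cases) simp
  qed
  have Aon: "hinner l2 (hcoord x) (hcoord x') = (if x = x' then 1 else 0)" if "x \<in> A" "x' \<in> A" for x x'
    using inner(1)[of "hcoord x" "hcoord x'"] Ax that A(2) by (simp add: orthonormal_def)
  have Bon: "hinner l2 (kcoord y) (kcoord y') = (if y = y' then 1 else 0)" if "y \<in> B" "y' \<in> B" for y y'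
    using inner(2)[of "kcoord y" "kcoord y'"] By that B(2) by (simp add: orthonormal_def)
  have "(\<Sum>p\<in>A \<times> B. ennreal ((cmod (tensor_synth c p))\<^sup>2)) = ennreal (\<Sum>p\<in>A \<times> B. (cmod (hinner l2 c (?v p)))\<^sup>2)"
    using Ax By by (subst sum_ennreal[symmetric], simp, intro sum.cong refl)
      (auto simp: tensor_synth_def intro!: arg_cong[where f = "\<lambda>z. ennreal ((cmod z)\<^sup>2)"], (metis in_carrier)+)
  also have "\<dots> \<le> ennreal ((hnorm l2 c)\<^sup>2)"
  proof (intro ennreal_leI bessel_l2[OF c])
    show "finite (A \<times> B)" using A B by simp
    show "?v p \<in> hcarrier l2" if "p \<in> A \<times> B" for p using that Ax By by (intro tens_l2) auto
    show "hinner l2 (?v p) (?v q) = (if p = q then 1 else 0)" if "p \<in> A \<times> B" "q \<in> A \<times> B" for p q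
      using that Ax By by (cases p; cases q) (auto simp: hinner_tens Aon Bon)
  qed
  finally show "(\<Sum>p\<in>A \<times> B. ennreal ((cmod (tensor_synth c p))\<^sup>2)) \<le> ennreal ((hnorm l2 c)\<^sup>2)" .
qed

text \<open>The reverse estimate tests on coordinate vectors only. The supremum runs over products
  of orthonormal sets, so a finite index set is enlarged to the rectangle spanned by its
  projections.\<close>

lemma hs_norm_ge:
  assumes "finite F"
  shows "ennreal (\<Sum>p\<in>F. (cmod (\<phi> (\<Psi> (unit_seq (fst p)), \<Phi> (unit_seq (snd p)))))\<^sup>2) \<le> hs_norm_sq H K \<phi>"
proof -
  let ?A = "(\<lambda>i. \<Psi> (unit_seq i)) ` fst ` F" and ?B = "(\<lambda>k. \<Phi> (unit_seq k)) ` snd ` F"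
  let ?m = "\<lambda>p. (\<Psi> (unit_seq (fst p)), \<Phi> (unit_seq (snd p)))"
  have unit_eq: "unit_seq i = unit_seq j \<longleftrightarrow> i = j" for i j :: 'z
    by (auto simp: unit_seq_def fun_eq_iff split: if_splits)
  have unit_inner: "hinner l2 (unit_seq i) (unit_seq j) = (if i = j then 1 else 0)" for i j :: 'z
    by (simp add: hinner_unit_seq) (simp add: unit_seq_def)
  have \<Psi>_eq: "\<Psi> (unit_seq i) = \<Psi> (unit_seq j) \<longleftrightarrow> i = j" for i j
    using coord(1)[OF unit_seq_l2[of i]] coord(1)[OF unit_seq_l2[of j]] by (metis unit_inner one_neq_zero)
  have \<Phi>_eq: "\<Phi> (unit_seq i) = \<Phi> (unit_seq j) \<longleftrightarrow> i = j" for i j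
    using coord(2)[OF unit_seq_l2[of i]] coord(2)[OF unit_seq_l2[of j]] by (metis unit_inner one_neq_zero)
  have A: "orthonormal H ?A" "finite ?A"
    using assms by (auto simp: orthonormal_def inner unit_seq_l2 unit_inner \<Psi>_eq)
  have B: "orthonormal K ?B" "finite ?B"
    using assms by (auto simp: orthonormal_def inner unit_seq_l2 unit_inner \<Phi>_eq)
  have "ennreal (\<Sum>p\<in>F. (cmod (\<phi> (?m p)))\<^sup>2) = (\<Sum>p\<in>F. ennreal ((cmod (\<phi> (?m p)))\<^sup>2))"
    by (simp add: sum_ennreal)
  also have "\<dots> = (\<Sum>q\<in>?m ` F. ennreal ((cmod (\<phi> q))\<^sup>2))"
    by (subst sum.reindex) (auto simp: inj_on_def \<Psi>_eq \<Phi>_eq)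
  also have "\<dots> \<le> (\<Sum>q\<in>?A \<times> ?B. ennreal ((cmod (\<phi> q))\<^sup>2))"
    using A(2) B(2) by (intro sum_mono2) auto
  also have "\<dots> \<le> hs_norm_sq H K \<phi>"
    unfolding hs_norm_sq_def using A B by (intro SUP_upper2[of "(?A, ?B)"]) auto
  finally show ?thesis .
qed

lemma hs_functional_coeffs:
  assumes fin: "hs_norm_sq H K \<phi> < \<infinity>"
  defines "c \<equiv> \<lambda>p. \<phi> (\<Psi> (unit_seq (fst p)), \<Phi> (unit_seq (snd p)))"
  shows "c \<in> hcarrier l2" "ennreal ((hnorm l2 c)\<^sup>2) \<le> hs_norm_sq H K \<phi>"
proof -
  obtain h where h: "0 \<le> h" "hs_norm_sq H K \<phi> = ennreal h"
    using fin by (cases "hs_norm_sq H K \<phi>") auto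
  have "(\<Sum>p\<in>F. (cmod (c p))\<^sup>2) \<le> (sqrt h)\<^sup>2" if "finite F" for F
    using hs_norm_ge[OF that, of \<phi>] h by (simp add: c_def)
  from l2I[OF this] have c: "c \<in> hcarrier l2" "hnorm l2 c \<le> sqrt h" using h by auto
  show "c \<in> hcarrier l2" by (rule c)
  have "(hnorm l2 c)\<^sup>2 \<le> (sqrt h)\<^sup>2" using c hnorm_l2_nonneg by (intro power_mono) auto
  then show "ennreal ((hnorm l2 c)\<^sup>2) \<le> hs_norm_sq H K \<phi>" using h by (simp add: ennreal_leI)
qed

lemma tensor_synth_unit_seq:
  "tensor_synth c (\<Psi> (unit_seq i), \<Phi> (unit_seq k)) = c (i, k)"
  by (simp add: tensor_synth_coord unit_seq_l2 tens_unit_seq hinner_unit_seq)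

lemma hs_norm_tensor_synth:
  assumes c: "c \<in> hcarrier l2"
  shows "hs_norm_sq H K (tensor_synth c) = ennreal ((hnorm l2 c)\<^sup>2)"
proof (rule antisym[OF hs_norm_tensor_synth_le[OF c]])
  have "hs_norm_sq H K (tensor_synth c) < \<infinity>"
    using hs_norm_tensor_synth_le[OF c] by (rule le_less_trans) simp
  from hs_functional_coeffs(2)[OF this]
  show "ennreal ((hnorm l2 c)\<^sup>2) \<le> hs_norm_sq H K (tensor_synth c)"
    by (simp add: tensor_synth_unit_seq)
qed

lemma hs_functional_iff:
  "\<phi> \<in> hs_functionals H K \<longleftrightarrow>
    (\<forall>p. p \<notin> hcarrier H \<times> hcarrier K \<longrightarrow> \<phi> p = 0) \<and>
    (\<forall>a\<in>hcarrier l2. \<forall>a'\<in>hcarrier l2. \<forall>b\<in>hcarrier l2. \<phi> (\<Psi> (a + a'), \<Phi> b) = \<phi> (\<Psi> a, \<Phi> b) + \<phi> (\<Psi> a', \<Phi> b)) \<and>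
    (\<forall>a\<in>hcarrier l2. \<forall>b\<in>hcarrier l2. \<forall>b'\<in>hcarrier l2. \<phi> (\<Psi> a, \<Phi> (b + b')) = \<phi> (\<Psi> a, \<Phi> b) + \<phi> (\<Psi> a, \<Phi> b')) \<and>
    (\<forall>c. \<forall>a\<in>hcarrier l2. \<forall>b\<in>hcarrier l2. \<phi> (\<Psi> (fun_scale c a), \<Phi> b) = cnj c * \<phi> (\<Psi> a, \<Phi> b) \<and>
      \<phi> (\<Psi> a, \<Phi> (fun_scale c b)) = cnj c * \<phi> (\<Psi> a, \<Phi> b)) \<and>
    hs_norm_sq H K \<phi> < \<infinity>"
proof -
  have car: "hcarrier H = \<Psi> ` hcarrier l2" "hcarrier K = \<Phi> ` hcarrier l2"
    using \<Psi> \<Phi> by (auto simp: unitary_map_def bij_betw_def)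
  show ?thesis unfolding hs_functionals_def by (simp add: car lin cong: ball_cong)
qed

lemma tensor_synth_in:
  assumes c: "c \<in> hcarrier l2"
  shows "tensor_synth c \<in> hs_functionals H K"
  unfolding hs_functional_iff hs_norm_tensor_synth[OF c]
  using c
  by (simp add: tensor_synth_coord l2_add l2_scale tens_add tens_scale hinner_l2_right tens_l2)
    (auto simp: tensor_synth_def)

text \<open>One-element orthonormal sets already show that a finite Hilbert-Schmidt norm bounds the
  functional on pairs of unit vectors; homogeneity extends the bound to all pairs.\<close>

lemma hs_functional_bounded:
  assumes \<phi>: "\<phi> \<in> hs_functionals H K"
  obtains C where "\<And>a b. a \<in> hcarrier l2 \<Longrightarrow> b \<in> hcarrier l2 \<Longrightarrow>
    cmod (\<phi> (\<Psi> a, \<Phi> b)) \<le> C * hnorm l2 a * hnorm l2 b"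
proof -
  note \<phi>' = \<phi>[unfolded hs_functional_iff]
  obtain h where h: "0 \<le> h" "hs_norm_sq H K \<phi> = ennreal h"
    using \<phi>' by (cases "hs_norm_sq H K \<phi>") auto
  have scale: "\<phi> (\<Psi> (fun_scale r a), \<Phi> (fun_scale s b)) = cnj r * (cnj s * \<phi> (\<Psi> a, \<Phi> b))"
    if "a \<in> hcarrier l2" "b \<in> hcarrier l2" for r s a b
    using \<phi>' that l2_scale[OF that(2)] by simp
  have unit: "cmod (\<phi> (\<Psi> a, \<Phi> b)) \<le> sqrt h"
    if ab: "a \<in> hcarrier l2" "b \<in> hcarrier l2" "hnorm l2 a = 1" "hnorm l2 b = 1" for a b
  proof -
    have "hinner l2 a a = 1" "hinner l2 b b = 1"
      using ab hnorm_l2_sq[of a] hnorm_l2_sq[of b] by (simp_all add: hinner_l2_self)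
    then have "orthonormal H {\<Psi> a}" "orthonormal K {\<Phi> b}"
      using ab by (simp_all add: orthonormal_def inner)
    then have "ennreal ((cmod (\<phi> (\<Psi> a, \<Phi> b)))\<^sup>2) \<le> hs_norm_sq H K \<phi>"
      unfolding hs_norm_sq_def by (intro SUP_upper2[of "({\<Psi> a}, {\<Phi> b})"]) auto
    then have "(cmod (\<phi> (\<Psi> a, \<Phi> b)))\<^sup>2 \<le> h" using h by simp
    then show ?thesis by (rule real_le_rsqrt)
  qed
  have normalize: "\<exists>a'. a' \<in> hcarrier l2 \<and> hnorm l2 a' = 1 \<and> a = fun_scale (hnorm l2 a) a'"
    if a: "a \<in> hcarrier l2" and "a \<noteq> 0" for a :: "'z \<Rightarrow> complex"
  proof -
    have pos: "hnorm l2 a > 0"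
    proof (rule ccontr)
      assume "\<not> hnorm l2 a > 0"
      then have "cmod (a i) \<le> 0" for i using l2_coord_le[OF a, of i] by linarith
      then show False using \<open>a \<noteq> 0\<close> by (auto simp: fun_eq_iff)
    qed
    let ?a = "fun_scale (1 / hnorm l2 a) a"
    have in_l2: "?a \<in> hcarrier l2" by (rule l2_scale[OF a])
    have "(hnorm l2 ?a)\<^sup>2 = (1 / hnorm l2 a)\<^sup>2 * (hnorm l2 a)\<^sup>2"
      unfolding hnorm_l2_sq[OF in_l2] hnorm_l2_sq[OF a, unfolded power2_eq_square[of "hnorm l2 a"]]
      using pos by (simp add: norm_mult power_mult_distrib norm_divide infsum_cmult_right' hnorm_l2_sq[OF a] del: times_divide_eq_left)
    then have "(hnorm l2 ?a)\<^sup>2 = 1\<^sup>2" using pos by (simp add: power_divide)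
    then have "hnorm l2 ?a = 1" using hnorm_l2_nonneg[OF in_l2] by (simp add: power2_eq_1_iff)
    moreover have "a = fun_scale (hnorm l2 a) ?a" using pos by (simp add: fun_eq_iff)
    ultimately show ?thesis using in_l2 by blast
  qed
  have "cmod (\<phi> (\<Psi> a, \<Phi> b)) \<le> sqrt h * hnorm l2 a * hnorm l2 b" if ab: "a \<in> hcarrier l2" "b \<in> hcarrier l2" for a b
  proof (cases "a = 0 \<or> b = 0")
    \<comment> \<open>A zero vector cannot be normalized; here the functional vanishes by
      homogeneity with the scalar 0.\<close>
    case True
    then have "\<phi> (\<Psi> a, \<Phi> b) = 0"
      using scale[OF ab, of 0 1] scale[OF ab, of 1 0] by auto
    then show ?thesis using h hnorm_l2_nonneg[OF ab(1)] hnorm_l2_nonneg[OF ab(2)] by simp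
  next
    case False
    then obtain a' b' where a': "a' \<in> hcarrier l2" "hnorm l2 a' = 1" "a = fun_scale (hnorm l2 a) a'"
      and b': "b' \<in> hcarrier l2" "hnorm l2 b' = 1" "b = fun_scale (hnorm l2 b) b'"
      using normalize[OF ab(1)] normalize[OF ab(2)] by blast
    have "\<phi> (\<Psi> a, \<Phi> b) = of_real (hnorm l2 a) * (of_real (hnorm l2 b) * \<phi> (\<Psi> a', \<Phi> b'))"
      using scale[OF a'(1) b'(1), of "hnorm l2 a" "hnorm l2 b"] unfolding a'(3)[symmetric] b'(3)[symmetric] by simp
    then have "cmod (\<phi> (\<Psi> a, \<Phi> b)) = hnorm l2 a * hnorm l2 b * cmod (\<phi> (\<Psi> a', \<Phi> b'))"
      using hnorm_l2_nonneg[OF ab(1)] hnorm_l2_nonneg[OF ab(2)] by (simp add: norm_mult)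
    also have "\<dots> \<le> hnorm l2 a * hnorm l2 b * sqrt h"
      using unit[OF a'(1) b'(1) a'(2) b'(2)] hnorm_l2_nonneg[OF ab(1)] hnorm_l2_nonneg[OF ab(2)] by (intro mult_left_mono) auto
    finally show ?thesis by (simp add: mult_ac)
  qed
  then show ?thesis using that by blast
qed

text \<open>The functional and the one built from its matrix agree on pairs of coordinate vectors,
  and both are bounded. Density is used in the first argument against a fixed coordinate vector,
  then in the second argument.\<close>

lemma tensor_synth_onto:
  assumes \<phi>: "\<phi> \<in> hs_functionals H K"
  shows "\<exists>c\<in>hcarrier l2. tensor_synth c = \<phi>"
proof -
  note \<phi>' = \<phi>[unfolded hs_functional_iff]
  define c where "c = (\<lambda>p. \<phi> (\<Psi> (unit_seq (fst p)), \<Phi> (unit_seq (snd p))))"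
  have c: "c \<in> hcarrier l2" using hs_functional_coeffs(1)[of \<phi>] \<phi>' by (simp add: c_def)
  note t' = tensor_synth_in[OF c, unfolded hs_functional_iff]
  obtain C where C: "\<And>a b. a \<in> hcarrier l2 \<Longrightarrow> b \<in> hcarrier l2 \<Longrightarrow>
    cmod (\<phi> (\<Psi> a, \<Phi> b)) \<le> C * hnorm l2 a * hnorm l2 b" using hs_functional_bounded[OF \<phi>] by blast
  obtain C' where C': "\<And>a b. a \<in> hcarrier l2 \<Longrightarrow> b \<in> hcarrier l2 \<Longrightarrow>
    cmod (tensor_synth c (\<Psi> a, \<Phi> b)) \<le> C' * hnorm l2 a * hnorm l2 b"
    using hs_functional_bounded[OF tensor_synth_in[OF c]] by blast
  define D where "D = (\<lambda>a b. \<phi> (\<Psi> a, \<Phi> b) - tensor_synth c (\<Psi> a, \<Phi> b))"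
  have D_add: "D (a + a') b = D a b + D a' b" "D b'' (b + b') = D b'' b + D b'' b'"
    if "a \<in> hcarrier l2" "a' \<in> hcarrier l2" "b \<in> hcarrier l2" "b' \<in> hcarrier l2" "b'' \<in> hcarrier l2"
    for a a' b b' b'' using \<phi>' t' that by (simp_all add: D_def)
  have D_scale: "D (fun_scale r a) b = cnj r * D a b" "D a (fun_scale r b) = cnj r * D a b"
    if "a \<in> hcarrier l2" "b \<in> hcarrier l2" for a b r
    using \<phi>' t' that by (simp_all add: D_def right_diff_distrib)
  have D_le: "cmod (D a b) \<le> (C + C') * hnorm l2 a * hnorm l2 b"
    if "a \<in> hcarrier l2" "b \<in> hcarrier l2" for a b
    using C[OF that] C'[OF that] norm_triangle_ineq4[of "\<phi> (\<Psi> a, \<Phi> b)" "tensor_synth c (\<Psi> a, \<Phi> b)"]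
    by (simp add: D_def distrib_right)
  have D_unit: "D (unit_seq i) (unit_seq k) = 0" for i k
    by (simp add: D_def tensor_synth_unit_seq c_def)
  have D1: "D a (unit_seq k) = 0" if "a \<in> hcarrier l2" for a k
  proof (rule l2_dense[OF _ _ _ that])
    show "D (x + y) (unit_seq k) = D x (unit_seq k) + D y (unit_seq k)"
      if "x \<in> hcarrier l2" "y \<in> hcarrier l2" for x y
      using D_add(1)[OF that unit_seq_l2 unit_seq_l2 l2_0] .
    show "cmod (D x (unit_seq k)) \<le> ((C + C') * hnorm l2 (unit_seq k)) * hnorm l2 x"
      if "x \<in> hcarrier l2" for x
      using D_le[OF that unit_seq_l2[of k]] by (simp add: mult_ac)
    show "D (fun_scale r (unit_seq i)) (unit_seq k) = 0" for r i
      by (simp add: D_scale unit_seq_l2 D_unit)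
  qed
  have D0: "D a b = 0" if a: "a \<in> hcarrier l2" and b: "b \<in> hcarrier l2" for a b
  proof (rule l2_dense[OF _ _ _ b])
    show "D a (x + y) = D a x + D a y" if "x \<in> hcarrier l2" "y \<in> hcarrier l2" for x y
      using D_add(2)[OF a a that a] .
    show "cmod (D a x) \<le> ((C + C') * hnorm l2 a) * hnorm l2 x" if "x \<in> hcarrier l2" for x
      using D_le[OF a that] .
    show "D a (fun_scale r (unit_seq k)) = 0" for r k
      by (simp add: D_scale unit_seq_l2 a D1)
  qed
  have "tensor_synth c p = \<phi> p" for p
  proof (cases "p \<in> hcarrier H \<times> hcarrier K")
    case True
    then obtain a b where "p = (\<Psi> a, \<Phi> b)" "a \<in> hcarrier l2" "b \<in> hcarrier l2"
      by (elim SigmaE H_cases K_cases) auto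
    then show ?thesis using D0[of a b] by (simp add: D_def)
  next
    case False
    then have "\<phi> p = 0" "tensor_synth c p = 0"
      using \<phi>'[THEN conjunct1] t'[THEN conjunct1] by blast+
    then show ?thesis by simp
  qed
  then have "tensor_synth c = \<phi>" by (rule ext)
  then show ?thesis using c by blast
qed

lemma unitary_tensor_synth: "unitary_map l2 (htensor H K) tensor_synth"
  unfolding htensor_def
proof (rule unitary_l2_hspace_of_norm)
  show "sqrt (enn2real (hs_norm_sq H K (tensor_synth c))) = hnorm l2 c" if "c \<in> hcarrier l2" for c
    using that by (simp add: hs_norm_tensor_synth hnorm_l2_nonneg)
  show "tensor_synth c \<in> hs_functionals H K" if "c \<in> hcarrier l2" for c
    using that by (rule tensor_synth_in)
  show "\<exists>c\<in>hcarrier l2. tensor_synth c = \<phi>" if "\<phi> \<in> hs_functionals H K" for \<phi>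
    using that by (rule tensor_synth_onto)
  have coords: "hcoord x \<in> hcarrier l2" "kcoord y \<in> hcarrier l2" if "x \<in> hcarrier H" "y \<in> hcarrier K" for x y
    using that by (auto elim!: H_cases K_cases)
  show "tensor_synth (c + d) = tensor_synth c + tensor_synth d" if "c \<in> hcarrier l2" "d \<in> hcarrier l2" for c d
    using that by (auto simp: tensor_synth_def fun_eq_iff l2.inner_add_left coords tens_l2)
  show "tensor_synth (fun_scale r c) = fun_scale r (tensor_synth c)" if "c \<in> hcarrier l2" for r c
    using l2.inner_scale_left[OF that] by (auto simp: tensor_synth_def fun_eq_iff coords tens_l2)
qed

lemma elem_tensor_eq:
  assumes "a \<in> hcarrier l2" "b \<in> hcarrier l2"
  shows "elem_tensor H K (\<Psi> a) (\<Phi> b) = tensor_synth (tens a b)"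
proof
  fix p
  show "elem_tensor H K (\<Psi> a) (\<Phi> b) p = tensor_synth (tens a b) p"
  proof (cases "p \<in> hcarrier H \<times> hcarrier K")
    case True
    then obtain a' b' where "p = (\<Psi> a', \<Phi> b')" "a' \<in> hcarrier l2" "b' \<in> hcarrier l2"
      by (elim SigmaE H_cases K_cases) auto
    then show ?thesis using assms by (simp add: elem_tensor_def tensor_synth_coord hinner_tens inner)
  qed (cases p, auto simp: elem_tensor_def tensor_synth_def)
qed

text \<open>Pushing along \<open>map_prod\<close> sends elementary tensors to elementary tensors,
  which gives existence. The coordinate vectors of the tensor product are themselves elementary
  tensors, which gives uniqueness.\<close>

lemma tensor_op_push:
  assumes \<sigma>: "inj \<sigma>" and \<tau>: "inj \<tau>"
    and A: "\<And>a. a \<in> hcarrier l2 \<Longrightarrow> A (\<Psi> a) = \<Psi> (push \<sigma> a)"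
    and B: "\<And>b. b \<in> hcarrier l2 \<Longrightarrow> B (\<Phi> b) = \<Phi> (push \<tau> b)"
    and c: "c \<in> hcarrier l2"
  shows "tensor_op H K A B (tensor_synth c) = tensor_synth (push (map_prod \<sigma> \<tau>) c)"
proof -
  have inj: "inj (map_prod \<sigma> \<tau>)" by (rule prod.inj_map[OF \<sigma> \<tau>])
  have push_tens: "push (map_prod \<sigma> \<tau>) (tens a b) = tens (push \<sigma> a) (push \<tau> b)" for a b
  proof
    fix p :: "'i \<times> 'k"
    obtain i k where p: "p = (i, k)" by (cases p)
    show "push (map_prod \<sigma> \<tau>) (tens a b) p = tens (push \<sigma> a) (push \<tau> b) p"
    proof (cases "i \<in> range \<sigma> \<and> k \<in> range \<tau>")
      case True
      then obtain i' k' where "i = \<sigma> i'" "k = \<tau> k'" by blast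
      then show ?thesis using push_apply[OF inj, of "tens a b" "(i', k')"] by (simp add: p tens_def \<sigma> \<tau>)
    next
      case False
      then have "p \<notin> range (map_prod \<sigma> \<tau>)" by (auto simp: p)
      then show ?thesis using False by (auto simp: p tens_def push_outside)
    qed
  qed
  obtain S where S: "S \<in> bounded_ops (htensor H K) (htensor H K)"
    "\<And>c. c \<in> hcarrier l2 \<Longrightarrow> S (tensor_synth c) = tensor_synth (push (map_prod \<sigma> \<tau>) c)"
    using push_operator[OF unitary_tensor_synth inj] by blast
  have elem: "S (elem_tensor H K x y) = elem_tensor H K (A x) (B y)" if x: "x \<in> hcarrier H" and y: "y \<in> hcarrier K" for x y
  proof -
    obtain a where "a \<in> hcarrier l2" "x = \<Psi> a" using H_cases[OF x] .
    moreover obtain b where "b \<in> hcarrier l2" "y = \<Phi> b" using K_cases[OF y] .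
    ultimately show ?thesis
      using \<sigma> \<tau> by (simp add: A B elem_tensor_eq S tens_l2 push_tens push_l2_iff)
  qed
  have "tensor_op H K A B = S"
    unfolding tensor_op_def
  proof (rule the_equality)
    show "S \<in> bounded_ops (htensor H K) (htensor H K) \<and>
      (\<forall>a\<in>hcarrier H. \<forall>b\<in>hcarrier K. S (elem_tensor H K a b) = elem_tensor H K (A a) (B b))"
      using S(1) elem by blast
    fix T assume T: "T \<in> bounded_ops (htensor H K) (htensor H K) \<and>
      (\<forall>a\<in>hcarrier H. \<forall>b\<in>hcarrier K. T (elem_tensor H K a b) = elem_tensor H K (A a) (B b))"
    show "T = S"
    proof (rule bounded_ops_eqI[OF unitary_tensor_synth unitary_tensor_synth conjunct1[OF T] S(1)])
      fix p :: "'i \<times> 'k"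
      have "tensor_synth (unit_seq p) = elem_tensor H K (\<Psi> (unit_seq (fst p))) (\<Phi> (unit_seq (snd p)))"
        by (simp add: elem_tensor_eq unit_seq_l2 tens_unit_seq)
      then show "T (tensor_synth (unit_seq p)) = S (tensor_synth (unit_seq p))"
        using T elem by (simp add: unit_seq_l2)
    qed
  qed
  then show ?thesis using S(2)[OF c] by simp
qed

end

interpretation HM3: tensor_model H2_disc E_space disc_synth E_synth
  by (rule tensor_model.intro[OF unitary_disc_synth unitary_E_synth])

text \<open>Lets an identity factor count as a push, so that \<open>tensor_op_push\<close> also
  covers operators acting on one factor only.\<close>

lemma push_id: "push (\<lambda>i. i) a = a"
  using push_apply[of "\<lambda>i. i" a] by (auto simp: fun_eq_iff)

lemma shift_model_HM3:
  "shift_model (htensor H2_disc E_space)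
     (tensor_op H2_disc E_space (mult_op H2_disc (\<lambda>z. z)) (\<lambda>h. h))
     (tensor_op H2_disc E_space (\<lambda>h. h) X0_op) HM3.tensor_synth"
proof -
  have maps: "map_prod Suc (\<lambda>j. j) = (\<lambda>(i, j). (Suc i, j))" "map_prod (\<lambda>i. i) Suc = (\<lambda>(i, j). (i, Suc j))"
    by (auto simp: fun_eq_iff)
  have "tensor_op H2_disc E_space (mult_op H2_disc (\<lambda>z. z)) (\<lambda>h. h) (HM3.tensor_synth c) = HM3.tensor_synth (shift1 c)"
    if "c \<in> hcarrier l2" for c
    unfolding shift1_def maps(1)[symmetric]
    by (rule HM3.tensor_op_push[OF _ _ _ _ that]) (simp_all add: mult_op_disc_synth push_id)
  moreover have "tensor_op H2_disc E_space (\<lambda>h. h) X0_op (HM3.tensor_synth c) = HM3.tensor_synth (shift2 c)"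
    if "c \<in> hcarrier l2" for c
    unfolding shift2_def maps(2)[symmetric]
    by (rule HM3.tensor_op_push[OF _ _ _ _ that]) (simp_all add: X0_op_E_synth push_id)
  moreover have "vector_space (hscale (htensor H2_disc E_space))"
    using vector_space_fun_scale by (simp add: htensor_def hspace_of_norm_def)
  ultimately show ?thesis using HM3.unitary_tensor_synth by (simp add: shift_model_def)
qed

theorem theorem1:
  "(hilbert_module HM1 \<and> bidisc_contractive HM1) \<and>
   (hilbert_module HM2 \<and> bidisc_contractive HM2) \<and>
   (hilbert_module HM3 \<and> bidisc_contractive HM3) \<and>
   (hilbert_module HM4 \<and> bidisc_contractive HM4) \<and>
   HM1 \<cong>\<^sub>H HM2 \<and> HM2 \<cong>\<^sub>H HM3 \<and> HM3 \<cong>\<^sub>H HM4"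
proof (intro conjI)
  note mod = shift_model_hilbert_module[OF _ shift_model_HM4 HM4_module[unfolded HM4_def]]
  show "hilbert_module HM1" "bidisc_contractive HM1" "hilbert_module HM2" "bidisc_contractive HM2"
    "hilbert_module HM3" "bidisc_contractive HM3"
    unfolding HM1_def HM2_def HM3_def
    by (rule mod[OF shift_model_HM1] mod[OF shift_model_HM2] mod[OF shift_model_HM3])+
  show "hilbert_module HM4" "bidisc_contractive HM4" by (rule HM4_module)+
  show "HM1 \<cong>\<^sub>H HM2" unfolding HM1_def HM2_def by (rule shift_models_iso[OF shift_model_HM1 shift_model_HM2])
  show "HM2 \<cong>\<^sub>H HM3" unfolding HM2_def HM3_def by (rule shift_models_iso[OF shift_model_HM2 shift_model_HM3])
  show "HM3 \<cong>\<^sub>H HM4" unfolding HM3_def HM4_def by (rule shift_models_iso[OF shift_model_HM3 shift_model_HM4])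
qed

end
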